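(* Let $p>1$, $\frac1p+\frac1{p'}=1$, $n\ge 2$, and let $\Omega\subset\mathbb{R}^n$ be a bounded domain with $\partial\Omega\in C^1$. Let $f=(f_1,\dots,f_n)$ be a vector function with $f_i\in C^1(\Omega)\cap C(\overline\Omega)$ and $|f|\neq 0$ in $\Omega$. Let $v>0$ and $w\ge 0$ be measurable functions in $\Omega$ with $v^{1-p}\in L^1(\Omega)$ such that $$-\operatorname{div} f-(p-1)\,v\,|f|^{p'}\ \ge\ w\qquad\text{for a.e. }x\in\Omega .$$ Then for every $u\in C^\infty_{\Gamma_-}(\Omega)$, $u\not\equiv 0$, $$L(u)\ \ge\ \left(\frac1p\right)^p\frac{\bigl(K_0(u)+(p-1)K(u)+N(u)\bigr)^p}{K^{p-1}(u)} .$$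
   Context: Let $\eta$ be the unit outward normal to $\Omega$ on $\partial\Omega$, $\langle\cdot,\cdot\rangle$ the scalar product in $\mathbb{R}^n$, and $dS$ the $(n-1)$-dimensional surface measure. The boundary is split as $\partial\Omega=\Gamma_-\cup\Gamma_+$ with $\Gamma_-=\{x\in\partial\Omega:\langle f,\eta\rangle<0\}$ and $\Gamma_+=\{x\in\partial\Omega:\langle f,\eta\rangle\ge 0\}$. The class $C^\infty_{\Gamma_-}(\Omega)$ consists of the functions $u\in C^\infty(\overline\Omega)$ that vanish in a neighbourhood of $\Gamma_-$. The functionals are $$L(u)=\int_\Omega v^{1-p}\left|\frac{\langle f,\nabla u\rangle}{|f|}\right|^p dx,\quad K_0(u)=\int_{\Gamma_+}\langle f,\eta\rangle|u|^p\,dS,\quad K(u)=\int_\Omega v|f|^{p'}|u|^p\,dx,\quad N(u)=\int_\Omega w|u|^p\,dx .$$ *)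

theory Defs
  imports "HOL-Analysis.Analysis"
begin

section \<open>Differential operators and function classes\<close>

definition partial_deriv :: "'a::euclidean_space \<Rightarrow> ('a \<Rightarrow> 'b::euclidean_space) \<Rightarrow> 'a \<Rightarrow> 'b" where
  "partial_deriv b g x = frechet_derivative g (at x) b"

definition grad :: "('a::euclidean_space \<Rightarrow> real) \<Rightarrow> 'a \<Rightarrow> 'a" where
  "grad u x = (\<Sum>b\<in>Basis. partial_deriv b u x *\<^sub>R b)"

definition divergence :: "('a::euclidean_space \<Rightarrow> 'a) \<Rightarrow> 'a \<Rightarrow> real" where
  "divergence f x = (\<Sum>b\<in>Basis. partial_deriv b f x \<bullet> b)"

text \<open>The following is meant for open \<open>S\<close>.\<close>

definition C1_on :: "'a::euclidean_space set \<Rightarrow> ('a \<Rightarrow> 'b::euclidean_space) \<Rightarrow> bool" where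
  "C1_on S g \<longleftrightarrow> g differentiable_on S \<and> (\<forall>b\<in>Basis. continuous_on S (partial_deriv b g))"

primrec iterated_partial :: "'a::euclidean_space list \<Rightarrow> ('a \<Rightarrow> real) \<Rightarrow> 'a \<Rightarrow> real" where
  "iterated_partial [] u = u"
| "iterated_partial (b # bs) u = partial_deriv b (iterated_partial bs u)"

text \<open>The class \<open>C\<^sup>\<infinity>\<close> of the closure of an open set \<open>\<Omega>\<close>: all partial derivatives of all orders
  exist in \<open>\<Omega>\<close> and extend continuously to the closure.  The boundary values of \<open>u\<close> itself
  are those of its continuous extension; values of \<open>u\<close> off the closure play no role.\<close>

definition Cinf_closure :: "'a::euclidean_space set \<Rightarrow> ('a \<Rightarrow> real) set" where
  "Cinf_closure \<Omega> = {u. continuous_on (closure \<Omega>) u \<and>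
     (\<forall>bs. set bs \<subseteq> Basis \<longrightarrow>
        iterated_partial bs u differentiable_on \<Omega> \<and>
        (\<exists>g. continuous_on (closure \<Omega>) g \<and> (\<forall>x\<in>\<Omega>. g x = iterated_partial bs u x)))}"

section \<open>Domains with boundary of class \<open>C\<^sup>1\<close>\<close>

text \<open>Inside the open set \<open>U\<close>, the set \<open>\<Omega>\<close> lies on one side (selected by the sign \<open>s\<close>) of the graph
  \<open>x\<^sub>b = \<gamma>\<close> of a \<open>C\<^sup>1\<close> function of the other \<open>n - 1\<close> coordinates; such a function is encoded
  as a function on the whole space that is constant along \<open>b\<close>.\<close>

definition graph_chart ::
  "'a::euclidean_space set \<Rightarrow> 'a set \<Rightarrow> 'a \<Rightarrow> real \<Rightarrow> ('a \<Rightarrow> real) \<Rightarrow> bool" where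
  "graph_chart \<Omega> U b s \<gamma> \<longleftrightarrow>
     open U \<and> b \<in> Basis \<and> s \<in> {-1, 1} \<and> C1_on UNIV \<gamma> \<and>
     (\<forall>x t. \<gamma> (x + t *\<^sub>R b) = \<gamma> x) \<and>
     \<Omega> \<inter> U = {x \<in> U. s * (x \<bullet> b) < s * \<gamma> x}"

definition C1_boundary :: "'a::euclidean_space set \<Rightarrow> bool" where
  "C1_boundary \<Omega> \<longleftrightarrow> (\<forall>x\<in>frontier \<Omega>. \<exists>U b s \<gamma>. x \<in> U \<and> graph_chart \<Omega> U b s \<gamma>)"

definition tangent_vectors :: "'a::euclidean_space set \<Rightarrow> 'a \<Rightarrow> 'a set" where
  "tangent_vectors S x = {\<tau>. \<exists>c :: real \<Rightarrow> 'a. c 0 = x \<and> (\<forall>\<^sub>F t in at 0. c t \<in> S) \<and>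
     (c has_vector_derivative \<tau>) (at 0)}"

definition is_outward_unit_normal :: "'a::euclidean_space set \<Rightarrow> 'a \<Rightarrow> 'a \<Rightarrow> bool" where
  "is_outward_unit_normal \<Omega> x \<nu> \<longleftrightarrow>
     norm \<nu> = 1 \<and> (\<forall>\<tau>\<in>tangent_vectors (frontier \<Omega>) x. \<tau> \<bullet> \<nu> = 0) \<and>
     (\<forall>\<^sub>F t in at_right 0. x + t *\<^sub>R \<nu> \<notin> \<Omega> \<and> x - t *\<^sub>R \<nu> \<in> \<Omega>)"

definition outward_normal :: "'a::euclidean_space set \<Rightarrow> 'a \<Rightarrow> 'a" where
  "outward_normal \<Omega> x = (THE \<nu>. is_outward_unit_normal \<Omega> x \<nu>)"

section \<open>Surface measure\<close>

text \<open>The point of the graph \<open>x\<^sub>b = \<gamma>\<close> above \<open>y\<close>, where \<open>y\<close> lists the coordinates other than \<open>b\<close>.\<close>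

definition graph_point :: "'a::euclidean_space \<Rightarrow> ('a \<Rightarrow> real) \<Rightarrow> ('a \<Rightarrow> real) \<Rightarrow> 'a" where
  "graph_point b \<gamma> y =
     (let x = (\<Sum>c\<in>Basis - {b}. y c *\<^sub>R c) in x + \<gamma> x *\<^sub>R b)"

text \<open>The measure \<open>\<zeta> dS\<close> on the graph, where \<open>dS = sqrt (1 + |\<nabla>\<gamma>|\<^sup>2) dy\<close>
  and \<open>dy\<close> is \<open>(n-1)\<close>-dimensional Lebesgue measure.\<close>

definition weighted_graph_measure ::
  "'a::euclidean_space \<Rightarrow> ('a \<Rightarrow> real) \<Rightarrow> ('a \<Rightarrow> real) \<Rightarrow> 'a measure" where
  "weighted_graph_measure b \<gamma> \<zeta> =
     distr
       (density (Pi\<^sub>M (Basis - {b}) (\<lambda>_. lborel))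
          (\<lambda>y. ennreal (\<zeta> (graph_point b \<gamma> y) * sqrt (1 + (norm (grad \<gamma> (graph_point b \<gamma> y)))\<^sup>2))))
       borel (graph_point b \<gamma>)"

text \<open>A finite atlas of graph charts for the boundary together with a subordinate \<open>C\<^sup>1\<close>
  partition of unity near the boundary.\<close>

definition boundary_partition ::
  "'a::euclidean_space set \<Rightarrow> ('a \<times> ('a \<Rightarrow> real) \<times> ('a \<Rightarrow> real)) list \<Rightarrow> bool" where
  "boundary_partition \<Omega> A \<longleftrightarrow>
     (\<forall>(b, \<gamma>, \<zeta>)\<in>set A. C1_on UNIV \<zeta> \<and> (\<forall>x. 0 \<le> \<zeta> x) \<and> bounded {x. \<zeta> x \<noteq> 0} \<and>
        (\<exists>U s. graph_chart \<Omega> U b s \<gamma> \<and> closure {x. \<zeta> x \<noteq> 0} \<subseteq> U)) \<and>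
     (\<exists>W. open W \<and> frontier \<Omega> \<subseteq> W \<and> (\<forall>x\<in>W. (\<Sum>(b, \<gamma>, \<zeta>)\<leftarrow>A. \<zeta> x) = 1))"

text \<open>The surface measure of the boundary of a bounded \<open>\<Omega>\<close> with \<open>C\<^sup>1\<close> boundary, as a Borel measure
  on the whole space carried by the boundary, assembled from the charts by a partition of unity.
  As usual, the result does not depend on the choice of the atlas and of the partition.\<close>

definition surface_measure :: "'a::euclidean_space set \<Rightarrow> 'a measure" where
  "surface_measure \<Omega> =
     measure_of UNIV (sets borel)
       (\<lambda>E. \<Sum>(b, \<gamma>, \<zeta>)\<leftarrow>(SOME A. boundary_partition \<Omega> A).
              emeasure (weighted_graph_measure b \<gamma> \<zeta>) E)"

section \<open>The boundary pieces, the test functions and the functionals\<close>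

definition Gamma_minus :: "'a::euclidean_space set \<Rightarrow> ('a \<Rightarrow> 'a) \<Rightarrow> 'a set" where
  "Gamma_minus \<Omega> f = {x \<in> frontier \<Omega>. f x \<bullet> outward_normal \<Omega> x < 0}"

definition Gamma_plus :: "'a::euclidean_space set \<Rightarrow> ('a \<Rightarrow> 'a) \<Rightarrow> 'a set" where
  "Gamma_plus \<Omega> f = {x \<in> frontier \<Omega>. f x \<bullet> outward_normal \<Omega> x \<ge> 0}"

definition Cinf_Gamma_minus :: "'a::euclidean_space set \<Rightarrow> ('a \<Rightarrow> 'a) \<Rightarrow> ('a \<Rightarrow> real) set" where
  "Cinf_Gamma_minus \<Omega> f = {u \<in> Cinf_closure \<Omega>.
     \<exists>V. open V \<and> Gamma_minus \<Omega> f \<subseteq> V \<and> (\<forall>x\<in>V \<inter> closure \<Omega>. u x = 0)}"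

definition L_fun ::
  "'a::euclidean_space set \<Rightarrow> ('a \<Rightarrow> 'a) \<Rightarrow> ('a \<Rightarrow> real) \<Rightarrow> real \<Rightarrow> ('a \<Rightarrow> real) \<Rightarrow> real" where
  "L_fun \<Omega> f v p u =
     (LINT x|lebesgue_on \<Omega>. v x powr (1 - p) * \<bar>(f x \<bullet> grad u x) / norm (f x)\<bar> powr p)"

definition K0_fun ::
  "'a::euclidean_space set \<Rightarrow> ('a \<Rightarrow> 'a) \<Rightarrow> real \<Rightarrow> ('a \<Rightarrow> real) \<Rightarrow> real" where
  "K0_fun \<Omega> f p u =
     (LINT x:Gamma_plus \<Omega> f|surface_measure \<Omega>. (f x \<bullet> outward_normal \<Omega> x) * \<bar>u x\<bar> powr p)"

definition K_fun ::
  "'a::euclidean_space set \<Rightarrow> ('a \<Rightarrow> 'a) \<Rightarrow> ('a \<Rightarrow> real) \<Rightarrow> real \<Rightarrow> real \<Rightarrow> ('a \<Rightarrow> real) \<Rightarrow> real" where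
  "K_fun \<Omega> f v p p' u =
     (LINT x|lebesgue_on \<Omega>. v x * norm (f x) powr p' * \<bar>u x\<bar> powr p)"

definition N_fun ::
  "'a::euclidean_space set \<Rightarrow> ('a \<Rightarrow> real) \<Rightarrow> real \<Rightarrow> ('a \<Rightarrow> real) \<Rightarrow> real" where
  "N_fun \<Omega> w p u = (LINT x|lebesgue_on \<Omega>. w x * \<bar>u x\<bar> powr p)"

end

theory Submission
  imports Defs
begin

text \<open>Put \<open>F = |u|\<^sup>p f\<close>, so that \<open>div F = |u|\<^sup>p div f + p |u|\<^sup>p\<^sup>-\<^sup>1 sgn u \<langle>f, \<nabla>u\<rangle>\<close>. Since \<open>u\<close> vanishes on \<open>\<Gamma>\<^sub>-\<close>,
  the flux of \<open>F\<close> through the boundary is \<open>K\<^sub>0\<close>. Hence the hypothesis on \<open>div f\<close> and the divergence theorem give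
  \<open>K\<^sub>0 + (p - 1) K + N \<le> p \<integral> |u|\<^sup>p\<^sup>-\<^sup>1 |\<langle>f, \<nabla>u\<rangle>|\<close>, and the right-hand side is at most \<open>p L\<^sup>1\<^sup>/\<^sup>p K\<^sup>1\<^sup>/\<^sup>p\<^sup>'\<close> by
  Hoelder's inequality. As \<open>f\<close> is \<open>C\<^sup>1\<close> only in the open set, \<open>div F\<close> may be unbounded; but it is bounded above,
  and this makes the divergence theorem provable by cutting off near the boundary and monotone convergence.\<close>

section \<open>Calculus of continuously differentiable functions\<close>

text \<open>\<open>surface_measure\<close> is assembled from one partition picked by
  \<open>SOME\<close>, so the divergence theorem is stated for every
  \<open>boundary_partition\<close>, with the boundary term as a sum of chart integrals; it then
  applies to whichever one was picked. The upper bound on div F has two sources: the differential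
  inequality forces div f \<le> 0, first almost everywhere and then everywhere by continuity of div
  f, while the term with grad u extends continuously to the compact closure. With a constant C \<ge>
  div F, the function C - div F is nonnegative, and its integrals against increasing cut-offs have a
  finite limit that can be computed from boundary layers. Integrability of div F is therefore a
  conclusion, and it is also what makes K and N finite. The weights in L and K come from splitting
  |u|^(p-1) |<f, grad u>| into v^(-1/p') |<f, grad u>| / |f| and v^(1/p') |f| |u|^(p-1): the p-th
  power of the first is the integrand of L, the p'-th power of the second that of K.\<close>

lemma partial_deriv_eqI:
  assumes "(g has_derivative g') (at x)"
  shows "partial_deriv b g x = g' b"
  using frechet_derivative_at[OF assms] by (simp add: partial_deriv_def)

lemma C1_onI:
  assumes "open S" and "\<And>x. x \<in> S \<Longrightarrow> (g has_derivative g' x) (at x)"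
    and "\<And>b. b \<in> Basis \<Longrightarrow> continuous_on S (\<lambda>x. g' x b)"
  shows "C1_on S g"
  unfolding C1_on_def
proof
  show "g differentiable_on S"
    using assms(2) by (meson differentiable_at_withinI differentiable_def differentiable_on_def)
  show "\<forall>b\<in>Basis. continuous_on S (partial_deriv b g)"
    using assms(3) partial_deriv_eqI[OF assms(2)]
    by (auto intro!: continuous_on_eq[OF assms(3)])
qed

lemma C1_on_frechet:
  assumes "open S" "C1_on S g" "x \<in> S"
  shows "(g has_derivative frechet_derivative g (at x)) (at x)"
  using assms by (metis C1_on_def at_within_open differentiable_on_def frechet_derivative_works)

lemma C1_on_continuous_frechet:
  assumes "C1_on S g" "b \<in> Basis"
  shows "continuous_on S (\<lambda>x. frechet_derivative g (at x) b)"
  using assms by (simp add: C1_on_def partial_deriv_def[abs_def])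

lemma C1_on_imp_continuous_on: "C1_on S g \<Longrightarrow> continuous_on S g"
  by (simp add: C1_on_def differentiable_imp_continuous_on)

lemma C1_on_subset: "C1_on S g \<Longrightarrow> T \<subseteq> S \<Longrightarrow> C1_on T g"
  unfolding C1_on_def by (meson continuous_on_subset differentiable_on_subset)

lemma grad_eqI:
  fixes g :: "'a::euclidean_space \<Rightarrow> real"
  assumes "(g has_derivative (\<lambda>h. D \<bullet> h)) (at x)"
  shows "grad g x = D"
  using euclidean_representation[of D] by (simp add: grad_def partial_deriv_eqI[OF assms])

lemma has_derivative_grad:
  fixes g :: "'a::euclidean_space \<Rightarrow> real"
  assumes "g differentiable at x"
  shows "(g has_derivative (\<lambda>h. grad g x \<bullet> h)) (at x)"
proof -
  define g' where "g' = frechet_derivative g (at x)"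
  have g': "(g has_derivative g') (at x)"
    using assms by (simp add: g'_def frechet_derivative_works)
  then have lin: "linear g'" by (rule has_derivative_linear)
  have "g' h = grad g x \<bullet> h" for h
  proof -
    have "g' h = g' (\<Sum>b\<in>Basis. (h \<bullet> b) *\<^sub>R b)" by (simp add: euclidean_representation)
    also have "\<dots> = (\<Sum>b\<in>Basis. (h \<bullet> b) * g' b)"
      by (simp add: linear_sum[OF lin] linear_scale[OF lin])
    also have "\<dots> = grad g x \<bullet> h"
      by (simp add: grad_def partial_deriv_def g'_def[symmetric] inner_sum_left inner_commute[of h] mult.commute)
    finally show ?thesis .
  qed
  then have "g' = (\<lambda>h. grad g x \<bullet> h)" by blast
  then show ?thesis using g' by simp
qed

lemma C1_on_has_derivative_grad:
  fixes g :: "'a::euclidean_space \<Rightarrow> real"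
  assumes "open S" "C1_on S g" "x \<in> S"
  shows "(g has_derivative (\<lambda>h. grad g x \<bullet> h)) (at x)"
  using assms by (intro has_derivative_grad) (metis C1_on_def at_within_open differentiable_on_def)

lemma C1_on_continuous_on_grad:
  fixes g :: "'a::euclidean_space \<Rightarrow> real"
  assumes "C1_on S g"
  shows "continuous_on S (grad g)"
  using assms unfolding grad_def[abs_def] C1_on_def
  by (intro continuous_on_sum continuous_on_scaleR continuous_on_const) auto

lemma C1_on_gradI:
  fixes g :: "'a::euclidean_space \<Rightarrow> real"
  assumes "open S" "\<And>x. x \<in> S \<Longrightarrow> (g has_derivative (\<lambda>h. D x \<bullet> h)) (at x)" "continuous_on S D"
  shows "C1_on S g"
  by (rule C1_onI[OF assms(1,2)]) (use assms(3) in \<open>auto intro: continuous_on_inner\<close>)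

lemma C1_on_const [simp]:
  fixes c :: real
  assumes "open S"
  shows "C1_on S (\<lambda>x. c)" 
  by (rule C1_on_gradI[OF assms, where D = "\<lambda>_. 0"]) auto

lemma C1_on_add:
  fixes g h :: "'a::euclidean_space \<Rightarrow> real"
  assumes "open S" "C1_on S g" "C1_on S h"
  shows "C1_on S (\<lambda>x. g x + h x)" and "x \<in> S \<Longrightarrow> grad (\<lambda>x. g x + h x) x = grad g x + grad h x"
proof -
  note D = C1_on_has_derivative_grad[OF assms(1,2)] C1_on_has_derivative_grad[OF assms(1,3)]
  have *: "((\<lambda>x. g x + h x) has_derivative (\<lambda>v. (grad g x + grad h x) \<bullet> v)) (at x)" if "x \<in> S" for x
    using has_derivative_add[OF D(1)[OF that] D(2)[OF that]] by (simp add: inner_add_left)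
  show "C1_on S (\<lambda>x. g x + h x)"
    by (rule C1_on_gradI[OF assms(1) *])
      (use assms C1_on_continuous_on_grad in \<open>auto intro: continuous_on_add\<close>)
  show "x \<in> S \<Longrightarrow> grad (\<lambda>x. g x + h x) x = grad g x + grad h x"
    using * by (rule grad_eqI)
qed

lemma C1_on_mult:
  fixes g h :: "'a::euclidean_space \<Rightarrow> real"
  assumes "open S" "C1_on S g" "C1_on S h"
  shows "C1_on S (\<lambda>x. g x * h x)"
    and "x \<in> S \<Longrightarrow> grad (\<lambda>x. g x * h x) x = g x *\<^sub>R grad h x + h x *\<^sub>R grad g x"
proof -
  note D = C1_on_has_derivative_grad[OF assms(1,2)] C1_on_has_derivative_grad[OF assms(1,3)]
  have *: "((\<lambda>x. g x * h x) has_derivative (\<lambda>v. (g x *\<^sub>R grad h x + h x *\<^sub>R grad g x) \<bullet> v)) (at x)"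
    if "x \<in> S" for x
    using has_derivative_mult[OF D(1)[OF that] D(2)[OF that]] by (simp add: inner_add_left mult.commute)
  show "C1_on S (\<lambda>x. g x * h x)"
    using assms C1_on_continuous_on_grad C1_on_imp_continuous_on
    by (intro C1_on_gradI[OF assms(1) *] continuous_on_add continuous_on_scaleR) auto
  show "x \<in> S \<Longrightarrow> grad (\<lambda>x. g x * h x) x = g x *\<^sub>R grad h x + h x *\<^sub>R grad g x"
    using * by (rule grad_eqI)
qed

text \<open>The outer function is constrained only along the values of \<open>g\<close>, which
  admits \<open>inverse\<close> after a positive function as well as functions smooth on the whole
  line.\<close>

lemma C1_on_compose:
  fixes g :: "'a::euclidean_space \<Rightarrow> real"
  assumes "open S" "C1_on S g"
    and "\<And>x. x \<in> S \<Longrightarrow> (\<phi> has_real_derivative \<phi>' (g x)) (at (g x))"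
    and "continuous_on S (\<lambda>x. \<phi>' (g x))"
  shows "C1_on S (\<lambda>x. \<phi> (g x))"
    and "x \<in> S \<Longrightarrow> grad (\<lambda>x. \<phi> (g x)) x = \<phi>' (g x) *\<^sub>R grad g x"
proof -
  have *: "((\<lambda>x. \<phi> (g x)) has_derivative (\<lambda>v. (\<phi>' (g x) *\<^sub>R grad g x) \<bullet> v)) (at x)" if "x \<in> S" for x
    using has_derivative_compose[OF C1_on_has_derivative_grad[OF assms(1,2) that]
        assms(3)[OF that, unfolded has_field_derivative_def]]
    by simp
  show "C1_on S (\<lambda>x. \<phi> (g x))"
    using assms C1_on_continuous_on_grad
    by (intro C1_on_gradI[OF assms(1) *] continuous_on_scaleR) auto
  show "x \<in> S \<Longrightarrow> grad (\<lambda>x. \<phi> (g x)) x = \<phi>' (g x) *\<^sub>R grad g x"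
    using * by (rule grad_eqI)
qed

lemma C1_on_cmult:
  fixes g :: "'a::euclidean_space \<Rightarrow> real"
  assumes "open S" "C1_on S g"
  shows "C1_on S (\<lambda>x. c * g x)" and "x \<in> S \<Longrightarrow> grad (\<lambda>x. c * g x) x = c *\<^sub>R grad g x"
proof -
  have D: "((*) c has_real_derivative c) (at t)" for t
    by (auto intro!: derivative_eq_intros)
  show "C1_on S (\<lambda>x. c * g x)" by (rule C1_on_compose(1)[OF assms D]) simp
  show "x \<in> S \<Longrightarrow> grad (\<lambda>x. c * g x) x = c *\<^sub>R grad g x"
    by (rule C1_on_compose(2)[OF assms D]) simp_all
qed

lemma C1_on_diff:
  fixes g h :: "'a::euclidean_space \<Rightarrow> real"
  assumes "open S" "C1_on S g" "C1_on S h"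
  shows "C1_on S (\<lambda>x. g x - h x)" and "x \<in> S \<Longrightarrow> grad (\<lambda>x. g x - h x) x = grad g x - grad h x"
  using C1_on_add(1)[OF assms(1,2) C1_on_cmult(1)[OF assms(1,3), of "-1"]]
    C1_on_add(2)[OF assms(1,2) C1_on_cmult(1)[OF assms(1,3), of "-1"], of x]
    C1_on_cmult(2)[OF assms(1,3), of x "-1"]
  by auto

text \<open>Both claims are proved in one induction because the gradient rule for a sum requires the
  tail to be \<open>C1_on\<close> already.\<close>

lemma C1_on_sum_list:
  fixes g :: "'b \<Rightarrow> 'a::euclidean_space \<Rightarrow> real"
  assumes "open S" "\<And>i. i \<in> set A \<Longrightarrow> C1_on S (g i)"
  shows "C1_on S (\<lambda>x. \<Sum>i\<leftarrow>A. g i x) \<and> (\<forall>x\<in>S. grad (\<lambda>x. \<Sum>i\<leftarrow>A. g i x) x = (\<Sum>i\<leftarrow>A. grad (g i) x))"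
  using assms(2)
proof (induction A)
  case Nil
  have "grad (\<lambda>x. 0::real) x = 0" for x :: 'a by (rule grad_eqI) simp
  then show ?case using assms by simp
next
  case (Cons a A)
  have 1: "C1_on S (g a)" using Cons.prems by simp
  have 2: "C1_on S (\<lambda>x. \<Sum>i\<leftarrow>A. g i x)"
    and 3: "\<forall>x\<in>S. grad (\<lambda>x. \<Sum>i\<leftarrow>A. g i x) x = (\<Sum>i\<leftarrow>A. grad (g i) x)"
    using Cons by auto
  show ?case using C1_on_add[OF assms(1) 1 2] 3 by simp
qed

lemma C1_on_inner_const: "open S \<Longrightarrow> C1_on S (\<lambda>x. x \<bullet> b)"
  and grad_inner_const: "grad (\<lambda>x. x \<bullet> b) y = b"
proof -
  have *: "((\<lambda>x. x \<bullet> b) has_derivative (\<lambda>h. b \<bullet> h)) (at y)" for y :: 'a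
    by (auto intro!: derivative_eq_intros simp: inner_commute)
  show "grad (\<lambda>x. x \<bullet> b) y = b" using * by (rule grad_eqI)
  show "open S \<Longrightarrow> C1_on S (\<lambda>x. x \<bullet> b)" by (rule C1_on_gradI[OF _ *]) auto
qed

lemma C1_on_scaleR:
  fixes \<theta> :: "'a::euclidean_space \<Rightarrow> real" and F :: "'a \<Rightarrow> 'a"
  assumes "open S" "C1_on S \<theta>" "C1_on S F"
  shows "C1_on S (\<lambda>x. \<theta> x *\<^sub>R F x)"
    and "x \<in> S \<Longrightarrow> divergence (\<lambda>x. \<theta> x *\<^sub>R F x) x = \<theta> x * divergence F x + grad \<theta> x \<bullet> F x"
proof -
  define F' where "F' x = frechet_derivative F (at x)" for x
  have *: "((\<lambda>x. \<theta> x *\<^sub>R F x) has_derivative (\<lambda>v. \<theta> x *\<^sub>R F' x v + (grad \<theta> x \<bullet> v) *\<^sub>R F x)) (at x)"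
    if "x \<in> S" for x
    using has_derivative_scaleR[OF C1_on_has_derivative_grad[OF assms(1,2) that]
        C1_on_frechet[OF assms(1,3) that]] by (simp add: F'_def)
  have "continuous_on S \<theta>" "continuous_on S F" "continuous_on S (grad \<theta>)"
    using assms by (simp_all add: C1_on_imp_continuous_on C1_on_continuous_on_grad)
  moreover have "continuous_on S (\<lambda>x. F' x b)" if "b \<in> Basis" for b
    using C1_on_continuous_frechet[OF assms(3) that] by (simp add: F'_def)
  ultimately show "C1_on S (\<lambda>x. \<theta> x *\<^sub>R F x)"
    by (intro C1_onI[OF assms(1) *] continuous_intros)
  assume x: "x \<in> S"
  have "divergence (\<lambda>x. \<theta> x *\<^sub>R F x) x = (\<Sum>b\<in>Basis. \<theta> x * (F' x b \<bullet> b) + (grad \<theta> x \<bullet> b) * (F x \<bullet> b))"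
    by (simp add: divergence_def partial_deriv_eqI[OF *[OF x]] inner_add_left)
  also have "\<dots> = \<theta> x * divergence F x + grad \<theta> x \<bullet> F x"
    unfolding euclidean_inner[of "grad \<theta> x" "F x"]
    by (simp add: sum.distrib sum_distrib_left divergence_def partial_deriv_def F'_def)
  finally show "divergence (\<lambda>x. \<theta> x *\<^sub>R F x) x = \<theta> x * divergence F x + grad \<theta> x \<bullet> F x" .
qed

lemma C1_on_continuous_on_divergence: "C1_on S F \<Longrightarrow> continuous_on S (divergence F)"
  unfolding divergence_def[abs_def] C1_on_def
  by (intro continuous_on_sum continuous_on_inner continuous_on_const) auto

section \<open>Integration by parts for compact supports\<close>

text \<open>By translation invariance of Lebesgue measure every difference quotient in direction
  \<open>c\<close> has integral zero, and dominated convergence hands this on to the derivative,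
  which is measurable as their limit.\<close>

lemma integral_directional_derivative_eq_0:
  fixes \<phi> :: "'a::euclidean_space \<Rightarrow> real"
  assumes deriv: "\<And>x. (\<phi> has_derivative \<phi>' x) (at x)"
    and bound: "\<And>x. \<bar>\<phi>' x c\<bar> \<le> C"
    and supp: "bounded {x. \<phi> x \<noteq> 0}"
  shows "integrable lborel (\<lambda>x. \<phi>' x c)" and "(LINT x|lborel. \<phi>' x c) = 0"
proof -
  have cont: "continuous_on S \<phi>" for S
    by (rule has_derivative_continuous_on[OF has_derivative_at_withinI[OF deriv]])
  then have [measurable]: "\<phi> \<in> borel_measurable borel"
    by (rule borel_measurable_continuous_onI)
  obtain R where R: "\<And>x. \<phi> x \<noteq> 0 \<Longrightarrow> norm x \<le> R"
    using supp by (auto simp: bounded_iff)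
  have int_\<phi>: "integrable lborel \<phi>"
  proof -
    have "integrable lborel (\<lambda>x. indicator (cball 0 R) x *\<^sub>R \<phi> x)"
      by (rule borel_integrable_compact[OF compact_cball cont])
    also have "(\<lambda>x. indicator (cball 0 R) x *\<^sub>R \<phi> x) = \<phi>"
      using R by (force simp: indicator_def)
    finally show ?thesis .
  qed
  define q where "q n x = real (Suc n) * (\<phi> (x + inverse (real (Suc n)) *\<^sub>R c) - \<phi> x)" for n x
  have [measurable]: "q n \<in> borel_measurable borel" for n
    unfolding q_def[abs_def] by measurable
  have line: "((\<lambda>t. \<phi> (x + t *\<^sub>R c)) has_real_derivative \<phi>' (x + t *\<^sub>R c) c) (at t)" for x t
  proof -
    have "((\<lambda>t. \<phi> (x + t *\<^sub>R c)) has_derivative (\<lambda>s. \<phi>' (x + t *\<^sub>R c) (s *\<^sub>R c))) (at t)"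
      by (rule has_derivative_compose[OF _ deriv]) (auto intro!: derivative_eq_intros)
    moreover have "\<phi>' (x + t *\<^sub>R c) (s *\<^sub>R c) = \<phi>' (x + t *\<^sub>R c) c * s" for s
      using linear_scale[OF has_derivative_linear[OF deriv]] by (simp add: mult.commute)
    ultimately show ?thesis by (simp add: has_field_derivative_def)
  qed
  \<comment> \<open>The mean value theorem supplies the bound \<open>C\<close>. The step lengths are
    at most 1, so all quotients vanish off the ball of radius \<open>R + norm c\<close>.\<close>
  have q_bound: "norm (q n x) \<le> C * indicator (cball 0 (R + norm c)) x" for n x
  proof (cases "x \<in> cball 0 (R + norm c)")
    case True
    obtain z where z: "\<phi> (x + inverse (real (Suc n)) *\<^sub>R c) - \<phi> (x + 0 *\<^sub>R c)
        = (inverse (real (Suc n)) - 0) * \<phi>' (x + z *\<^sub>R c) c"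
      using MVT2[of 0 "inverse (real (Suc n))" "\<lambda>t. \<phi> (x + t *\<^sub>R c)" "\<lambda>t. \<phi>' (x + t *\<^sub>R c) c"] line
      by auto
    then have "q n x = \<phi>' (x + z *\<^sub>R c) c" by (simp add: q_def field_simps)
    then show ?thesis using True bound by simp
  next
    case False
    have "norm (x + inverse (real (Suc n)) *\<^sub>R c) \<ge> norm x - norm (inverse (real (Suc n)) *\<^sub>R c)"
      by (metis norm_diff_ineq)
    moreover have "norm (inverse (real (Suc n)) *\<^sub>R c) \<le> norm c"
      using mult_right_mono[of "inverse (real (Suc n))" 1 "norm c"] by (simp add: field_simps)
    moreover have "norm x > R + norm c" using False by simp
    ultimately have "\<not> norm (x + inverse (real (Suc n)) *\<^sub>R c) \<le> R" "\<not> norm x \<le> R"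
      using norm_ge_zero[of c] by linarith+
    then have "\<phi> (x + inverse (real (Suc n)) *\<^sub>R c) = 0" "\<phi> x = 0"
      using R by blast+
    then show ?thesis using False by (simp add: q_def)
  qed
  have q_lim: "(\<lambda>n. q n x) \<longlonglongrightarrow> \<phi>' x c" for x
  proof -
    have "((\<lambda>h. (\<phi> (x + h *\<^sub>R c) - \<phi> x) / h) \<longlongrightarrow> \<phi>' x c) (at 0)"
      using line[of x 0] by (simp add: DERIV_def)
    moreover have "filterlim (\<lambda>n. inverse (real (Suc n))) (at 0) sequentially"
      by (intro filterlim_atI LIMSEQ_inverse_real_of_nat) auto
    ultimately have "(\<lambda>n. (\<phi> (x + inverse (real (Suc n)) *\<^sub>R c) - \<phi> x) / inverse (real (Suc n))) \<longlonglongrightarrow> \<phi>' x c"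
      by (rule filterlim_compose)
    then show ?thesis by (simp add: q_def field_simps)
  qed
  have [measurable]: "(\<lambda>x. \<phi>' x c) \<in> borel_measurable borel"
    by (rule borel_measurable_LIMSEQ_real[OF q_lim]) simp
  have dom: "integrable lborel (\<lambda>x::'a. C * indicator (cball 0 (R + norm c)) x :: real)"
    by (intro integrable_mult_right integrable_real_indicator) (use emeasure_lborel_cball_finite[of "0::'a" "R + norm c"] in \<open>auto simp: infinity_ennreal_def\<close>)
  show "integrable lborel (\<lambda>x. \<phi>' x c)"
    by (rule integrable_dominated_convergence[OF _ _ dom, of _ q]) (use q_lim q_bound in auto)
  have "(\<lambda>n. LINT x|lborel. q n x) \<longlonglongrightarrow> (LINT x|lborel. \<phi>' x c)"
    by (rule integral_dominated_convergence[OF _ _ dom]) (use q_lim q_bound in auto)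
  moreover have "(LINT x|lborel. q n x) = 0" for n
  proof -
    let ?a = "inverse (real (Suc n)) *\<^sub>R c"
    have d: "distr lborel borel ((+) ?a) = (lborel :: 'a measure)"
      by (rule lborel_distr_plus)
    have "integrable (distr lborel borel ((+) ?a)) \<phi>" using int_\<phi> d by simp
    then have i: "integrable lborel (\<lambda>x. \<phi> (x + ?a))"
      by (subst (asm) integrable_distr_eq) (auto simp: add.commute)
    have "(LINT x|lborel. \<phi> (x + ?a)) = (LINT x|distr lborel borel ((+) ?a). \<phi> x)"
      by (subst integral_distr) (auto simp: add.commute)
    also have "\<dots> = (LINT x|lborel. \<phi> x)" using d by simp
    finally show ?thesis unfolding q_def using i int_\<phi> by simp
  qed
  ultimately show "(LINT x|lborel. \<phi>' x c) = 0"
    by (simp add: LIMSEQ_const_iff)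
qed

lemma set_integrable_compact_support:
  fixes g :: "'a::euclidean_space \<Rightarrow> real"
  assumes "continuous_on S g" "compact K" "K \<subseteq> S" "\<And>x. x \<in> S - K \<Longrightarrow> g x = 0"
  shows "set_integrable lborel S g"
proof -
  have "integrable lborel (\<lambda>x. indicator K x *\<^sub>R g x)"
    using assms(2) continuous_on_subset[OF assms(1,3)] by (rule borel_integrable_compact)
  also have "(\<lambda>x. indicator K x *\<^sub>R g x) = (\<lambda>x. indicator S x *\<^sub>R g x)"
    using assms(3,4) by (force simp: indicator_def)
  finally show ?thesis by (simp add: set_integrable_def)
qed

text \<open>The components of \<open>\<Psi>\<close> extend by zero to differentiable functions on
  the whole space, since \<open>S\<close> and \<open>- K\<close> are open and cover it. Each
  diagonal partial derivative then integrates to zero.\<close>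

lemma divergence_compact_support:
  fixes \<Psi> :: "'a::euclidean_space \<Rightarrow> 'a"
  assumes "open S" "C1_on S \<Psi>" "compact K" "K \<subseteq> S" "\<And>x. x \<in> S - K \<Longrightarrow> \<Psi> x = 0"
  shows "(LINT x:S|lborel. divergence \<Psi> x) = 0"
proof -
  define \<Psi>' where "\<Psi>' x = frechet_derivative \<Psi> (at x)" for x
  have d\<Psi>: "(\<Psi> has_derivative \<Psi>' x) (at x)" if "x \<in> S" for x
    using C1_on_frechet[OF assms(1,2) that] by (simp add: \<Psi>'_def)
  have zero: "\<Psi>' x = (\<lambda>_. 0)" if "x \<in> S - K" for x
  proof -
    have "open (S - K)" using assms(1,3) by (simp add: compact_imp_closed open_Diff)
    then have "(\<Psi> has_derivative (\<lambda>_. 0)) (at x)"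
      using assms(5) that by (intro has_derivative_transform_within_open[OF has_derivative_const, where s = "S - K"]) auto
    then show ?thesis using d\<Psi> that by (metis DiffD1 has_derivative_unique)
  qed
  define \<Phi> where "\<Phi> b x = (if x \<in> S then \<Psi> x \<bullet> b else 0)" for b x
  define \<Phi>' where "\<Phi>' b x h = (if x \<in> S then \<Psi>' x h \<bullet> b else 0)" for b x h
  have deriv: "(\<Phi> b has_derivative \<Phi>' b x) (at x)" for b x
  proof (cases "x \<in> S")
    case True
    have "((\<lambda>x. \<Psi> x \<bullet> b) has_derivative (\<lambda>h. \<Psi>' x h \<bullet> b)) (at x)"
      by (rule has_derivative_inner_left[OF d\<Psi>[OF True]])
    then have "(\<Phi> b has_derivative (\<lambda>h. \<Psi>' x h \<bullet> b)) (at x)"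
      by (rule has_derivative_transform_within_open[OF _ assms(1) True]) (simp add: \<Phi>_def)
    then show ?thesis using True by (simp add: \<Phi>'_def[abs_def])
  next
    case False
    have "(\<Phi> b has_derivative (\<lambda>_. 0)) (at x)"
      by (rule has_derivative_transform_within_open[OF has_derivative_const, where s = "- K"])
        (use False assms(3,4,5) in \<open>auto simp: \<Phi>_def compact_imp_closed open_Compl\<close>)
    then show ?thesis using False by (simp add: \<Phi>'_def[abs_def])
  qed
  have "\<Phi> b x = 0" if "x \<notin> K" for b x
    using assms(5)[of x] that by (auto simp: \<Phi>_def)
  then have supp: "bounded {x. \<Phi> b x \<noteq> 0}" for b
    by (intro bounded_subset[OF compact_imp_bounded[OF assms(3)]]) blast
  have bound: "\<exists>C. \<forall>x. \<bar>\<Phi>' b x b\<bar> \<le> C" if "b \<in> Basis" for b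
  proof -
    have "continuous_on S (\<lambda>x. \<Psi>' x b)"
      using C1_on_continuous_frechet[OF assms(2) that] by (simp add: \<Psi>'_def)
    then have "continuous_on K (\<lambda>x. \<Psi>' x b \<bullet> b)"
      using assms(4) by (intro continuous_on_inner continuous_on_const) (rule continuous_on_subset)
    then have "bounded ((\<lambda>x. \<Psi>' x b \<bullet> b) ` K)"
      using assms(3) by (simp add: compact_continuous_image compact_imp_bounded)
    then obtain C where C: "C > 0" "\<And>x. x \<in> K \<Longrightarrow> \<bar>\<Psi>' x b \<bullet> b\<bar> \<le> C"
      by (auto simp: bounded_pos)
    have "\<bar>\<Phi>' b x b\<bar> \<le> C" for x
      using C zero[of x] by (cases "x \<in> K") (auto simp: \<Phi>'_def)
    then show ?thesis by blast
  qed
  have *: "integrable lborel (\<lambda>x. \<Phi>' b x b)" "(LINT x|lborel. \<Phi>' b x b) = 0" if b: "b \<in> Basis" for b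
    using bound[OF b] integral_directional_derivative_eq_0[OF deriv _ supp, of b b] by blast+
  have "indicator S x *\<^sub>R divergence \<Psi> x = (\<Sum>b\<in>Basis. \<Phi>' b x b)" for x
    by (auto simp: divergence_def partial_deriv_def \<Phi>'_def \<Psi>'_def indicator_def)
  then show ?thesis
    unfolding set_lebesgue_integral_def using * by (simp add: Bochner_Integration.integral_sum)
qed

text \<open>The field \<open>\<theta> F\<close> has compact support in \<open>S\<close>, so its
  divergence integrates to zero and the product rule splits it. The cut-off keeps all integrands
  away from the boundary, where div F is not controlled.\<close>

lemma integral_by_parts_compact_support:
  fixes F :: "'a::euclidean_space \<Rightarrow> 'a" and \<theta> :: "'a \<Rightarrow> real"
  assumes "open S" "C1_on S F" "C1_on S \<theta>"
    and K: "compact K" "K \<subseteq> S" "\<And>x. x \<in> S - K \<Longrightarrow> \<theta> x = 0"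
  shows "set_integrable lborel S (\<lambda>x. \<theta> x * divergence F x)"
    and "set_integrable lborel S (\<lambda>x. grad \<theta> x \<bullet> F x)"
    and "(LINT x:S|lborel. \<theta> x * divergence F x) = - (LINT x:S|lborel. grad \<theta> x \<bullet> F x)"
proof -
  have cont: "continuous_on S \<theta>" "continuous_on S F" "continuous_on S (grad \<theta>)" "continuous_on S (divergence F)"
    using assms by (simp_all add: C1_on_imp_continuous_on C1_on_continuous_on_grad C1_on_continuous_on_divergence)
  have zero: "grad \<theta> x = 0" if "x \<in> S - K" for x
  proof (rule grad_eqI)
    have "open (S - K)" using assms(1) K(1) by (simp add: compact_imp_closed open_Diff)
    then have "(\<theta> has_derivative (\<lambda>_. 0)) (at x)"
      using K(3) that by (intro has_derivative_transform_within_open[OF has_derivative_const, where s = "S - K"]) auto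
    then show "(\<theta> has_derivative (\<lambda>h. 0 \<bullet> h)) (at x)" by simp
  qed
  show 1: "set_integrable lborel S (\<lambda>x. \<theta> x * divergence F x)"
    by (rule set_integrable_compact_support[OF _ K(1,2)])
      (use cont K(3) in \<open>auto intro: continuous_on_mult\<close>)
  show 2: "set_integrable lborel S (\<lambda>x. grad \<theta> x \<bullet> F x)"
    by (rule set_integrable_compact_support[OF _ K(1,2)])
      (use cont zero in \<open>auto intro: continuous_on_inner\<close>)
  have "0 = (LINT x:S|lborel. divergence (\<lambda>x. \<theta> x *\<^sub>R F x) x)"
    by (rule divergence_compact_support[symmetric, OF assms(1) C1_on_scaleR(1)[OF assms(1,3,2)] K(1,2)])
      (use K(3) in auto)
  also have "\<dots> = (LINT x:S|lborel. \<theta> x * divergence F x + grad \<theta> x \<bullet> F x)"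
    by (rule set_lebesgue_integral_cong) (use assms(1) C1_on_scaleR(2)[OF assms(1,3,2)] in auto)
  also have "\<dots> = (LINT x:S|lborel. \<theta> x * divergence F x) + (LINT x:S|lborel. grad \<theta> x \<bullet> F x)"
    by (rule set_integral_add(2)[OF 1 2])
  finally show "(LINT x:S|lborel. \<theta> x * divergence F x) = - (LINT x:S|lborel. grad \<theta> x \<bullet> F x)"
    by simp
qed

section \<open>Boundary layers in graph charts\<close>

text \<open>The squared positive part is the elementary C1 function vanishing on a half-line; the
  step function, the bumps and the regularised denominator of the partition of unity are all built
  from it.\<close>

lemma has_real_derivative_max_0_power2:
  "((\<lambda>t. (max 0 t)\<^sup>2) has_real_derivative 2 * max 0 t) (at (t::real))"
proof -
  consider "t < 0" | "t > 0" | "t = 0" by linarith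
  then show ?thesis
  proof cases
    case 1
    have "((\<lambda>_. 0) has_real_derivative 2 * max 0 t) (at t)"
      using 1 by simp
    then show ?thesis
      by (rule has_field_derivative_transform_within_open[where S = "{..<0}"]) (use 1 in auto)
  next
    case 2
    have "((\<lambda>t. t\<^sup>2) has_real_derivative 2 * max 0 t) (at t)"
      using 2 by (auto intro!: derivative_eq_intros)
    then show ?thesis
      by (rule has_field_derivative_transform_within_open[where S = "{0<..}"]) (use 2 in auto)
  next
    case 3
    have "((\<lambda>h::real. max 0 h) \<longlongrightarrow> max 0 0) (at 0)"
      by (intro tendsto_intros)
    moreover have "\<forall>\<^sub>F h::real in at 0. max 0 h = ((max 0 (0 + h))\<^sup>2 - (max 0 0)\<^sup>2) / h"
      by (auto simp: eventually_at_filter max_def power2_eq_square)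
    ultimately show ?thesis
      unfolding DERIV_def 3 using Lim_transform_eventually by fastforce
  qed
qed

text \<open>The transition is placed in \<open>{1..2}\<close>, so that rescaling the argument by n
  gives a function that is zero up to depth 1/n; this yields compact supports inside the domain. The
  derivative of mass 1 acts as an approximate delta on the boundary.\<close>

lemma smooth_step:
  obtains \<eta> \<eta>' :: "real \<Rightarrow> real"
  where "\<And>t. (\<eta> has_real_derivative \<eta>' t) (at t)" "continuous_on UNIV \<eta>'" "mono \<eta>"
    "\<And>t. t \<le> 1 \<Longrightarrow> \<eta> t = 0" "\<And>t. t \<ge> 2 \<Longrightarrow> \<eta> t = 1"
    "\<And>t. t \<notin> {1..2} \<Longrightarrow> \<eta>' t = 0" "\<And>t. \<bar>\<eta>' t\<bar> \<le> 2"
    "integrable lborel \<eta>'" "(LINT t|lborel. \<eta>' t) = 1"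
proof
  define P where "P t = (max 0 t)\<^sup>2" for t :: real
  \<comment> \<open>A second difference of parabolas: \<open>\<eta>'\<close> is the hat on
    \<open>{1..2}\<close> with peak 2 at 3/2, hence with area 1.\<close>
  define \<eta> where "\<eta> t = 2 * (P (t - 1) - 2 * P (t - 3/2) + P (t - 2))" for t
  define \<eta>' where "\<eta>' t = 4 * (max 0 (t - 1) - 2 * max 0 (t - 3/2) + max 0 (t - 2))" for t :: real
  have P: "((\<lambda>t. P (t - a)) has_real_derivative 2 * max 0 (t - a)) (at t)" for t a
    using DERIV_shift[of P "2 * max 0 (t - a)" t "- a"] has_real_derivative_max_0_power2[of "t - a"]
    unfolding P_def[abs_def] by simp
  show D: "(\<eta> has_real_derivative \<eta>' t) (at t)" for t
    unfolding \<eta>_def[abs_def] \<eta>'_def by (auto intro!: derivative_eq_intros P)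
  show cont: "continuous_on UNIV \<eta>'"
    unfolding \<eta>'_def[abs_def] by (intro continuous_intros)
  have nonneg: "0 \<le> \<eta>' t" for t by (simp add: \<eta>'_def max_def)
  then show "mono \<eta>" by (meson D DERIV_nonneg_imp_nondecreasing monoI)
  show z: "\<eta> t = 0" if "t \<le> 1" for t using that by (simp add: \<eta>_def P_def)
  show o: "\<eta> t = 1" if "t \<ge> 2" for t using that by (simp add: \<eta>_def P_def power2_eq_square algebra_simps)
  show supp: "\<eta>' t = 0" if "t \<notin> {1..2}" for t using that by (auto simp: \<eta>'_def max_def)
  show "\<bar>\<eta>' t\<bar> \<le> 2" for t by (auto simp: \<eta>'_def max_def abs_if)
  have "has_bochner_integral lborel (\<lambda>t. indicator {1..2} t *\<^sub>R \<eta>' t) (\<eta> 2 - \<eta> 1)"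
    by (rule has_bochner_integral_FTC_Icc)
      (use D cont in \<open>auto simp: has_real_derivative_iff_has_vector_derivative
         intro: has_vector_derivative_at_within continuous_on_subset\<close>)
  moreover have "(\<lambda>t. indicator {1..2} t *\<^sub>R \<eta>' t) = \<eta>'"
    using supp by (force simp: indicator_def)
  ultimately have "has_bochner_integral lborel \<eta>' 1" using z o by simp
  then show "integrable lborel \<eta>'" "(LINT t|lborel. \<eta>' t) = 1"
    by (simp_all add: has_bochner_integral_iff)
qed

section \<open>Shear coordinates over a graph\<close>

abbreviation hyperplane_measure :: "'a::euclidean_space \<Rightarrow> ('a \<Rightarrow> real) measure" where
  "hyperplane_measure b \<equiv> Pi\<^sub>M (Basis - {b}) (\<lambda>_. lborel)"

lemma sigma_finite_hyperplane_measure: "sigma_finite_measure (hyperplane_measure b)"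
proof -
  interpret product_sigma_finite "\<lambda>_::'a. lborel :: real measure"
    by standard
  show ?thesis by (rule sigma_finite) simp
qed

lemma graph_point_measurable [measurable]:
  assumes "\<gamma> \<in> borel_measurable borel"
  shows "graph_point b \<gamma> \<in> measurable (hyperplane_measure b) borel"
proof -
  have [measurable]: "(\<lambda>y. \<Sum>c\<in>Basis - {b}. y c *\<^sub>R c) \<in> measurable (hyperplane_measure b) borel"
    by (intro borel_measurable_sum borel_measurable_scaleR) auto
  note [measurable] = assms
  show ?thesis unfolding graph_point_def[abs_def] Let_def by measurable
qed

text \<open>Fubini isolates the coordinate along \<open>b\<close>. On each line in that direction
  the map is a translation by the graph height after a dilation by \<open>k\<close>, so
  measurability of \<open>\<gamma>\<close> suffices and the Jacobian is |k|.\<close>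

lemma nn_integral_graph_shear:
  fixes b :: "'a::euclidean_space"
  assumes b: "b \<in> Basis" and \<gamma>[measurable]: "\<gamma> \<in> borel_measurable borel" and "k \<noteq> 0"
    and f[measurable]: "f \<in> borel_measurable borel"
  shows "(\<integral>\<^sup>+x. f x \<partial>lborel) =
    ennreal \<bar>k\<bar> * (\<integral>\<^sup>+(y, t). f (graph_point b \<gamma> y + (k * t) *\<^sub>R b) \<partial>(hyperplane_measure b \<Otimes>\<^sub>M lborel))"
proof -
  interpret product_sigma_finite "\<lambda>_::'a. lborel :: real measure"
    by standard
  define base where "base y = (\<Sum>c\<in>Basis - {b}. y c *\<^sub>R c)" for y
  have [measurable]: "base \<in> measurable (hyperplane_measure b) borel"
    unfolding base_def[abs_def] by (intro borel_measurable_sum borel_measurable_scaleR) auto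
  have gp: "graph_point b \<gamma> y = base y + \<gamma> (base y) *\<^sub>R b" for y
    by (simp add: graph_point_def base_def Let_def)
  have ins: "insert b (Basis - {b}) = Basis" using b by auto
  have upd: "(\<Sum>c\<in>Basis. (y(b := t)) c *\<^sub>R c) = base y + t *\<^sub>R b" for y t
    unfolding base_def using b by (subst sum.remove[of _ b]) (auto intro!: sum.cong)
  have "(\<integral>\<^sup>+x. f x \<partial>lborel) = (\<integral>\<^sup>+y. f (\<Sum>c\<in>Basis. y c *\<^sub>R c) \<partial>(\<Pi>\<^sub>M c\<in>Basis. lborel))"
    by (subst lborel_eq, subst nn_integral_distr) auto
  also have "\<dots> = (\<integral>\<^sup>+y. \<integral>\<^sup>+t. f (base y + t *\<^sub>R b) \<partial>lborel \<partial>hyperplane_measure b)"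
    using product_nn_integral_insert[of "Basis - {b}" b "\<lambda>y. f (\<Sum>c\<in>Basis. y c *\<^sub>R c)", unfolded ins upd]
    by simp
  also have "\<dots> = (\<integral>\<^sup>+y. ennreal \<bar>k\<bar> * (\<integral>\<^sup>+t. f (graph_point b \<gamma> y + (k * t) *\<^sub>R b) \<partial>lborel) \<partial>hyperplane_measure b)"
  proof (rule nn_integral_cong)
    fix y
    show "(\<integral>\<^sup>+t. f (base y + t *\<^sub>R b) \<partial>lborel)
      = ennreal \<bar>k\<bar> * (\<integral>\<^sup>+t. f (graph_point b \<gamma> y + (k * t) *\<^sub>R b) \<partial>lborel)"
      by (subst nn_integral_real_affine[of _ k "\<gamma> (base y)"])
        (use \<open>k \<noteq> 0\<close> in \<open>auto simp: gp scaleR_add_left add.assoc\<close>)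
  qed
  also have "\<dots> = ennreal \<bar>k\<bar> * (\<integral>\<^sup>+y. \<integral>\<^sup>+t. f (graph_point b \<gamma> y + (k * t) *\<^sub>R b) \<partial>lborel \<partial>hyperplane_measure b)"
    by (rule nn_integral_cmult) measurable
  also have "(\<integral>\<^sup>+y. \<integral>\<^sup>+t. f (graph_point b \<gamma> y + (k * t) *\<^sub>R b) \<partial>lborel \<partial>hyperplane_measure b)
    = (\<integral>\<^sup>+(y, t). f (graph_point b \<gamma> y + (k * t) *\<^sub>R b) \<partial>(hyperplane_measure b \<Otimes>\<^sub>M lborel))"
    by (subst lborel.nn_integral_fst[symmetric]) auto
  finally show ?thesis .
qed

text \<open>Stating the substitution as an identity of measures transfers it from nonnegative to
  signed integrands without an integrability condition.\<close>

lemma lborel_graph_shear: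
  fixes b :: "'a::euclidean_space"
  assumes "b \<in> Basis" and [measurable]: "\<gamma> \<in> borel_measurable borel" and "k \<noteq> 0"
  shows "lborel = density (distr (hyperplane_measure b \<Otimes>\<^sub>M lborel) borel
    (\<lambda>(y, t). graph_point b \<gamma> y + (k * t) *\<^sub>R b)) (\<lambda>_. ennreal \<bar>k\<bar>)" (is "_ = ?D")
proof (rule measure_eqI)
  fix E :: "'a set" assume "E \<in> sets lborel"
  then have [measurable]: "E \<in> sets borel" by simp
  have "emeasure lborel E = (\<integral>\<^sup>+x. indicator E x \<partial>lborel)" by simp
  also have "\<dots> = ennreal \<bar>k\<bar> *
      (\<integral>\<^sup>+(y, t). indicator E (graph_point b \<gamma> y + (k * t) *\<^sub>R b) \<partial>(hyperplane_measure b \<Otimes>\<^sub>M lborel))"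
    by (rule nn_integral_graph_shear) (use assms in auto)
  also have "\<dots> = (\<integral>\<^sup>+x. indicator E x \<partial>?D)"
    by (simp add: nn_integral_density nn_integral_distr nn_integral_cmult split_def
        del: nn_integral_indicator)
  also have "\<dots> = emeasure ?D E" by simp
  finally show "emeasure lborel E = emeasure ?D E" .
qed simp

lemma integral_graph_shear:
  fixes b :: "'a::euclidean_space" and f :: "'a \<Rightarrow> real"
  assumes "b \<in> Basis" and [measurable]: "\<gamma> \<in> borel_measurable borel" and "k \<noteq> 0"
    and [measurable]: "f \<in> borel_measurable borel"
  shows "(LINT x|lborel. f x) = (LINT (y, t)|(hyperplane_measure b \<Otimes>\<^sub>M lborel).
    \<bar>k\<bar> * f (graph_point b \<gamma> y + (k * t) *\<^sub>R b))"
  by (subst lborel_graph_shear[OF assms(1-3)])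
    (simp add: integral_density integral_distr split_def)

lemma graph_point_inner:
  "b \<in> Basis \<Longrightarrow> c \<in> Basis - {b} \<Longrightarrow> graph_point b \<gamma> y \<bullet> c = y c"
  by (auto simp add: graph_point_def Let_def inner_add_left inner_sum_left inner_Basis if_distrib sum.delta
      cong: if_cong)

section \<open>Graph charts described by the depth below the graph\<close>

lemma graph_chart_level:
  assumes "graph_chart \<Omega> U b s \<gamma>" "x \<in> U"
  shows "x \<in> \<Omega> \<longleftrightarrow> 0 < s * (\<gamma> x - x \<bullet> b)"
  using assms by (auto simp: graph_chart_def algebra_simps)

text \<open>Since \<open>\<gamma>\<close> is constant along \<open>b\<close>, the depth is linear
  along that direction: displacing a graph point by \<open>- s * r\<close> along \<open>b\<close>
  gives depth exactly \<open>r\<close>, as s^2 = 1.\<close>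

lemma graph_chart_graph_point:
  assumes "graph_chart \<Omega> U b s \<gamma>"
  shows "s * (\<gamma> (graph_point b \<gamma> y + t *\<^sub>R b) - (graph_point b \<gamma> y + t *\<^sub>R b) \<bullet> b) = - s * t"
proof -
  have b: "b \<in> Basis" and inv: "\<And>x t. \<gamma> (x + t *\<^sub>R b) = \<gamma> x"
    using assms by (auto simp: graph_chart_def)
  have "(\<Sum>c\<in>Basis - {b}. y c *\<^sub>R c) \<bullet> b = 0"
    using b by (auto simp: inner_sum_left inner_Basis intro!: sum.neutral)
  then show ?thesis
    using b inv[of _ "_ + _"] by (simp add: graph_point_def Let_def inv inner_add_left add.assoc
        flip: scaleR_add_left)
qed

text \<open>Points of negative depth form an open set disjoint from \<open>\<Omega>\<close>, so a
  frontier point can have neither negative nor positive depth. Conversely, a point of depth zero is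
  the limit of its displacements by \<open>- s / (n + 1)\<close> along \<open>b\<close>, which have
  positive depth.\<close>

lemma graph_chart_frontier:
  assumes "open \<Omega>" and ch: "graph_chart \<Omega> U b s \<gamma>" and "x \<in> U"
  shows "x \<in> frontier \<Omega> \<longleftrightarrow> \<gamma> x = x \<bullet> b"
proof -
  have U: "open U" and b: "b \<in> Basis" and s: "s = 1 \<or> s = -1" and inv: "\<And>x t. \<gamma> (x + t *\<^sub>R b) = \<gamma> x"
    and C1: "C1_on UNIV \<gamma>"
    using ch by (auto simp: graph_chart_def)
  have cont: "continuous_on UNIV \<gamma>" by (rule C1_on_imp_continuous_on[OF C1])
  have fr: "frontier \<Omega> = closure \<Omega> - \<Omega>"
    using assms(1) by (simp add: frontier_def interior_open)
  show ?thesis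
  proof
    assume x: "x \<in> frontier \<Omega>"
    let ?N = "U \<inter> {z. s * (\<gamma> z - z \<bullet> b) < 0}"
    have "open ?N"
      by (intro open_Int U open_Collect_less continuous_intros cont)
    moreover have "?N \<inter> \<Omega> = {}"
      using graph_chart_level[OF ch] by (force simp: not_less)
    ultimately have "?N \<inter> closure \<Omega> = {}"
      by (simp add: open_Int_closure_eq_empty)
    then have "\<not> s * (\<gamma> x - x \<bullet> b) < 0" "\<not> 0 < s * (\<gamma> x - x \<bullet> b)"
      using x fr assms(3) graph_chart_level[OF ch assms(3)] by auto
    then show "\<gamma> x = x \<bullet> b" using s by auto
  next
    assume *: "\<gamma> x = x \<bullet> b"
    have "x \<in> closure \<Omega>"
    proof -
      let ?z = "\<lambda>n. x + (- s * inverse (real (Suc n))) *\<^sub>R b"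
      have "(\<lambda>n. - s * inverse (real (Suc n))) \<longlonglongrightarrow> - s * 0"
        by (intro tendsto_mult LIMSEQ_inverse_real_of_nat tendsto_const)
      then have lim: "?z \<longlonglongrightarrow> x"
        using tendsto_add[OF tendsto_const[of x] tendsto_scaleR[OF _ tendsto_const[of b]]] by fastforce
      have "\<forall>\<^sub>F n in sequentially. ?z n \<in> U"
        by (rule topological_tendstoD[OF lim U assms(3)])
      moreover have "0 < s * (\<gamma> (?z n) - ?z n \<bullet> b)" for n
      proof -
        have "\<gamma> (?z n) = x \<bullet> b" using inv[of x "- s * inverse (real (Suc n))"] * by simp
        moreover have "?z n \<bullet> b = x \<bullet> b - s * inverse (real (Suc n))"
          using b by (simp add: inner_diff_left inner_add_left)
        ultimately have "s * (\<gamma> (?z n) - ?z n \<bullet> b) = s * s * inverse (real (Suc n))"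
          by (simp add: algebra_simps)
        then show ?thesis using s by auto
      qed
      ultimately have "\<forall>\<^sub>F n in sequentially. ?z n \<in> closure \<Omega>"
        using graph_chart_level[OF ch] closure_subset by (fastforce elim: eventually_mono)
      then show ?thesis
        by (rule Lim_in_closed_set[OF closed_closure _ sequentially_bot lim])
    qed
    then show "x \<in> frontier \<Omega>"
      using * fr graph_chart_level[OF ch assms(3)] by simp
  qed
qed

lemma hyperplane_box_finite:
  "emeasure (hyperplane_measure b) (Pi\<^sub>E (Basis - {b}) (\<lambda>_. {- R..R})) < \<infinity>"
    (is "emeasure _ ?B < _")
  and hyperplane_box_measurable [measurable]:
  "Pi\<^sub>E (Basis - {b}) (\<lambda>_. {- R..R}) \<in> sets (hyperplane_measure b)"
proof -
  interpret product_sigma_finite "\<lambda>_::'a. lborel :: real measure"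
    by standard
  show "?B \<in> sets (hyperplane_measure b)" by (rule sets_PiM_I_finite) auto
  have "emeasure lborel {- R..R} < \<infinity>" by (simp add: emeasure_lborel_Icc_eq)
  then show "emeasure (hyperplane_measure b) ?B < \<infinity>"
    by (subst emeasure_PiM) (auto simp: power_less_top_ennreal)
qed

text \<open>Substituting \<open>x = graph_point b \<gamma> y - s t / (n + 1) b\<close> turns the layer integral into one over a
  fixed domain, in which the limit may be taken under the integral sign.\<close>

lemma boundary_layer_limit:
  fixes \<Omega> :: "'a::euclidean_space set" and m :: "'a \<Rightarrow> real" and h :: "real \<Rightarrow> real"
  assumes "open \<Omega>" "bounded \<Omega>" and ch: "graph_chart \<Omega> U b s \<gamma>"
    and m: "continuous_on (closure \<Omega>) m"
    and Z: "closed Z" "Z \<subseteq> U" "\<And>x. x \<notin> Z \<Longrightarrow> m x = 0"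
    and h: "continuous_on UNIV h" "\<And>t. t \<notin> {1..2} \<Longrightarrow> h t = 0" "\<And>t. \<bar>h t\<bar> \<le> B"
      "integrable lborel h" "(LINT t|lborel. h t) = 1"
  shows "integrable (hyperplane_measure b) (\<lambda>y. m (graph_point b \<gamma> y))"
    and "(\<lambda>n. LINT x:\<Omega>|lborel. real (Suc n) * h (real (Suc n) * (s * (\<gamma> x - x \<bullet> b))) * m x)
      \<longlonglongrightarrow> (LINT y|hyperplane_measure b. m (graph_point b \<gamma> y))"
proof -
  let ?P = "hyperplane_measure b" and ?gp = "graph_point b \<gamma>"
  have U: "open U" and b: "b \<in> Basis" and s: "s = 1 \<or> s = -1" and C1: "C1_on UNIV \<gamma>"
    using ch by (auto simp: graph_chart_def)
  have \<gamma>_cont: "continuous_on UNIV \<gamma>" by (rule C1_on_imp_continuous_on[OF C1])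
  then have [measurable]: "\<gamma> \<in> borel_measurable borel" by (rule borel_measurable_continuous_onI)
  have [measurable]: "h \<in> borel_measurable borel" by (rule borel_measurable_continuous_onI[OF h(1)])
  have [measurable]: "\<Omega> \<in> sets borel" using assms(1) by simp
  interpret P: sigma_finite_measure ?P by (rule sigma_finite_hyperplane_measure)
  interpret pair_sigma_finite ?P "lborel :: real measure" ..
  obtain R where R: "\<And>x. x \<in> closure \<Omega> \<Longrightarrow> norm x \<le> R"
    using bounded_closure[OF assms(2)] by (auto simp: bounded_iff)
  obtain C where C: "C > 0" "\<And>x. x \<in> closure \<Omega> \<Longrightarrow> \<bar>m x\<bar> \<le> C"
    using compact_imp_bounded[OF compact_continuous_image[OF m]] assms(2)
    by (force simp: bounded_pos)
  \<comment> \<open>A bounded box containing the projection of \<open>closure \<Omega>\<close> along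
    \<open>b\<close>; it carries the integrable majorant in the hyperplane variable.\<close>
  define Q where "Q = Pi\<^sub>E (Basis - {b}) (\<lambda>_. {- R..R})"
  have [measurable]: "Q \<in> sets ?P" by (simp add: Q_def)
  have Q: "y \<in> Q" if "y \<in> space ?P" "?gp y + t *\<^sub>R b \<in> closure \<Omega>" for y t
  proof -
    have "\<bar>y c\<bar> \<le> R" if c: "c \<in> Basis - {b}" for c
    proof -
      have "y c = (?gp y + t *\<^sub>R b) \<bullet> c"
        using graph_point_inner[OF b c] b c by (auto simp: inner_add_left inner_Basis)
      also have "\<bar>\<dots>\<bar> \<le> norm (?gp y + t *\<^sub>R b)" using c by (simp add: Basis_le_norm)
      also have "\<dots> \<le> R" by (rule R) fact
      finally show ?thesis .
    qed
    then show ?thesis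
      using that(1) by (auto simp: Q_def space_PiM PiE_iff abs_le_iff minus_le_iff)
  qed
  \<comment> \<open>Truncating to the closure makes \<open>m\<close> Borel. On the graph nothing
    changes: graph points in \<open>U\<close> belong to the frontier, and outside \<open>U\<close>
    the function \<open>m\<close> is zero.\<close>
  define m0 where "m0 x = indicator (closure \<Omega>) x * m x" for x
  have [measurable]: "m0 \<in> borel_measurable borel"
    using borel_measurable_continuous_on_indicator[OF _ m] by (simp add: m0_def[abs_def])
  have gp_m0: "m (?gp y) = m0 (?gp y)" for y
  proof (cases "?gp y \<in> U")
    case True
    have "?gp y \<in> frontier \<Omega>"
      using graph_chart_frontier[OF assms(1) ch True] graph_chart_graph_point[OF ch, of y 0] s by auto
    then show ?thesis by (simp add: m0_def frontier_def)
  next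
    case False
    then show ?thesis using Z by (auto simp: m0_def)
  qed
  have m0_bound: "\<bar>m0 (?gp y + t *\<^sub>R b)\<bar> \<le> C * indicator Q y" if "y \<in> space ?P" for y t
    using Q[OF that] C by (auto simp: m0_def indicator_def)
  have Q_fin: "emeasure ?P Q < \<infinity>" unfolding Q_def by (rule hyperplane_box_finite)
  have "integrable ?P (\<lambda>y. C * indicator Q y)"
    using Q_fin by (intro integrable_mult_right integrable_real_indicator) auto
  then show int_gp: "integrable ?P (\<lambda>y. m (?gp y))"
    unfolding gp_m0
    by (rule Bochner_Integration.integrable_bound) (use m0_bound[of _ 0] C in \<open>auto intro!: AE_I2\<close>)
  define m1 where "m1 x = indicator \<Omega> x * m0 x" for x
  have [measurable]: "m1 \<in> borel_measurable borel" unfolding m1_def[abs_def] by measurable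
  define I where "I n = (\<lambda>(y, t). h t * m1 (?gp y + (- s * inverse (real (Suc n)) * t) *\<^sub>R b))" for n
  have [measurable]: "I n \<in> borel_measurable (?P \<Otimes>\<^sub>M lborel)" for n
    unfolding I_def by measurable
  have I: "(LINT x:\<Omega>|lborel. real (Suc n) * h (real (Suc n) * (s * (\<gamma> x - x \<bullet> b))) * m x)
      = (LINT z|(?P \<Otimes>\<^sub>M lborel). I n z)" for n
  proof -
    \<comment> \<open>With this dilation the shifted point has depth t / (n + 1), so the argument of
      \<open>h\<close> becomes \<open>t\<close>, and the Jacobian cancels the factor n + 1.\<close>
    let ?k = "- s * inverse (real (Suc n))"
    have "(LINT x:\<Omega>|lborel. real (Suc n) * h (real (Suc n) * (s * (\<gamma> x - x \<bullet> b))) * m x)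
      = (LINT x|lborel. real (Suc n) * h (real (Suc n) * (s * (\<gamma> x - x \<bullet> b))) * m1 x)"
      unfolding set_lebesgue_integral_def
      by (intro Bochner_Integration.integral_cong)
        (use closure_subset in \<open>auto simp: m1_def m0_def indicator_def\<close>)
    also have "\<dots> = (LINT (y, t)|(?P \<Otimes>\<^sub>M lborel). \<bar>?k\<bar> * (real (Suc n) *
        h (real (Suc n) * (s * (\<gamma> (?gp y + (?k * t) *\<^sub>R b) - (?gp y + (?k * t) *\<^sub>R b) \<bullet> b)))
        * m1 (?gp y + (?k * t) *\<^sub>R b)))"
      by (rule integral_graph_shear) (use b s in auto)
    also have "\<dots> = (LINT z|(?P \<Otimes>\<^sub>M lborel). I n z)"
    proof (rule Bochner_Integration.integral_cong)
      fix z :: "('a \<Rightarrow> real) \<times> real"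
      obtain y t where z: "z = (y, t)" by force
      have "real (Suc n) * (- s * (?k * t)) = t" using s by auto
      moreover have "\<bar>?k\<bar> * real (Suc n) = 1" using s by (auto simp: abs_mult)
      moreover have "\<bar>?k\<bar> * (real (Suc n) * a * c) = (\<bar>?k\<bar> * real (Suc n)) * (a * c)" for a c
        by (simp only: mult.assoc)
      ultimately show "(case z of (y, t) \<Rightarrow> \<bar>?k\<bar> * (real (Suc n) *
        h (real (Suc n) * (s * (\<gamma> (?gp y + (?k * t) *\<^sub>R b) - (?gp y + (?k * t) *\<^sub>R b) \<bullet> b)))
        * m1 (?gp y + (?k * t) *\<^sub>R b))) = I n z"
        unfolding z case_prod_conv I_def graph_chart_graph_point[OF ch] by (simp only: mult_1)
    qed simp
    finally show ?thesis .
  qed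
  have I_bound: "norm (I n z) \<le> \<bar>B\<bar> * C * indicator (Q \<times> {1..2}) z"
    if z: "z \<in> space (?P \<Otimes>\<^sub>M lborel)" for n z
  proof -
    obtain y t where yt: "z = (y, t)" "y \<in> space ?P" using z by (auto simp: space_pair_measure)
    have 1: "\<bar>h t\<bar> \<le> \<bar>B\<bar> * indicator {1..2} t"
      using h(2)[of t] h(3)[of t] by (auto simp: indicator_def)
    have 2: "\<bar>m1 (?gp y + (- s * inverse (real (Suc n)) * t) *\<^sub>R b)\<bar> \<le> C * indicator Q y"
      using m0_bound[OF yt(2), of "- s * inverse (real (Suc n)) * t"] C
      by (auto simp: m1_def indicator_def split: if_splits)
    have "norm (I n z) \<le> (\<bar>B\<bar> * indicator {1..2} t) * (C * indicator Q y)"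
      unfolding I_def yt(1) case_prod_conv real_norm_def abs_mult
      by (rule mult_mono[OF 1 2]) auto
    also have "\<dots> = \<bar>B\<bar> * C * indicator (Q \<times> {1..2}) z"
      by (simp add: yt(1) indicator_times)
    finally show ?thesis .
  qed
  have I_lim: "(\<lambda>n. I n z) \<longlonglongrightarrow> (case z of (y, t) \<Rightarrow> h t * m (?gp y))" for z
  proof -
    obtain y t where yt: "z = (y, t)" by force
    show ?thesis
    \<comment> \<open>For t \<le> 0 the profile \<open>h\<close> is zero. For t > 0 the shifted
      points have positive depth, so those in the chart lie in \<open>\<Omega>\<close>, and the
      indicator in \<open>m1\<close> is eventually 1 there.\<close>
    proof (cases "t > 0")
      case False
      then show ?thesis using h(2)[of t] by (simp add: yt I_def)
    next
      case True
      let ?x = "\<lambda>n. ?gp y + (- s * inverse (real (Suc n)) * t) *\<^sub>R b"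
      have "(\<lambda>n. - s * inverse (real (Suc n)) * t) \<longlonglongrightarrow> - s * 0 * t"
        by (intro tendsto_mult LIMSEQ_inverse_real_of_nat tendsto_const)
      then have lim: "?x \<longlonglongrightarrow> ?gp y"
        using tendsto_add[OF tendsto_const[of "?gp y"] tendsto_scaleR[OF _ tendsto_const[of b]]] by fastforce
      have "(\<lambda>n. m1 (?x n)) \<longlonglongrightarrow> m (?gp y)"
      proof (cases "?gp y \<in> U")
        case inU: True
        have gp: "?gp y \<in> closure \<Omega>"
          using graph_chart_frontier[OF assms(1) ch inU] graph_chart_graph_point[OF ch, of y 0] s
          by (auto simp: frontier_def)
        have pos: "0 < s * (\<gamma> (?x n) - ?x n \<bullet> b)" for n
          unfolding graph_chart_graph_point[OF ch] using s True by auto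
        have "\<forall>\<^sub>F n in sequentially. ?x n \<in> U"
          by (rule topological_tendstoD[OF lim U inU])
        then have ev: "\<forall>\<^sub>F n in sequentially. ?x n \<in> \<Omega>"
          by (rule eventually_mono) (use graph_chart_level[OF ch] pos in blast)
        then have evc: "\<forall>\<^sub>F n in sequentially. ?x n \<in> closure \<Omega>"
          by (rule eventually_mono) (use closure_subset in blast)
        have "(\<lambda>n. m (?x n)) \<longlonglongrightarrow> m (?gp y)"
          by (rule continuous_on_tendsto_compose[OF m lim gp evc])
        then show ?thesis
          by (rule Lim_transform_eventually)
            (use ev evc in eventually_elim, simp add: m1_def m0_def)
      next
        case False
        then have "?gp y \<in> - Z" using Z by auto
        then have "\<forall>\<^sub>F n in sequentially. ?x n \<in> - Z"
          using Z(1) by (intro topological_tendstoD[OF lim]) auto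
        then have "\<forall>\<^sub>F n in sequentially. m1 (?x n) = 0"
          by (rule eventually_mono) (use Z(3) in \<open>auto simp: m1_def m0_def\<close>)
        then have "(\<lambda>n. m1 (?x n)) \<longlonglongrightarrow> 0" by (rule tendsto_eventually)
        then show ?thesis using Z \<open>?gp y \<in> - Z\<close> by simp
      qed
      then show ?thesis unfolding yt I_def case_prod_conv by (intro tendsto_mult tendsto_const)
    qed
  qed
  have meas: "(\<lambda>(y, t). h t * m (?gp y)) \<in> borel_measurable (?P \<Otimes>\<^sub>M lborel)"
    unfolding gp_m0 by measurable
  have "emeasure (?P \<Otimes>\<^sub>M lborel) (Q \<times> {1..2::real}) < \<infinity>"
    using Q_fin by (subst lborel.emeasure_pair_measure_Times) (auto simp: ennreal_mult_less_top)
  then have dom: "integrable (?P \<Otimes>\<^sub>M lborel) (\<lambda>z. \<bar>B\<bar> * C * indicator (Q \<times> {1..2::real}) z)"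
    by (intro integrable_mult_right integrable_real_indicator) auto
  have "(\<lambda>n. LINT z|(?P \<Otimes>\<^sub>M lborel). I n z)
      \<longlonglongrightarrow> (LINT (y, t)|(?P \<Otimes>\<^sub>M lborel). h t * m (?gp y))"
    by (rule integral_dominated_convergence[OF meas _ dom]) (use I_lim I_bound in auto)
  moreover have "integrable (?P \<Otimes>\<^sub>M lborel) (\<lambda>(y, t). h t * m (?gp y))"
    by (rule integrable_dominated_convergence[OF meas _ dom, of I]) (use I_lim I_bound in auto)
  then have "(LINT (y, t)|(?P \<Otimes>\<^sub>M lborel). h t * m (?gp y))
    = (LINT y|?P. LINT t|lborel. h t * m (?gp y))"
    by (subst integral_fst'[symmetric]) (auto simp: split_def)
  moreover have "\<dots> = (LINT y|?P. m (?gp y))" using h(5) by simp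
  ultimately show "(\<lambda>n. LINT x:\<Omega>|lborel. real (Suc n) * h (real (Suc n) * (s * (\<gamma> x - x \<bullet> b))) * m x)
      \<longlonglongrightarrow> (LINT y|hyperplane_measure b. m (graph_point b \<gamma> y))"
    unfolding I using h(5) by simp
qed

lemma set_integrable_continuous_on_closure:
  fixes g :: "'a::euclidean_space \<Rightarrow> real"
  assumes "open S" "bounded S" "continuous_on (closure S) g"
  shows "set_integrable lborel S g"
proof (rule set_integrable_subset)
  show "set_integrable lborel (closure S) g"
    unfolding set_integrable_def
    using assms by (intro borel_integrable_compact) (auto simp: compact_closure)
qed (use assms(1) closure_subset in auto)

lemma grad_eq_0_outside_support:
  fixes \<zeta> :: "'a::euclidean_space \<Rightarrow> real"
  assumes "x \<notin> closure {x. \<zeta> x \<noteq> 0}"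
  shows "grad \<zeta> x = 0"
proof (rule grad_eqI)
  let ?T = "- closure {x. \<zeta> x \<noteq> 0}"
  have "0 = \<zeta> y" if "y \<in> ?T" for y
    using that closure_subset[of "{x. \<zeta> x \<noteq> 0}"] by auto
  moreover have "open ?T" by (rule open_Compl[OF closed_closure])
  moreover have "x \<in> ?T" using assms by simp
  ultimately have "(\<zeta> has_derivative (\<lambda>_. 0)) (at x)"
    by (metis has_derivative_transform_within_open has_derivative_const)
  then show "(\<zeta> has_derivative (\<lambda>h. 0 \<bullet> h)) (at x)" by simp
qed

text \<open>The cut-off functions \<open>\<eta> (n (s (\<gamma> x - x \<bullet> b)))\<close> vanish near the boundary; their gradients
  concentrate there and produce the flux, and monotone convergence makes the possibly
  unbounded divergence integrable.\<close>

lemma divergence_graph_chart: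
  fixes \<Omega> :: "'a::euclidean_space set" and F :: "'a \<Rightarrow> 'a" and \<zeta> :: "'a \<Rightarrow> real"
  assumes \<Omega>: "open \<Omega>" "bounded \<Omega>" and ch: "graph_chart \<Omega> U b s \<gamma>"
    and \<zeta>: "C1_on UNIV \<zeta>" "\<And>x. 0 \<le> \<zeta> x" "bounded {x. \<zeta> x \<noteq> 0}" "closure {x. \<zeta> x \<noteq> 0} \<subseteq> U"
    and F: "C1_on \<Omega> F" "continuous_on (closure \<Omega>) F" "\<And>x. x \<in> \<Omega> \<Longrightarrow> divergence F x \<le> C"
  defines "m \<equiv> \<lambda>x. \<zeta> x * (F x \<bullet> (s *\<^sub>R (b - grad \<gamma> x)))"
  shows "integrable (hyperplane_measure b) (\<lambda>y. m (graph_point b \<gamma> y))"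
    and "set_integrable lborel \<Omega> (\<lambda>x. \<zeta> x * (C - divergence F x))"
    and "(LINT x:\<Omega>|lborel. \<zeta> x * (C - divergence F x)) =
      (LINT x:\<Omega>|lborel. C * \<zeta> x + grad \<zeta> x \<bullet> F x)
      - (LINT y|hyperplane_measure b. m (graph_point b \<gamma> y))"
proof -
  let ?S = "closure {x. \<zeta> x \<noteq> 0}"
  have U: "open U" and b: "b \<in> Basis" and s: "s = 1 \<or> s = -1" and \<gamma>: "C1_on UNIV \<gamma>"
    using ch by (auto simp: graph_chart_def)
  obtain \<eta> \<eta>' where \<eta>: "\<And>t. (\<eta> has_real_derivative \<eta>' t) (at t)" "continuous_on UNIV \<eta>'" "mono \<eta>"
    "\<And>t. t \<le> 1 \<Longrightarrow> \<eta> t = 0" "\<And>t. t \<ge> 2 \<Longrightarrow> \<eta> t = 1"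
    "\<And>t. t \<notin> {1..2} \<Longrightarrow> \<eta>' t = 0" "\<And>t. \<bar>\<eta>' t\<bar> \<le> 2"
    "integrable lborel \<eta>'" "(LINT t|lborel. \<eta>' t) = 1"
    by (rule smooth_step) blast
  have \<eta>_range: "0 \<le> \<eta> t" "\<eta> t \<le> 1" for t
    using monoD[OF \<eta>(3), of "min t 1" t] monoD[OF \<eta>(3), of t "max t 2"] \<eta>(4)[of "min t 1"] \<eta>(5)[of "max t 2"]
    by auto
  define g where "g x = s * (\<gamma> x - x \<bullet> b)" for x
  have g: "C1_on UNIV g" "grad g x = - (s *\<^sub>R (b - grad \<gamma> x))" for x
  proof -
    have C: "C1_on UNIV (\<lambda>x. \<gamma> x - x \<bullet> b)" and G: "grad (\<lambda>x. \<gamma> x - x \<bullet> b) x = grad \<gamma> x - b"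
      using C1_on_diff[OF open_UNIV \<gamma> C1_on_inner_const[OF open_UNIV]] by (auto simp: grad_inner_const)
    show "C1_on UNIV g" unfolding g_def[abs_def] by (rule C1_on_cmult[OF open_UNIV C])
    show "grad g x = - (s *\<^sub>R (b - grad \<gamma> x))"
      using C1_on_cmult(2)[OF open_UNIV C, of x s] G by (simp add: g_def[abs_def] algebra_simps)
  qed
  have cont: "continuous_on T \<zeta>" "continuous_on T (grad \<zeta>)" "continuous_on T (grad \<gamma>)" "continuous_on T g" for T
    using C1_on_imp_continuous_on[OF \<zeta>(1)] C1_on_continuous_on_grad[OF \<zeta>(1)]
      C1_on_continuous_on_grad[OF \<gamma>] C1_on_imp_continuous_on[OF g(1)]
    by (meson continuous_on_subset subset_UNIV)+
  have cont_div: "continuous_on \<Omega> (divergence F)" by (rule C1_on_continuous_on_divergence[OF F(1)])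
  have outside: "\<zeta> x = 0" "grad \<zeta> x = 0" if "x \<notin> ?S" for x
    using that grad_eq_0_outside_support[OF that] closure_subset[of "{x. \<zeta> x \<noteq> 0}"] by auto
  have pos: "0 < g x" if "x \<in> \<Omega>" "x \<in> ?S" for x
    using graph_chart_level[OF ch, of x] \<zeta>(4) that by (auto simp: g_def)

  \<comment> \<open>The vector \<open>s *\<^sub>R (b - grad \<gamma> x)\<close> is the outward
    normal times the surface element, so on the graph \<open>m\<close> is the flux density with
    respect to \<open>hyperplane_measure b\<close>.\<close>
  have m_cont: "continuous_on (closure \<Omega>) m"
    unfolding m_def by (intro continuous_intros cont F(2))
  note flux = boundary_layer_limit[OF \<Omega> ch m_cont closed_closure \<zeta>(4) _ \<eta>(2,6,7,8,9), folded g_def]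
  have m_out: "m x = 0" if "x \<notin> ?S" for x using outside[OF that] by (simp add: m_def)
  show "integrable (hyperplane_measure b) (\<lambda>y. m (graph_point b \<gamma> y))"
    by (rule flux(1)) (rule m_out)

  define e where "e n x = \<eta> (real (Suc n) * g x)" for n x
  define \<theta> where "\<theta> n x = \<zeta> x * e n x" for n x
  have e: "C1_on UNIV (e n)" "grad (e n) x = (real (Suc n) * \<eta>' (real (Suc n) * g x)) *\<^sub>R grad g x" for n x
  proof -
    have D: "((\<lambda>t. \<eta> (real (Suc n) * t)) has_real_derivative real (Suc n) * \<eta>' (real (Suc n) * t)) (at t)" for t
      using DERIV_chain2[OF \<eta>(1) DERIV_cmult_Id[of "real (Suc n)"]] by (simp add: mult.commute)
    have c: "continuous_on UNIV (\<lambda>x. real (Suc n) * \<eta>' (real (Suc n) * g x))"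
      by (intro continuous_on_mult continuous_on_const continuous_on_compose2[OF \<eta>(2)] cont) auto
    show "C1_on UNIV (e n)"
      unfolding e_def[abs_def] by (rule C1_on_compose(1)[OF open_UNIV g(1) D c])
    show "grad (e n) x = (real (Suc n) * \<eta>' (real (Suc n) * g x)) *\<^sub>R grad g x"
      unfolding e_def[abs_def] by (rule C1_on_compose(2)[OF open_UNIV g(1) D c UNIV_I])
  qed
  have \<theta>: "C1_on \<Omega> (\<theta> n)" for n
    unfolding \<theta>_def[abs_def]
    by (rule C1_on_subset[OF C1_on_mult(1)[OF open_UNIV \<zeta>(1) e(1)]]) simp
  \<comment> \<open>The gradient of the depth points inwards, which explains the minus sign before
    the boundary layer; the other term stays bounded as n grows.\<close>
  have grad_\<theta>: "grad (\<theta> n) x \<bullet> F x =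
      e n x * (grad \<zeta> x \<bullet> F x) - real (Suc n) * \<eta>' (real (Suc n) * g x) * m x" for n x
  proof -
    have "grad (\<theta> n) x = \<zeta> x *\<^sub>R ((real (Suc n) * \<eta>' (real (Suc n) * g x)) *\<^sub>R - (s *\<^sub>R (b - grad \<gamma> x)))
        + e n x *\<^sub>R grad \<zeta> x"
      unfolding \<theta>_def[abs_def] C1_on_mult(2)[OF open_UNIV \<zeta>(1) e(1)[of n] UNIV_I, of x] e(2) g(2) ..
    moreover have "(z *\<^sub>R (a *\<^sub>R - V) + c *\<^sub>R G) \<bullet> Y = c * (G \<bullet> Y) - a * (z * (Y \<bullet> V))"
      for a z c :: real and V G Y :: 'a
      by (simp add: inner_add_left inner_diff_left inner_commute[of Y])
    ultimately show ?thesis by (simp only: m_def)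
  qed
  \<comment> \<open>As \<open>\<eta>\<close> vanishes up to 1, the cut-off \<open>\<theta> n\<close>
    is zero wherever the depth is at most 1 / (n + 1).\<close>
  define K where "K n = ?S \<inter> {x. 1 / real (Suc n) \<le> g x}" for n
  have K: "compact (K n)" "K n \<subseteq> \<Omega>" "x \<in> \<Omega> - K n \<Longrightarrow> \<theta> n x = 0" for n x
  proof -
    have "closed {x. 1 / real (Suc n) \<le> g x}"
      by (intro closed_Collect_le continuous_on_const cont)
    then show "compact (K n)"
      unfolding K_def using \<zeta>(3) by (intro compact_Int_closed) (auto simp: compact_closure)
    have "0 < 1 / real (Suc n)" by simp
    then show "K n \<subseteq> \<Omega>"
      using graph_chart_level[OF ch] \<zeta>(4) unfolding K_def g_def by (fastforce dest: less_le_trans)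
    show "\<theta> n x = 0" if "x \<in> \<Omega> - K n"
    proof (cases "x \<in> ?S")
      case True
      then have "g x < 1 / real (Suc n)" using that by (auto simp: K_def)
      then have "real (Suc n) * g x \<le> 1" by (simp add: field_simps)
      then show ?thesis using \<eta>(4) by (simp add: \<theta>_def e_def)
    next
      case False
      from outside(1)[OF this] show ?thesis by (simp add: \<theta>_def)
    qed
  qed
  have parts: "set_integrable lborel \<Omega> (\<lambda>x. \<theta> n x * divergence F x)"
    "set_integrable lborel \<Omega> (\<lambda>x. grad (\<theta> n) x \<bullet> F x)"
    "(LINT x:\<Omega>|lborel. \<theta> n x * divergence F x) = - (LINT x:\<Omega>|lborel. grad (\<theta> n) x \<bullet> F x)" for n
    by (rule integral_by_parts_compact_support[OF \<Omega>(1) F(1) \<theta>[of n] K(1)[of n] K(2)[of n]], erule K(3))+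

  \<comment> \<open>\<open>W\<close> collects the terms that are continuous up to the boundary;
    against them the cut-offs \<open>e n\<close> can be removed by dominated convergence.\<close>
  define W where "W x = C * \<zeta> x + grad \<zeta> x \<bullet> F x" for x
  have W_int: "set_integrable lborel \<Omega> W"
    unfolding W_def
    by (intro set_integrable_continuous_on_closure[OF \<Omega>] continuous_intros cont F(2))
  have eW_int: "set_integrable lborel \<Omega> (\<lambda>x. e n x * W x)" for n
    unfolding W_def
    by (intro set_integrable_continuous_on_closure[OF \<Omega>] continuous_intros cont F(2))
      (meson e(1) C1_on_imp_continuous_on continuous_on_subset subset_UNIV)
  have lay_int: "set_integrable lborel \<Omega> (\<lambda>x. real (Suc n) * \<eta>' (real (Suc n) * g x) * m x)" for n
    by (intro set_integrable_continuous_on_closure[OF \<Omega>] continuous_intros m_cont cont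
        continuous_on_compose2[OF \<eta>(2)]) auto
  have \<theta>_int: "set_integrable lborel \<Omega> (\<lambda>x. C * \<theta> n x)" for n
    by (intro set_integrable_compact_support[OF _ K(1,2)[of n]] continuous_on_mult continuous_on_const
        C1_on_imp_continuous_on[OF \<theta>]) (use K(3) in auto)
  have step_int: "set_integrable lborel \<Omega> (\<lambda>x. \<theta> n x * (C - divergence F x))" for n
    using set_integral_diff(1)[OF \<theta>_int parts(1)] by (simp add: algebra_simps)
  have step: "(LINT x:\<Omega>|lborel. \<theta> n x * (C - divergence F x)) =
      (LINT x:\<Omega>|lborel. e n x * W x)
      - (LINT x:\<Omega>|lborel. real (Suc n) * \<eta>' (real (Suc n) * g x) * m x)" for n
  proof -
    have "(LINT x:\<Omega>|lborel. \<theta> n x * (C - divergence F x))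
      = (LINT x:\<Omega>|lborel. C * \<theta> n x) - (LINT x:\<Omega>|lborel. \<theta> n x * divergence F x)"
      by (subst set_integral_diff(2)[OF \<theta>_int parts(1), symmetric]) (simp add: algebra_simps)
    also have "\<dots> = (LINT x:\<Omega>|lborel. C * \<theta> n x + grad (\<theta> n) x \<bullet> F x)"
      by (subst set_integral_add(2)[OF \<theta>_int parts(2)]) (simp_all add: parts(3))
    also have "\<dots> = (LINT x:\<Omega>|lborel. e n x * W x - real (Suc n) * \<eta>' (real (Suc n) * g x) * m x)"
      unfolding grad_\<theta> by (simp add: W_def \<theta>_def algebra_simps)
    also have "\<dots> = (LINT x:\<Omega>|lborel. e n x * W x)
      - (LINT x:\<Omega>|lborel. real (Suc n) * \<eta>' (real (Suc n) * g x) * m x)"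
      by (rule set_integral_diff(2)[OF eW_int lay_int])
    finally show ?thesis .
  qed
  have e_lim: "(\<lambda>n. e n x) \<longlonglongrightarrow> 1" if "0 < g x" for x
  proof (rule tendsto_eventually)
    have "filterlim (\<lambda>n. g x * real (Suc n)) at_top sequentially"
      by (rule filterlim_tendsto_pos_mult_at_top[OF tendsto_const that])
        (rule filterlim_compose[OF filterlim_real_sequentially filterlim_Suc])
    then have "\<forall>\<^sub>F n in sequentially. 2 \<le> g x * real (Suc n)" by (simp add: filterlim_at_top)
    then show "\<forall>\<^sub>F n in sequentially. e n x = 1"
      by eventually_elim (simp add: e_def \<eta>(5) mult.commute)
  qed
  have vanish: "W x = 0" "\<zeta> x = 0" if "x \<notin> ?S" for x using outside[OF that] by (simp_all add: W_def)
  have "(\<lambda>n. LINT x:\<Omega>|lborel. e n x * W x) \<longlonglongrightarrow> (LINT x:\<Omega>|lborel. W x)"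
    unfolding set_lebesgue_integral_def
  proof (rule integral_dominated_convergence[where w = "\<lambda>x. norm (indicator \<Omega> x *\<^sub>R W x)"])
    show "(\<lambda>x. indicator \<Omega> x *\<^sub>R W x) \<in> borel_measurable lborel"
      "integrable lborel (\<lambda>x. norm (indicator \<Omega> x *\<^sub>R W x))"
      using W_int by (auto simp: set_integrable_def)
    show "(\<lambda>x. indicator \<Omega> x *\<^sub>R (e n x * W x)) \<in> borel_measurable lborel" for n
      using eW_int[of n] by (auto simp: set_integrable_def)
    show "AE x in lborel. norm (indicator \<Omega> x *\<^sub>R (e n x * W x)) \<le> norm (indicator \<Omega> x *\<^sub>R W x)" for n
      using \<eta>_range by (intro AE_I2) (auto simp: e_def abs_mult mult_left_le_one_le split: split_indicator)
    show "AE x in lborel. (\<lambda>n. indicator \<Omega> x *\<^sub>R (e n x * W x)) \<longlonglongrightarrow> indicator \<Omega> x *\<^sub>R W x"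
    proof (rule AE_I2)
      fix x
      show "(\<lambda>n. indicator \<Omega> x *\<^sub>R (e n x * W x)) \<longlonglongrightarrow> indicator \<Omega> x *\<^sub>R W x"
      proof (cases "x \<in> \<Omega> \<and> x \<in> ?S")
        case True
        have "(\<lambda>n. e n x * W x) \<longlonglongrightarrow> 1 * W x"
          by (intro tendsto_mult e_lim tendsto_const pos) (use True in auto)
        then show ?thesis using True by simp
      next
        case False
        then show ?thesis using vanish[of x] by auto
      qed
    qed
  qed
  then have lim: "(\<lambda>n. LINT x:\<Omega>|lborel. \<theta> n x * (C - divergence F x))
      \<longlonglongrightarrow> (LINT x:\<Omega>|lborel. W x) - (LINT y|hyperplane_measure b. m (graph_point b \<gamma> y))"
    unfolding step by (intro tendsto_diff flux(2)) (auto intro: m_out)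
  \<comment> \<open>On the part of the support inside \<open>\<Omega>\<close> the depth is positive,
    so \<open>e n\<close> increases with n; the factor C - div F is nonnegative, and this is the use
    of the upper bound.\<close>
  have mono: "mono (\<lambda>n. indicator \<Omega> x *\<^sub>R (\<theta> n x * (C - divergence F x)))" for x
  proof (rule monoI)
    fix i j :: nat assume ij: "i \<le> j"
    show "indicator \<Omega> x *\<^sub>R (\<theta> i x * (C - divergence F x)) \<le> indicator \<Omega> x *\<^sub>R (\<theta> j x * (C - divergence F x))"
    proof (cases "x \<in> \<Omega> \<and> x \<in> ?S")
      case True
      then have "real (Suc i) * g x \<le> real (Suc j) * g x"
        using ij pos[of x] by (intro mult_right_mono) auto
      then have "e i x \<le> e j x" unfolding e_def by (rule monoD[OF \<eta>(3)])
      then have "\<theta> i x \<le> \<theta> j x" unfolding \<theta>_def using \<zeta>(2) by (rule mult_left_mono)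
      then show ?thesis using True F(3)[of x] by (simp add: mult_right_mono)
    next
      case False
      then show ?thesis using vanish[of x] by (auto simp: \<theta>_def)
    qed
  qed
  have pointwise: "(\<lambda>n. indicator \<Omega> x *\<^sub>R (\<theta> n x * (C - divergence F x)))
      \<longlonglongrightarrow> indicator \<Omega> x *\<^sub>R (\<zeta> x * (C - divergence F x))" for x
  proof (cases "x \<in> \<Omega> \<and> x \<in> ?S")
    case True
    have "(\<lambda>n. \<zeta> x * e n x * (C - divergence F x)) \<longlonglongrightarrow> \<zeta> x * 1 * (C - divergence F x)"
      by (intro tendsto_mult e_lim tendsto_const pos) (use True in auto)
    then show ?thesis using True by (simp add: \<theta>_def)
  next
    case False
    then show ?thesis using vanish[of x] by (auto simp: \<theta>_def)
  qed
  have meas: "(\<lambda>x. indicator \<Omega> x *\<^sub>R (\<zeta> x * (C - divergence F x))) \<in> borel_measurable lborel"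
  proof -
    have "continuous_on \<Omega> (\<lambda>x. \<zeta> x * (C - divergence F x))"
      by (intro continuous_on_mult continuous_on_diff continuous_on_const cont cont_div)
    then show ?thesis
      using borel_measurable_continuous_on_indicator[of \<Omega> "\<lambda>x. \<zeta> x * (C - divergence F x)"] \<Omega>(1)
      by simp
  qed
  \<comment> \<open>The integrals along the increasing sequence were just shown to converge to a
    finite number, so the limit function is integrable with this integral.\<close>
  note conv = integrable_monotone_convergence integral_monotone_convergence
  note conv = conv[OF step_int[unfolded set_integrable_def] AE_I2[OF mono]
      AE_I2[OF pointwise] lim[unfolded set_lebesgue_integral_def] meas]
  show "set_integrable lborel \<Omega> (\<lambda>x. \<zeta> x * (C - divergence F x))"
    unfolding set_integrable_def by (rule conv(1))
  show "(LINT x:\<Omega>|lborel. \<zeta> x * (C - divergence F x)) =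
      (LINT x:\<Omega>|lborel. C * \<zeta> x + grad \<zeta> x \<bullet> F x)
      - (LINT y|hyperplane_measure b. m (graph_point b \<gamma> y))"
    using conv(2) unfolding set_lebesgue_integral_def W_def .
qed

section \<open>The outward normal in a graph chart\<close>

lemma has_derivative_along_line:
  fixes g :: "'a::euclidean_space \<Rightarrow> real"
  assumes "C1_on UNIV g"
  shows "((\<lambda>t. g (x + t *\<^sub>R d)) has_derivative (\<lambda>t. t * (grad g x \<bullet> d))) (at 0)"
proof -
  have "((\<lambda>t. x + t *\<^sub>R d) has_derivative (\<lambda>t. t *\<^sub>R d)) (at 0)"
    by (auto intro!: derivative_eq_intros)
  moreover have "(g has_derivative (\<lambda>h. grad g x \<bullet> h)) (at (x + 0 *\<^sub>R d))"
    using C1_on_has_derivative_grad[OF open_UNIV assms] by simp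
  ultimately have "((\<lambda>t. g (x + t *\<^sub>R d)) has_derivative (\<lambda>t. grad g x \<bullet> (t *\<^sub>R d))) (at 0)"
    by (rule has_derivative_compose)
  then show ?thesis by simp
qed

lemma grad_graph_function_inner:
  assumes "graph_chart \<Omega> U b s \<gamma>"
  shows "grad \<gamma> x \<bullet> b = 0"
proof -
  have C1: "C1_on UNIV \<gamma>" and inv: "\<And>t. \<gamma> (x + t *\<^sub>R b) = \<gamma> x"
    using assms by (auto simp: graph_chart_def)
  have "((\<lambda>t::real. \<gamma> x) has_derivative (\<lambda>t. t * (grad \<gamma> x \<bullet> b))) (at 0)"
    using has_derivative_along_line[OF C1, of x b] by (simp add: inv)
  then have "(\<lambda>t. t * (grad \<gamma> x \<bullet> b)) = (\<lambda>_. 0)"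
    by (rule has_derivative_unique) simp
  then show ?thesis by (metis mult_1)
qed

text \<open>\<open>grad \<gamma> x\<close> is orthogonal to the unit vector \<open>b\<close>, so
  Pythagoras applies. The length of the unnormalised normal is exactly the surface element, and the
  two cancel in flux integrals.\<close>

lemma norm_graph_normal:
  assumes "graph_chart \<Omega> U b s \<gamma>"
  shows "norm (s *\<^sub>R (b - grad \<gamma> x)) = sqrt (1 + (norm (grad \<gamma> x))\<^sup>2)"
proof -
  have b: "b \<in> Basis" and s: "s = 1 \<or> s = -1" using assms by (auto simp: graph_chart_def)
  have "(norm (b - grad \<gamma> x))\<^sup>2 = 1 + (norm (grad \<gamma> x))\<^sup>2"
    using grad_graph_function_inner[OF assms, of x] inner_commute[of b "grad \<gamma> x"] b
    by (simp add: power2_norm_eq_inner inner_diff_left inner_diff_right)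
  then have "norm (b - grad \<gamma> x) = sqrt (1 + (norm (grad \<gamma> x))\<^sup>2)"
    by (metis norm_ge_zero real_sqrt_abs abs_of_nonneg)
  then show ?thesis using s by auto
qed

text \<open>The curve is a straight line in direction \<open>d\<close>, corrected along
  \<open>b\<close> so that it stays on the graph. These vectors fill the tangent hyperplane and thus
  pin down the normal direction.\<close>

lemma tangent_vector_graph:
  assumes "open \<Omega>" and ch: "graph_chart \<Omega> U b s \<gamma>" and x: "x \<in> U" "x \<in> frontier \<Omega>"
    and d: "d \<bullet> b = 0"
  shows "d + (grad \<gamma> x \<bullet> d) *\<^sub>R b \<in> tangent_vectors (frontier \<Omega>) x"
proof -
  have U: "open U" and b: "b \<in> Basis" and inv: "\<And>x t. \<gamma> (x + t *\<^sub>R b) = \<gamma> x" and C1: "C1_on UNIV \<gamma>"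
    using ch by (auto simp: graph_chart_def)
  define c where "c t = x + t *\<^sub>R d + (\<gamma> (x + t *\<^sub>R d) - \<gamma> x) *\<^sub>R b" for t
  have "(c has_derivative (\<lambda>t. t *\<^sub>R (d + (grad \<gamma> x \<bullet> d) *\<^sub>R b))) (at 0)"
    unfolding c_def[abs_def]
    by (auto intro!: derivative_eq_intros has_derivative_along_line[OF C1] simp: scaleR_add_right)
  then have deriv: "(c has_vector_derivative d + (grad \<gamma> x \<bullet> d) *\<^sub>R b) (at 0)"
    by (simp add: has_vector_derivative_def)
  have c0: "c 0 = x" by (simp add: c_def)
  have "isCont c 0" using deriv by (rule has_vector_derivative_continuous)
  then have "\<forall>\<^sub>F t in at 0. c t \<in> U"
    using U x(1) c0 by (metis continuous_at_open eventually_at_topological tendsto_def isCont_def)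
  moreover have "c t \<in> frontier \<Omega>" if "c t \<in> U" for t
  proof -
    have "\<gamma> x = x \<bullet> b" using graph_chart_frontier[OF assms(1) ch x(1)] x(2) by simp
    moreover have "\<gamma> (c t) = \<gamma> (x + t *\<^sub>R d)" unfolding c_def by (rule inv)
    moreover have "c t \<bullet> b = x \<bullet> b + \<gamma> (x + t *\<^sub>R d) - \<gamma> x"
      using d b by (simp add: c_def inner_add_left)
    ultimately show ?thesis using graph_chart_frontier[OF assms(1) ch that] by simp
  qed
  ultimately have "\<forall>\<^sub>F t in at 0. c t \<in> frontier \<Omega>" by (rule eventually_mono)
  with deriv c0 show ?thesis unfolding tangent_vectors_def by blast
qed

text \<open>Along a curve in the frontier the function \<gamma> - <., b> vanishes, so the chain rule
  annihilates its derivative in direction \<open>\<tau>\<close>.\<close>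

lemma tangent_vector_orthogonal_graph_normal:
  assumes "open \<Omega>" and ch: "graph_chart \<Omega> U b s \<gamma>" and x: "x \<in> U"
    and \<tau>: "\<tau> \<in> tangent_vectors (frontier \<Omega>) x"
  shows "\<tau> \<bullet> (b - grad \<gamma> x) = 0"
proof -
  have U: "open U" and C1: "C1_on UNIV \<gamma>" using ch by (auto simp: graph_chart_def)
  obtain c :: "real \<Rightarrow> 'a" where c: "c 0 = x" "\<forall>\<^sub>F t in at 0. c t \<in> frontier \<Omega>"
      "(c has_vector_derivative \<tau>) (at 0)"
    using \<tau> by (auto simp: tangent_vectors_def)
  define g where "g t = \<gamma> (c t) - c t \<bullet> b" for t
  have "(\<gamma> has_derivative (\<lambda>h. grad \<gamma> x \<bullet> h)) (at (c 0))"
    using C1_on_has_derivative_grad[OF open_UNIV C1] c(1) by simp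
  then have "((\<lambda>t. \<gamma> (c t)) has_derivative (\<lambda>t. grad \<gamma> x \<bullet> (t *\<^sub>R \<tau>))) (at 0)"
    using has_derivative_compose c(3)[unfolded has_vector_derivative_def] by blast
  then have g': "(g has_derivative (\<lambda>t. grad \<gamma> x \<bullet> (t *\<^sub>R \<tau>) - (t *\<^sub>R \<tau>) \<bullet> b)) (at 0)"
    unfolding g_def[abs_def]
    by (intro has_derivative_diff has_derivative_inner_left c(3)[unfolded has_vector_derivative_def])
  have "isCont c 0" using c(3) by (rule has_vector_derivative_continuous)
  then have "\<forall>\<^sub>F t in at 0. c t \<in> U"
    using U x c(1) by (metis continuous_at_open eventually_at_topological tendsto_def isCont_def)
  with c(2) have "\<forall>\<^sub>F t in at 0. g t = 0"
    by eventually_elim (use graph_chart_frontier[OF assms(1) ch] in \<open>simp add: g_def\<close>)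
  \<comment> \<open>\<open>tangent_vectors\<close> constrains the curve only at nonzero parameters;
    the value at 0 follows by continuity.\<close>
  moreover have "g 0 = 0"
  proof -
    have "(g \<longlongrightarrow> g 0) (at 0)"
      using has_derivative_continuous[OF g'] by (simp add: isCont_def)
    moreover have "(g \<longlongrightarrow> 0) (at 0)"
      using calculation tendsto_eventually[OF \<open>\<forall>\<^sub>F t in at 0. g t = 0\<close>] by simp
    ultimately show ?thesis using tendsto_unique[OF at_neq_bot] by blast
  qed
  ultimately have "(g has_derivative (\<lambda>_. 0)) (at 0)"
    by (intro has_derivative_transform_eventually[OF has_derivative_const]) (auto elim: eventually_mono)
  then have "(\<lambda>t. grad \<gamma> x \<bullet> (t *\<^sub>R \<tau>) - (t *\<^sub>R \<tau>) \<bullet> b) = (\<lambda>_. 0)"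
    using has_derivative_unique g' by blast
  from fun_cong[OF this, of 1] show ?thesis
    by (simp add: inner_diff_right inner_commute)
qed

text \<open>Along this vector the depth starts at 0 with derivative -q, where q > 0 is the length of
  \<open>b - grad \<gamma> x\<close>. It is therefore negative just ahead and positive just behind,
  which decides membership in \<open>\<Omega>\<close>.\<close>

lemma is_outward_unit_normal_graph:
  assumes "open \<Omega>" and ch: "graph_chart \<Omega> U b s \<gamma>" and x: "x \<in> U" "x \<in> frontier \<Omega>"
  shows "is_outward_unit_normal \<Omega> x ((s / sqrt (1 + (norm (grad \<gamma> x))\<^sup>2)) *\<^sub>R (b - grad \<gamma> x))"
    (is "is_outward_unit_normal \<Omega> x ?\<nu>")
proof -
  have U: "open U" and b: "b \<in> Basis" and s: "s = 1 \<or> s = -1" and C1: "C1_on UNIV \<gamma>"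
    using ch by (auto simp: graph_chart_def)
  define q where "q = sqrt (1 + (norm (grad \<gamma> x))\<^sup>2)"
  have q: "q > 0" "q\<^sup>2 = 1 + (norm (grad \<gamma> x))\<^sup>2"
    by (auto simp: q_def add_pos_nonneg add_nonneg_nonneg)
  have nq: "norm (b - grad \<gamma> x) = q" using norm_graph_normal[OF ch, of x] s by (auto simp: q_def)
  define \<nu> where "\<nu> = ?\<nu>"
  have \<nu>: "\<nu> = (s / q) *\<^sub>R (b - grad \<gamma> x)" by (simp add: q_def \<nu>_def)
  define g where "g t = s * (\<gamma> (x + t *\<^sub>R \<nu>) - (x + t *\<^sub>R \<nu>) \<bullet> b)" for t
  have "(g has_derivative (\<lambda>t. s * (t * (grad \<gamma> x \<bullet> \<nu>) - (t *\<^sub>R \<nu>) \<bullet> b))) (at 0)"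
    unfolding g_def[abs_def]
    by (auto intro!: derivative_eq_intros has_derivative_along_line[OF C1])
  moreover have "s * (t * (grad \<gamma> x \<bullet> \<nu>) - (t *\<^sub>R \<nu>) \<bullet> b) = - q * t" for t
  proof -
    have "grad \<gamma> x \<bullet> \<nu> - \<nu> \<bullet> b = - ((s / q) * ((b - grad \<gamma> x) \<bullet> (b - grad \<gamma> x)))"
      unfolding \<nu> by (simp add: inner_diff_left inner_diff_right inner_commute algebra_simps)
    also have "\<dots> = - (s * q)"
      using q(1) by (simp add: power2_norm_eq_inner[symmetric] nq power2_eq_square)
    finally have *: "grad \<gamma> x \<bullet> \<nu> - \<nu> \<bullet> b = - (s * q)" .
    have "s * (t * (grad \<gamma> x \<bullet> \<nu>) - (t *\<^sub>R \<nu>) \<bullet> b) = s * t * (grad \<gamma> x \<bullet> \<nu> - \<nu> \<bullet> b)"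
      by (simp only: inner_scaleR_left inner_scaleR_right right_diff_distrib mult.assoc)
    then show ?thesis unfolding * using s by auto
  qed
  ultimately have "(g has_derivative (\<lambda>t. - q * t)) (at 0)" by simp
  then have g': "(g has_real_derivative - q) (at 0)"
    unfolding has_field_derivative_def .
  have g0: "g 0 = 0"
    using graph_chart_frontier[OF assms(1) ch x(1)] x(2) by (simp add: g_def)
  obtain d1 where d1: "d1 > 0" "\<And>h. 0 < h \<Longrightarrow> h < d1 \<Longrightarrow> g h < 0"
    using DERIV_neg_dec_right[OF g'] q(1) g0 by auto
  obtain d2 where d2: "d2 > 0" "\<And>h. 0 < h \<Longrightarrow> h < d2 \<Longrightarrow> 0 < g (- h)"
    using DERIV_neg_dec_left[OF g'] q(1) g0 by auto
  obtain r where r: "r > 0" "ball x r \<subseteq> U" using U x(1) by (meson openE)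
  have norm_\<nu>: "norm \<nu> = 1" unfolding \<nu> using s q(1) nq by auto
  have "\<forall>\<^sub>F t in at_right 0. x + t *\<^sub>R \<nu> \<notin> \<Omega> \<and> x - t *\<^sub>R \<nu> \<in> \<Omega>"
    unfolding eventually_at_right_field
  proof (intro exI[of _ "min r (min d1 d2)"] conjI allI impI)
    show "0 < min r (min d1 d2)" using r d1 d2 by simp
    fix t assume t: "0 < t" "t < min r (min d1 d2)"
    have "x + a *\<^sub>R \<nu> \<in> U" if "\<bar>a\<bar> < r" for a
      using that norm_\<nu> by (intro subsetD[OF r(2)]) (simp add: dist_norm)
    from this[of t] this[of "- t"] have inU: "x + t *\<^sub>R \<nu> \<in> U" "x + (- t) *\<^sub>R \<nu> \<in> U"
      using t by simp_all
    show "x + t *\<^sub>R \<nu> \<notin> \<Omega>"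
      using graph_chart_level[OF ch inU(1)] d1(2)[of t] t by (simp add: g_def)
    have "x + (- t) *\<^sub>R \<nu> \<in> \<Omega>"
      using graph_chart_level[OF ch inU(2)] d2(2)[of t] t unfolding g_def by simp
    then show "x - t *\<^sub>R \<nu> \<in> \<Omega>" by simp
  qed
  moreover have "\<forall>\<tau>\<in>tangent_vectors (frontier \<Omega>) x. \<tau> \<bullet> \<nu> = 0"
    using tangent_vector_orthogonal_graph_normal[OF assms(1) ch x(1)] by (simp add: \<nu>)
  ultimately have "is_outward_unit_normal \<Omega> x \<nu>" using norm_\<nu> unfolding is_outward_unit_normal_def by blast
  then show ?thesis by (simp only: \<nu>_def)
qed

text \<open>Orthogonality to the lifted basis vectors leaves only multiples of
  \<open>b - grad \<gamma> x\<close>, and unit length leaves two signs. The wrong sign would put the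
  same nearby points both inside and outside \<open>\<Omega>\<close>.\<close>

lemma outward_normal_graph:
  assumes "open \<Omega>" and ch: "graph_chart \<Omega> U b s \<gamma>" and x: "x \<in> U" "x \<in> frontier \<Omega>"
  shows "outward_normal \<Omega> x = (s / sqrt (1 + (norm (grad \<gamma> x))\<^sup>2)) *\<^sub>R (b - grad \<gamma> x)"
    (is "_ = ?\<nu>")
  unfolding outward_normal_def
proof (rule the_equality)
  show \<nu>: "is_outward_unit_normal \<Omega> x ?\<nu>" by (rule is_outward_unit_normal_graph[OF assms])
  fix \<mu> assume \<mu>: "is_outward_unit_normal \<Omega> x \<mu>"
  have b: "b \<in> Basis" and s: "s = 1 \<or> s = -1" using ch by (auto simp: graph_chart_def)
  have \<mu>_eq: "\<mu> = (\<mu> \<bullet> b) *\<^sub>R (b - grad \<gamma> x)"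
  proof (rule euclidean_eqI)
    fix c :: 'a assume c: "c \<in> Basis"
    show "\<mu> \<bullet> c = ((\<mu> \<bullet> b) *\<^sub>R (b - grad \<gamma> x)) \<bullet> c"
    proof (cases "c = b")
      case True
      then show ?thesis using grad_graph_function_inner[OF ch, of x] b by (simp add: inner_diff_left)
    next
      case False
      then have cb: "c \<bullet> b = 0" using c b by (simp add: inner_Basis)
      then have "(c + (grad \<gamma> x \<bullet> c) *\<^sub>R b) \<bullet> \<mu> = 0"
        using \<mu> tangent_vector_graph[OF assms(1) ch x] by (simp add: is_outward_unit_normal_def)
      then have "\<mu> \<bullet> c = - (grad \<gamma> x \<bullet> c) * (\<mu> \<bullet> b)"
        by (simp add: inner_add_left inner_add_right inner_commute[of _ \<mu>])
      then show ?thesis using cb by (simp add: inner_diff_left inner_commute[of b c])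
    qed
  qed
  define q where "q = sqrt (1 + (norm (grad \<gamma> x))\<^sup>2)"
  have q: "q > 0" by (auto simp: q_def add_pos_nonneg)
  have nq: "norm (b - grad \<gamma> x) = q" using norm_graph_normal[OF ch, of x] s by (auto simp: q_def)
  have "1 = norm \<mu>" using \<mu> by (simp add: is_outward_unit_normal_def)
  also have "\<dots> = \<bar>\<mu> \<bullet> b\<bar> * q" by (subst \<mu>_eq) (simp add: nq)
  finally have "\<bar>\<mu> \<bullet> b\<bar> = 1 / q" using q by (simp add: field_simps)
  then have "\<mu> \<bullet> b = s / q \<or> \<mu> \<bullet> b = - (s / q)" using s by (auto simp: abs_if split: if_splits)
  then consider "\<mu> = ?\<nu>" | "\<mu> = - ?\<nu>" using \<mu>_eq by (auto simp: q_def)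
  then show "\<mu> = ?\<nu>"
  proof cases
    case 2
    have "\<forall>\<^sub>F t in at_right 0. x + t *\<^sub>R \<mu> \<notin> \<Omega> \<and> x - t *\<^sub>R ?\<nu> \<in> \<Omega>"
      using \<mu> \<nu> unfolding is_outward_unit_normal_def by (auto elim: eventually_elim2)
    then have "\<forall>\<^sub>F t in at_right (0::real). False"
      by (rule eventually_mono) (simp add: 2)
    then show ?thesis by simp
  qed
qed

section \<open>The divergence theorem\<close>

definition graph_flux ::
  "'a::euclidean_space set \<Rightarrow> ('a \<Rightarrow> 'a) \<Rightarrow> 'a \<Rightarrow> ('a \<Rightarrow> real) \<Rightarrow> ('a \<Rightarrow> real) \<Rightarrow> ('a \<Rightarrow> real) \<Rightarrow> real" where
  "graph_flux \<Omega> F b \<gamma> \<zeta> y =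
     \<zeta> (graph_point b \<gamma> y) * sqrt (1 + (norm (grad \<gamma> (graph_point b \<gamma> y)))\<^sup>2) *
     (F (graph_point b \<gamma> y) \<bullet> outward_normal \<Omega> (graph_point b \<gamma> y))"

lemma graph_chart_graph_point_frontier:
  assumes "open \<Omega>" "graph_chart \<Omega> U b s \<gamma>" "graph_point b \<gamma> y \<in> U"
  shows "graph_point b \<gamma> y \<in> frontier \<Omega>"
proof -
  have "s = 1 \<or> s = -1" using assms(2) by (auto simp: graph_chart_def)
  then show ?thesis
    using graph_chart_frontier[OF assms] graph_chart_graph_point[OF assms(2), of y 0] by auto
qed

text \<open>The surface element cancels the normalisation of the normal. Graph points outside the
  chart, where the normal is unknown, do no harm because \<open>\<zeta>\<close> vanishes
  there.\<close>

lemma graph_flux_eq: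
  assumes "open \<Omega>" and ch: "graph_chart \<Omega> U b s \<gamma>" and "closure {x. \<zeta> x \<noteq> 0} \<subseteq> U"
  shows "graph_flux \<Omega> F b \<gamma> \<zeta> y =
    (\<lambda>x. \<zeta> x * (F x \<bullet> (s *\<^sub>R (b - grad \<gamma> x)))) (graph_point b \<gamma> y)"
proof (cases "\<zeta> (graph_point b \<gamma> y) = 0")
  case False
  define q where "q = sqrt (1 + (norm (grad \<gamma> (graph_point b \<gamma> y)))\<^sup>2)"
  have "q > 0" by (auto simp: q_def add_pos_nonneg)
  have "graph_point b \<gamma> y \<in> U"
    using False assms(3) closure_subset[of "{x. \<zeta> x \<noteq> 0}"] by auto
  note n = outward_normal_graph[OF assms(1) ch this graph_chart_graph_point_frontier[OF assms(1) ch this]]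
  show ?thesis unfolding graph_flux_def n q_def[symmetric] using \<open>q > 0\<close> by simp
qed (simp add: graph_flux_def)

lemma set_integral_sum_list:
  fixes g :: "'b \<Rightarrow> 'a \<Rightarrow> real"
  assumes "\<And>a. a \<in> set A \<Longrightarrow> set_integrable M S (g a)"
  shows "set_integrable M S (\<lambda>x. \<Sum>a\<leftarrow>A. g a x) \<and>
    (LINT x:S|M. \<Sum>a\<leftarrow>A. g a x) = (\<Sum>a\<leftarrow>A. LINT x:S|M. g a x)"
  using assms
proof (induction A)
  case Nil
  then show ?case by (simp add: set_integrable_def set_lebesgue_integral_def)
next
  case (Cons a A)
  then show ?case by (simp add: set_integral_add)
qed

lemma boundary_partitionD:
  assumes "boundary_partition \<Omega> A" "(b, \<gamma>, \<zeta>) \<in> set A"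
  shows "C1_on UNIV \<zeta>" "0 \<le> \<zeta> x" "bounded {x. \<zeta> x \<noteq> 0}"
    "\<exists>U s. graph_chart \<Omega> U b s \<gamma> \<and> closure {x. \<zeta> x \<noteq> 0} \<subseteq> U"
  using bspec[OF conjunct1[OF assms(1)[unfolded boundary_partition_def]] assms(2)] by simp_all

text \<open>Near the boundary the chart formula is summed over the partition; the remaining part is
  compactly supported in \<open>\<Omega>\<close> and contributes no flux. All pieces are applied to
  C - div F and reassembled at the end.\<close>

theorem divergence_theorem:
  fixes \<Omega> :: "'a::euclidean_space set" and F :: "'a \<Rightarrow> 'a"
  assumes \<Omega>: "open \<Omega>" "bounded \<Omega>" and A: "boundary_partition \<Omega> A"
    and F: "C1_on \<Omega> F" "continuous_on (closure \<Omega>) F" "\<And>x. x \<in> \<Omega> \<Longrightarrow> divergence F x \<le> C"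
  shows "\<And>b \<gamma> \<zeta>. (b, \<gamma>, \<zeta>) \<in> set A \<Longrightarrow> integrable (hyperplane_measure b) (graph_flux \<Omega> F b \<gamma> \<zeta>)"
    and "set_integrable lborel \<Omega> (divergence F)"
    and "(LINT x:\<Omega>|lborel. divergence F x) =
      (\<Sum>(b, \<gamma>, \<zeta>)\<leftarrow>A. LINT y|hyperplane_measure b. graph_flux \<Omega> F b \<gamma> \<zeta> y)"
proof -
  define Z :: "'a \<times> ('a \<Rightarrow> real) \<times> ('a \<Rightarrow> real) \<Rightarrow> 'a \<Rightarrow> real" where "Z a = snd (snd a)" for a
  define flux where "flux a = (LINT y|hyperplane_measure (fst a).
      graph_flux \<Omega> F (fst a) (fst (snd a)) (Z a) y)" for a
  have chart: "integrable (hyperplane_measure b) (graph_flux \<Omega> F b \<gamma> \<zeta>)"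
    "set_integrable lborel \<Omega> (\<lambda>x. \<zeta> x * (C - divergence F x))"
    "(LINT x:\<Omega>|lborel. \<zeta> x * (C - divergence F x)) =
      (LINT x:\<Omega>|lborel. C * \<zeta> x + grad \<zeta> x \<bullet> F x)
      - (LINT y|hyperplane_measure b. graph_flux \<Omega> F b \<gamma> \<zeta> y)"
    "C1_on UNIV \<zeta>"
    if a: "(b, \<gamma>, \<zeta>) \<in> set A" for b \<gamma> \<zeta>
  proof -
    obtain U s where \<zeta>: "C1_on UNIV \<zeta>" "\<And>x. 0 \<le> \<zeta> x" "bounded {x. \<zeta> x \<noteq> 0}"
        "closure {x. \<zeta> x \<noteq> 0} \<subseteq> U" and ch: "graph_chart \<Omega> U b s \<gamma>"
      using boundary_partitionD[OF A a] by blast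
    have flux: "graph_flux \<Omega> F b \<gamma> \<zeta> =
        (\<lambda>y. \<zeta> (graph_point b \<gamma> y) * (F (graph_point b \<gamma> y) \<bullet> (s *\<^sub>R (b - grad \<gamma> (graph_point b \<gamma> y)))))"
      using graph_flux_eq[OF \<Omega>(1) ch \<zeta>(4)] by blast
    note D = divergence_graph_chart[OF \<Omega> ch \<zeta> F]
    show "integrable (hyperplane_measure b) (graph_flux \<Omega> F b \<gamma> \<zeta>)"
      unfolding flux by (rule D(1))
    show "set_integrable lborel \<Omega> (\<lambda>x. \<zeta> x * (C - divergence F x))" by (rule D(2))
    show "(LINT x:\<Omega>|lborel. \<zeta> x * (C - divergence F x)) =
      (LINT x:\<Omega>|lborel. C * \<zeta> x + grad \<zeta> x \<bullet> F x)
      - (LINT y|hyperplane_measure b. graph_flux \<Omega> F b \<gamma> \<zeta> y)"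
      unfolding flux by (rule D(3))
    show "C1_on UNIV \<zeta>" by (rule \<zeta>(1))
  qed
  then show "\<And>b \<gamma> \<zeta>. (b, \<gamma>, \<zeta>) \<in> set A \<Longrightarrow> integrable (hyperplane_measure b) (graph_flux \<Omega> F b \<gamma> \<zeta>)"
    by blast
  have ZA: "set_integrable lborel \<Omega> (\<lambda>x. Z a x * (C - divergence F x))"
    "(LINT x:\<Omega>|lborel. Z a x * (C - divergence F x)) =
      (LINT x:\<Omega>|lborel. C * Z a x + grad (Z a) x \<bullet> F x) - flux a"
    "C1_on UNIV (Z a)" if "a \<in> set A" for a
    using chart[of "fst a" "fst (snd a)" "Z a"] that by (simp_all add: Z_def flux_def)
  obtain W where W: "open W" "frontier \<Omega> \<subseteq> W" "\<And>x. x \<in> W \<Longrightarrow> (\<Sum>a\<leftarrow>A. Z a x) = 1"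
    using A unfolding boundary_partition_def Z_def by (auto simp: split_def)

  \<comment> \<open>The partition functions sum to 1 only near the boundary, so
    \<open>\<zeta>0\<close> may take either sign inside. Its compact support in
    \<open>\<Omega>\<close> is what integration by parts asks for.\<close>
  define \<zeta>0 where "\<zeta>0 x = 1 - (\<Sum>a\<leftarrow>A. Z a x)" for x
  have sum_C1: "C1_on UNIV (\<lambda>x. \<Sum>a\<leftarrow>A. Z a x)"
    and grad_sum: "grad (\<lambda>x. \<Sum>a\<leftarrow>A. Z a x) x = (\<Sum>a\<leftarrow>A. grad (Z a) x)" for x
    using C1_on_sum_list[OF open_UNIV, of A Z] ZA(3) by auto
  have grad_const: "grad (\<lambda>_. 1::real) x = 0" for x :: 'a by (rule grad_eqI) simp
  have \<zeta>0: "C1_on UNIV \<zeta>0" "grad \<zeta>0 x = - (\<Sum>a\<leftarrow>A. grad (Z a) x)" for x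
    using C1_on_diff[OF open_UNIV C1_on_const[OF open_UNIV, of 1] sum_C1]
    unfolding \<zeta>0_def[abs_def] by (auto simp: grad_const grad_sum)
  define K where "K = closure \<Omega> - W"
  have K: "compact K" "K \<subseteq> \<Omega>"
    using W(1,2) \<Omega> closure_subset unfolding K_def
    by (auto simp: compact_diff compact_closure frontier_def interior_open)
  have K0: "\<zeta>0 x = 0" if "x \<in> \<Omega> - K" for x
    using that W(3)[of x] closure_subset[of \<Omega>] by (auto simp: \<zeta>0_def K_def)
  note parts = integral_by_parts_compact_support[OF \<Omega>(1) F(1) C1_on_subset[OF \<zeta>0(1)] K K0, OF subset_UNIV]
  have C\<zeta>0: "set_integrable lborel \<Omega> (\<lambda>x. C * \<zeta>0 x)"
    by (intro set_integrable_continuous_on_closure[OF \<Omega>] continuous_on_mult continuous_on_const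
        continuous_on_subset[OF C1_on_imp_continuous_on[OF \<zeta>0(1)]]) simp
  have int0: "set_integrable lborel \<Omega> (\<lambda>x. \<zeta>0 x * (C - divergence F x))"
    "(LINT x:\<Omega>|lborel. \<zeta>0 x * (C - divergence F x)) =
      (LINT x:\<Omega>|lborel. C * \<zeta>0 x + grad \<zeta>0 x \<bullet> F x)"
    using set_integral_diff[OF C\<zeta>0 parts(1)] set_integral_add[OF C\<zeta>0 parts(2)] parts(3)
    by (simp_all add: algebra_simps)
  have int_w: "set_integrable lborel \<Omega> (\<lambda>x. C * Z a x + grad (Z a) x \<bullet> F x)" if "a \<in> set A" for a
    using C1_on_imp_continuous_on[OF ZA(3)[OF that]] C1_on_continuous_on_grad[OF ZA(3)[OF that]] F(2)
    by (intro set_integrable_continuous_on_closure[OF \<Omega>] continuous_on_add continuous_on_mult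
        continuous_on_const continuous_on_inner) (auto intro: continuous_on_subset)

  have split: "C - divergence F x = \<zeta>0 x * (C - divergence F x) + (\<Sum>a\<leftarrow>A. Z a x * (C - divergence F x))" for x
    by (simp add: \<zeta>0_def sum_list_mult_const left_diff_distrib)
  \<comment> \<open>The functions add up to 1 identically, so their gradients cancel and only the
    constant C survives from the interior terms.\<close>
  have split': "C = (C * \<zeta>0 x + grad \<zeta>0 x \<bullet> F x) + (\<Sum>a\<leftarrow>A. C * Z a x + grad (Z a) x \<bullet> F x)" for x
  proof -
    have "(\<Sum>a\<leftarrow>A. grad (Z a) x \<bullet> F x) = (\<Sum>a\<leftarrow>A. grad (Z a) x) \<bullet> F x"
      by (induction A) (auto simp: inner_add_left)
    then show ?thesis
      unfolding \<zeta>0(2) by (simp add: \<zeta>0_def sum_list_addf sum_list_const_mult right_diff_distrib)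
  qed
  note S = set_integral_sum_list[of A lborel \<Omega> "\<lambda>a x. Z a x * (C - divergence F x)", OF ZA(1)]
  note S' = set_integral_sum_list[of A lborel \<Omega> "\<lambda>a x. C * Z a x + grad (Z a) x \<bullet> F x", OF int_w]
  have C_int: "set_integrable lborel \<Omega> (\<lambda>_. C)"
    by (intro set_integrable_continuous_on_closure[OF \<Omega>] continuous_on_const)
  have W0: "set_integrable lborel \<Omega> (\<lambda>x. C * \<zeta>0 x + grad \<zeta>0 x \<bullet> F x)"
    using set_integral_add[OF C\<zeta>0 parts(2)] by simp
  have D: "set_integrable lborel \<Omega> (\<lambda>x. C - divergence F x)"
    by (subst split, rule set_integral_add(1)[OF int0(1) conjunct1[OF S]])
  then show div_int: "set_integrable lborel \<Omega> (divergence F)"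
    using set_integral_diff(1)[OF C_int D] by simp
  have "(LINT x:\<Omega>|lborel. C - divergence F x) =
      (LINT x:\<Omega>|lborel. \<zeta>0 x * (C - divergence F x)) + (\<Sum>a\<leftarrow>A. LINT x:\<Omega>|lborel. Z a x * (C - divergence F x))"
  proof -
    have "(LINT x:\<Omega>|lborel. C - divergence F x) = (LINT x:\<Omega>|lborel.
        \<zeta>0 x * (C - divergence F x) + (\<Sum>a\<leftarrow>A. Z a x * (C - divergence F x)))"
      by (rule arg_cong[OF ext[OF split]])
    also note set_integral_add(2)[OF int0(1) conjunct1[OF S]]
    also note conjunct2[OF S]
    finally show ?thesis .
  qed
  also have "\<dots> = (LINT x:\<Omega>|lborel. C * \<zeta>0 x + grad \<zeta>0 x \<bullet> F x)
      + (\<Sum>a\<leftarrow>A. (LINT x:\<Omega>|lborel. C * Z a x + grad (Z a) x \<bullet> F x) - flux a)"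
    using ZA(2) by (simp add: int0(2) cong: map_cong)
  also have "\<dots> = (LINT x:\<Omega>|lborel. C * \<zeta>0 x + grad \<zeta>0 x \<bullet> F x)
      + (\<Sum>a\<leftarrow>A. LINT x:\<Omega>|lborel. C * Z a x + grad (Z a) x \<bullet> F x) - (\<Sum>a\<leftarrow>A. flux a)"
    by (simp add: sum_list_subtractf)
  also have "\<dots> = (LINT x:\<Omega>|lborel. C) - (\<Sum>a\<leftarrow>A. flux a)"
  proof -
    have "(LINT x:\<Omega>|lborel. C) = (LINT x:\<Omega>|lborel.
        (C * \<zeta>0 x + grad \<zeta>0 x \<bullet> F x) + (\<Sum>a\<leftarrow>A. C * Z a x + grad (Z a) x \<bullet> F x))"
      by (rule arg_cong[OF ext[OF split']])
    also note set_integral_add(2)[OF W0 conjunct1[OF S']]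
    also note conjunct2[OF S']
    finally show ?thesis by simp
  qed
  finally have "(LINT x:\<Omega>|lborel. C - divergence F x) = (LINT x:\<Omega>|lborel. C) - (\<Sum>a\<leftarrow>A. flux a)" .
  then have "(LINT x:\<Omega>|lborel. divergence F x) = (\<Sum>a\<leftarrow>A. flux a)"
    using set_integral_diff(2)[OF C_int div_int] by simp
  then show "(LINT x:\<Omega>|lborel. divergence F x) =
      (\<Sum>(b, \<gamma>, \<zeta>)\<leftarrow>A. LINT y|hyperplane_measure b. graph_flux \<Omega> F b \<gamma> \<zeta> y)"
    by (simp add: flux_def Z_def split_def)
qed

section \<open>Boundary partitions and surface integrals\<close>

text \<open>The bump is the squared positive part of the polynomial r^2 - |x - c|^2; using the
  squared distance avoids the singularity of the norm at the centre.\<close>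

lemma C1_bump:
  fixes c :: "'a::euclidean_space"
  assumes "r > 0"
  obtains \<phi> :: "'a \<Rightarrow> real" where "C1_on UNIV \<phi>" "\<And>x. 0 \<le> \<phi> x" "\<And>x. \<phi> x \<noteq> 0 \<longleftrightarrow> x \<in> ball c r"
proof
  define g where "g x = r\<^sup>2 - (x - c) \<bullet> (x - c)" for x
  define \<phi> where "\<phi> x = (max 0 (g x))\<^sup>2" for x
  have D: "(g has_derivative (\<lambda>h. (- 2 *\<^sub>R (x - c)) \<bullet> h)) (at x)" for x
    unfolding g_def[abs_def]
    by (auto intro!: derivative_eq_intros simp: inner_commute inner_diff_left inner_diff_right)
  have g: "C1_on UNIV g"
    by (rule C1_on_gradI[OF open_UNIV D]) (intro continuous_intros)
  show "C1_on UNIV \<phi>"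
    unfolding \<phi>_def[abs_def]
    by (rule C1_on_compose(1)[OF open_UNIV g has_real_derivative_max_0_power2])
      (intro continuous_intros C1_on_imp_continuous_on[OF g])
  show "0 \<le> \<phi> x" for x by (simp add: \<phi>_def)
  have "g x > 0 \<longleftrightarrow> x \<in> ball c r" for x
  proof -
    have "g x > 0 \<longleftrightarrow> (norm (x - c))\<^sup>2 < r\<^sup>2" by (simp add: g_def power2_norm_eq_inner)
    also have "\<dots> \<longleftrightarrow> norm (x - c) < r"
      using assms by (meson norm_ge_zero power2_less_imp_less power_strict_mono less_imp_le zero_less_numeral)
    finally show ?thesis by (simp add: dist_norm norm_minus_commute)
  qed
  moreover have "\<phi> x \<noteq> 0 \<longleftrightarrow> g x > 0" for x by (auto simp: \<phi>_def max_def)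
  ultimately show "\<phi> x \<noteq> 0 \<longleftrightarrow> x \<in> ball c r" for x by blast
qed

text \<open>Finitely many bumps inside chart domains cover the compact frontier. Dividing by their
  sum would give the partition, but this sum vanishes far from the frontier, so the denominator must
  be modified there.\<close>

lemma boundary_partition_exists:
  fixes \<Omega> :: "'a::euclidean_space set"
  assumes "bounded \<Omega>" "C1_boundary \<Omega>"
  shows "\<exists>A. boundary_partition \<Omega> A"
proof -
  have compact: "compact (frontier \<Omega>)" using assms(1) by (simp add: compact_frontier_bounded)
  have "\<forall>x\<in>frontier \<Omega>. \<exists>b s \<gamma> U r \<phi>. graph_chart \<Omega> U b s \<gamma> \<and> r > 0 \<and> cball x r \<subseteq> U \<and>
      C1_on UNIV \<phi> \<and> (\<forall>y. 0 \<le> \<phi> y) \<and> (\<forall>y. \<phi> y \<noteq> (0::real) \<longleftrightarrow> y \<in> ball x r)"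
  proof
    fix x assume "x \<in> frontier \<Omega>"
    then obtain U b s \<gamma> where ch: "x \<in> U" "graph_chart \<Omega> U b s \<gamma>"
      using assms(2) unfolding C1_boundary_def by blast
    then have "open U" by (simp add: graph_chart_def)
    then obtain r where r: "r > 0" "cball x r \<subseteq> U" using ch(1) by (meson open_contains_cball)
    obtain \<phi> where "C1_on UNIV \<phi>" "\<And>y. 0 \<le> \<phi> y" "\<And>y. \<phi> y \<noteq> (0::real) \<longleftrightarrow> y \<in> ball x r"
      using C1_bump[OF r(1)] by metis
    with ch r show "\<exists>b s \<gamma> U r \<phi>. graph_chart \<Omega> U b s \<gamma> \<and> r > 0 \<and> cball x r \<subseteq> U \<and>
      C1_on UNIV \<phi> \<and> (\<forall>y. 0 \<le> \<phi> y) \<and> (\<forall>y. \<phi> y \<noteq> (0::real) \<longleftrightarrow> y \<in> ball x r)" by blast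
  qed
  then obtain b s \<gamma> U r \<phi> where *: "\<forall>x\<in>frontier \<Omega>. graph_chart \<Omega> (U x) (b x) (s x) (\<gamma> x) \<and> r x > 0 \<and>
      cball x (r x) \<subseteq> U x \<and>
      C1_on UNIV (\<phi> x) \<and> (\<forall>y. 0 \<le> \<phi> x y) \<and> (\<forall>y. \<phi> x y \<noteq> (0::real) \<longleftrightarrow> y \<in> ball x (r x))"
    by metis
  obtain T where T: "T \<subseteq> frontier \<Omega>" "finite T" "frontier \<Omega> \<subseteq> (\<Union>x\<in>T. ball x (r x))"
    by (rule compactE_image[OF compact, of "frontier \<Omega>" "\<lambda>x. ball x (r x)"]) (use * in \<open>auto intro!: centre_in_ball[THEN iffD2]\<close>)
  obtain xs where xs: "set xs = T" using T(2) finite_list by blast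
  have \<phi>: "C1_on UNIV (\<phi> x)" "0 \<le> \<phi> x y" "\<phi> x y \<noteq> 0 \<longleftrightarrow> y \<in> ball x (r x)"
    and chart: "graph_chart \<Omega> (U x) (b x) (s x) (\<gamma> x)" "r x > 0" "cball x (r x) \<subseteq> U x" if "x \<in> set xs" for x y
    using * that xs T(1) by auto
  define \<Phi> where "\<Phi> y = (\<Sum>x\<leftarrow>xs. \<phi> x y)" for y
  have \<Phi>: "C1_on UNIV \<Phi>" unfolding \<Phi>_def[abs_def]
    using C1_on_sum_list[OF open_UNIV, of xs \<phi>] \<phi>(1) by blast
  have cont: "continuous_on S \<Phi>" for S
    by (rule continuous_on_subset[OF C1_on_imp_continuous_on[OF \<Phi>]]) simp
  have \<Phi>_nonneg: "0 \<le> \<Phi> y" for y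
    unfolding \<Phi>_def by (rule sum_list_nonneg) (use \<phi>(2) in auto)
  have \<Phi>_pos: "0 < \<Phi> y" if "y \<in> frontier \<Omega>" for y
  proof -
    obtain x where x: "x \<in> set xs" "y \<in> ball x (r x)" using T(3) \<open>y \<in> frontier \<Omega>\<close> xs by blast
    obtain ys zs where split: "xs = ys @ x # zs" using split_list[OF x(1)] by blast
    have "0 \<le> (\<Sum>x\<leftarrow>ys. \<phi> x y)" "0 \<le> (\<Sum>x\<leftarrow>zs. \<phi> x y)"
      by (rule sum_list_nonneg, use \<phi>(2) split in auto)+
    then have "\<phi> x y \<le> \<Phi> y" by (simp add: \<Phi>_def split)
    moreover have "\<phi> x y > 0" using \<phi>(2)[OF x(1), of y] \<phi>(3)[OF x(1), of y] x(2) by linarith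
    ultimately show ?thesis by simp
  qed
  obtain \<mu> where \<mu>: "\<mu> > 0" "\<And>y. y \<in> frontier \<Omega> \<Longrightarrow> \<mu> \<le> \<Phi> y"
  proof (cases "frontier \<Omega> = {}")
    case True
    then show ?thesis using that[of 1] by simp
  next
    case False
    then obtain y where "y \<in> frontier \<Omega>" "\<And>z. z \<in> frontier \<Omega> \<Longrightarrow> \<Phi> y \<le> \<Phi> z"
      using continuous_attains_inf[OF compact _ cont] by blast
    then show ?thesis using that \<Phi>_pos by blast
  qed
  \<comment> \<open>\<open>h\<close> is the identity from \<open>\<mu> / 2\<close> on and positive
    on all of [0, \<infinity>). Hence 1 / h(\<Phi>) is C1 everywhere, and the quotients still sum to
    1 where \<Phi> > \<mu>/2, a neighbourhood of the frontier.\<close>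
  define h where "h t = t + (max 0 (\<mu> / 2 - t))\<^sup>2" for t
  have h_pos: "h (\<Phi> y) > 0" for y
    using \<Phi>_nonneg[of y] \<mu>(1) by (cases "\<Phi> y = 0") (auto simp: h_def add_pos_nonneg)
  have h_id: "h t = t" if "t \<ge> \<mu> / 2" for t using that by (simp add: h_def)
  define I where "I y = inverse (h (\<Phi> y))" for y
  have I: "C1_on UNIV I"
  proof -
    have "((\<lambda>t. (max 0 (\<mu> / 2 - t))\<^sup>2) has_real_derivative 2 * max 0 (\<mu> / 2 - t) * (-1)) (at t)" for t
      by (rule DERIV_chain2[OF has_real_derivative_max_0_power2]) (auto intro!: derivative_eq_intros)
    from DERIV_add[OF DERIV_ident this]
    have Dh: "(h has_real_derivative 1 - 2 * max 0 (\<mu> / 2 - t)) (at t)" for t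
      by (simp add: h_def[abs_def])
    have H: "C1_on UNIV (\<lambda>y. h (\<Phi> y))"
      by (rule C1_on_compose(1)[OF open_UNIV \<Phi> Dh]) (intro continuous_intros cont)
    have "h (\<Phi> y) \<noteq> 0" for y using h_pos[of y] by simp
    then show ?thesis unfolding I_def[abs_def]
      by (intro C1_on_compose(1)[OF open_UNIV H DERIV_inverse] continuous_intros
          C1_on_imp_continuous_on[OF H]) auto
  qed
  define \<zeta> where "\<zeta> x y = \<phi> x y * I y" for x y
  define A where "A = map (\<lambda>x. (b x, \<gamma> x, \<zeta> x)) xs"
  have "C1_on UNIV (\<zeta> x) \<and> (\<forall>y. 0 \<le> \<zeta> x y) \<and> bounded {y. \<zeta> x y \<noteq> 0} \<and>
      (\<exists>U' s'. graph_chart \<Omega> U' (b x) s' (\<gamma> x) \<and> closure {y. \<zeta> x y \<noteq> 0} \<subseteq> U')" if x: "x \<in> set xs" for x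
  proof -
    have "C1_on UNIV (\<zeta> x)"
      unfolding \<zeta>_def[abs_def] by (rule C1_on_mult(1)[OF open_UNIV \<phi>(1)[OF x] I])
    moreover have "0 \<le> \<zeta> x y" for y
      using \<phi>(2)[OF x] h_pos[of y] by (simp add: \<zeta>_def I_def)
    moreover have sub: "{y. \<zeta> x y \<noteq> 0} \<subseteq> ball x (r x)"
      using \<phi>(3)[OF x] by (auto simp: \<zeta>_def)
    then have "bounded {y. \<zeta> x y \<noteq> 0}" using bounded_ball bounded_subset by blast
    moreover have "closure {y. \<zeta> x y \<noteq> 0} \<subseteq> U x"
      using closure_mono[OF sub] chart(2,3)[OF x] by simp
    ultimately show ?thesis using chart(1)[OF x] by blast
  qed
  moreover have "\<exists>W. open W \<and> frontier \<Omega> \<subseteq> W \<and> (\<forall>y\<in>W. (\<Sum>(b, \<gamma>, \<zeta>)\<leftarrow>A. \<zeta> y) = 1)"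
  proof (intro exI conjI ballI)
    show "open {y. \<mu> / 2 < \<Phi> y}" by (intro open_Collect_less continuous_on_const cont)
    show "frontier \<Omega> \<subseteq> {y. \<mu> / 2 < \<Phi> y}" using \<mu> by fastforce
    fix y assume y: "y \<in> {y. \<mu> / 2 < \<Phi> y}"
    have "(\<Sum>(b, \<gamma>, \<zeta>)\<leftarrow>A. \<zeta> y) = (\<Sum>x\<leftarrow>xs. \<phi> x y * I y)"
      by (simp add: A_def \<zeta>_def comp_def)
    also have "\<dots> = \<Phi> y * I y" by (simp add: \<Phi>_def sum_list_mult_const)
    also have "\<dots> = 1" using y \<mu>(1) h_id[of "\<Phi> y"] by (simp add: I_def)
    finally show "(\<Sum>(b, \<gamma>, \<zeta>)\<leftarrow>A. \<zeta> y) = 1" .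
  qed
  ultimately have "boundary_partition \<Omega> A" unfolding boundary_partition_def A_def by auto
  then show ?thesis ..
qed

text \<open>\<open>measure_of\<close> assigns the prescribed values only if they form a measure;
  this is the check required to compute with \<open>surface_measure\<close>.\<close>

lemma measure_space_sum_list_emeasure:
  assumes "\<And>i. i \<in> set A \<Longrightarrow> sets (M i) = \<Sigma>" and "sigma_algebra X \<Sigma>"
  shows "measure_space X \<Sigma> (\<lambda>E. \<Sum>i\<leftarrow>A. emeasure (M i) E)"
proof -
  have "positive \<Sigma> (\<lambda>E. \<Sum>i\<leftarrow>A. emeasure (M i) E)"
    by (simp add: positive_def)
  moreover have "(\<Sum>n. \<Sum>i\<leftarrow>A. emeasure (M i) (E n)) = (\<Sum>i\<leftarrow>A. emeasure (M i) (\<Union>(range E)))"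
    if E: "range E \<subseteq> \<Sigma>" "disjoint_family E" for E :: "nat \<Rightarrow> 'b set"
    using assms(1)
  proof (induction A)
    case (Cons i A)
    have "(\<Sum>n. emeasure (M i) (E n)) = emeasure (M i) (\<Union>(range E))"
      by (rule suminf_emeasure) (use Cons.prems E in auto)
    then show ?case using Cons by (simp add: suminf_add[symmetric])
  qed simp
  ultimately show ?thesis
    using assms(2) by (auto simp: measure_space_def intro!: countably_additiveI)
qed

text \<open>Standard induction on nonnegative measurable functions. The list sum is reindexed by
  positions because suprema of increasing sequences commute with sums over finite index
  sets.\<close>

lemma nn_integral_sum_list_measure:
  assumes "\<And>i. i \<in> set A \<Longrightarrow> sets (M i) = sets N"
    and emeasure: "\<And>E. E \<in> sets N \<Longrightarrow> emeasure N E = (\<Sum>i\<leftarrow>A. emeasure (M i) E)"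
    and g: "g \<in> borel_measurable N"
  shows "(\<integral>\<^sup>+x. g x \<partial>N) = (\<Sum>i\<leftarrow>A. \<integral>\<^sup>+x. g x \<partial>M i)"
proof -
  let ?I = "{0..<length A}"
  have sets_M: "sets (M (A ! j)) = sets N" if "j \<in> ?I" for j using assms(1) that by simp
  have meas: "f \<in> borel_measurable (M (A ! j))" if "j \<in> ?I" "f \<in> borel_measurable N" for j and f :: "_ \<Rightarrow> ennreal"
    using that(2) by (subst measurable_cong_sets[OF sets_M[OF that(1)] refl])
  have space_M: "space (M (A ! j)) = space N" if "j \<in> ?I" for j
    by (rule sets_eq_imp_space_eq[OF sets_M[OF that]])
  have "(\<integral>\<^sup>+x. g x \<partial>N) = (\<Sum>j\<in>?I. \<integral>\<^sup>+x. g x \<partial>M (A ! j))"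
    using g
  proof (induction rule: borel_measurable_induct)
    case (cong f h)
    have "(\<integral>\<^sup>+x. f x \<partial>N) = (\<integral>\<^sup>+x. h x \<partial>N)" by (rule nn_integral_cong[OF cong(3)])
    moreover have "(\<integral>\<^sup>+x. f x \<partial>M (A ! j)) = (\<integral>\<^sup>+x. h x \<partial>M (A ! j))" if "j \<in> ?I" for j
      using cong(3) space_M[OF that] by (auto intro: nn_integral_cong)
    ultimately show ?case using cong(4) by simp
  next
    case (set E)
    then show ?case
      using emeasure[of E] sets_M by (simp add: sum_list_sum_nth)
  next
    case (mult u c)
    then show ?case using meas by (simp add: nn_integral_cmult sum_distrib_left)
  next
    case (add u v)
    then show ?case using meas by (simp add: nn_integral_add sum.distrib)
  next
    case (seq U)
    have sup: "(\<integral>\<^sup>+x. (SUP i. U i) x \<partial>K) = (SUP i. \<integral>\<^sup>+x. U i x \<partial>K)"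
      if "\<And>i. U i \<in> borel_measurable K" for K
      using \<open>incseq U\<close> that by (simp add: nn_integral_monotone_convergence_SUP image_comp)
    have "(\<integral>\<^sup>+x. (SUP i. U i) x \<partial>N) = (SUP i. \<integral>\<^sup>+x. U i x \<partial>N)"
      by (rule sup) fact
    also have "\<dots> = (SUP i. \<Sum>j\<in>?I. \<integral>\<^sup>+x. U i x \<partial>M (A ! j))" using seq by simp
    also have "\<dots> = (\<Sum>j\<in>?I. SUP i. \<integral>\<^sup>+x. U i x \<partial>M (A ! j))"
      using seq by (intro ennreal_SUP_sum) (auto simp: incseq_def le_fun_def intro!: nn_integral_mono)
    also have "\<dots> = (\<Sum>j\<in>?I. \<integral>\<^sup>+x. (SUP i. U i) x \<partial>M (A ! j))"
    proof (rule sum.cong[OF refl])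
      fix j assume j: "j \<in> ?I"
      have "U i \<in> borel_measurable (M (A ! j))" for i by (rule meas[OF j]) fact
      then show "(SUP i. \<integral>\<^sup>+x. U i x \<partial>M (A ! j)) = (\<integral>\<^sup>+x. (SUP i. U i) x \<partial>M (A ! j))"
        by (rule sup[symmetric])
    qed
    finally show ?case .
  qed
  then show ?thesis by (simp add: sum_list_sum_nth)
qed

section \<open>Integration against the surface measure\<close>

lemma sets_surface_measure: "sets (surface_measure \<Omega>) = sets borel"
  unfolding surface_measure_def
  by (metis sets.sigma_sets_eq sets_measure_of space_borel top_greatest Pow_UNIV)

text \<open>For nonnegative integrands the image measure, the density and the finite sum of measures
  can all be evaluated in extended nonnegative numbers; chart integrability makes the result finite
  and permits the return to Bochner integrals.\<close>

lemma surface_integral_nonneg_eq: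
  fixes \<Omega> :: "'a::euclidean_space set" and \<phi> :: "'a \<Rightarrow> real"
  defines "A \<equiv> SOME A. boundary_partition \<Omega> A"
  assumes A: "boundary_partition \<Omega> A"
    and \<phi>: "\<And>x. 0 \<le> \<phi> x" "\<phi> \<in> borel_measurable borel"
    and int: "\<And>b \<gamma> \<zeta>. (b, \<gamma>, \<zeta>) \<in> set A \<Longrightarrow> integrable (hyperplane_measure b)
      (\<lambda>y. \<zeta> (graph_point b \<gamma> y) * sqrt (1 + (norm (grad \<gamma> (graph_point b \<gamma> y)))\<^sup>2) * \<phi> (graph_point b \<gamma> y))"
  shows "(LINT x|surface_measure \<Omega>. \<phi> x) =
    (\<Sum>(b, \<gamma>, \<zeta>)\<leftarrow>A. LINT y|hyperplane_measure b.
      \<zeta> (graph_point b \<gamma> y) * sqrt (1 + (norm (grad \<gamma> (graph_point b \<gamma> y)))\<^sup>2) * \<phi> (graph_point b \<gamma> y))"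
proof -
  define M :: "_ \<Rightarrow> 'a measure" where "M a = (case a of (b, \<gamma>, \<zeta>) \<Rightarrow> weighted_graph_measure b \<gamma> \<zeta>)" for a
  define J where "J a = (case a of (b, \<gamma>, \<zeta>) \<Rightarrow> LINT y|hyperplane_measure b.
      \<zeta> (graph_point b \<gamma> y) * sqrt (1 + (norm (grad \<gamma> (graph_point b \<gamma> y)))\<^sup>2) * \<phi> (graph_point b \<gamma> y))" for a
  have sets_M: "sets (M a) = sets borel" for a
    by (auto simp: M_def weighted_graph_measure_def split: prod.split)
  have \<sigma>: "surface_measure \<Omega> = measure_of UNIV (sets borel) (\<lambda>E. \<Sum>a\<leftarrow>A. emeasure (M a) E)"
    unfolding surface_measure_def A_def M_def by (simp add: split_def)
  have sets_\<sigma>: "sets (surface_measure \<Omega>) = sets borel" by (rule sets_surface_measure)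
  have alg: "sigma_algebra UNIV (sets borel :: 'a set set)"
    using sets.sigma_algebra_axioms[of "borel :: 'a measure"] by simp
  have "measure_space UNIV (sets borel) (\<lambda>E. \<Sum>a\<leftarrow>A. emeasure (M a) E)"
    by (rule measure_space_sum_list_emeasure[OF sets_M alg])
  then have em: "emeasure (surface_measure \<Omega>) E = (\<Sum>a\<leftarrow>A. emeasure (M a) E)" if "E \<in> sets borel" for E
    unfolding \<sigma> using that alg
    by (intro emeasure_measure_of_sigma) (auto simp: measure_space_def)
  have chart: "(\<integral>\<^sup>+x. ennreal (\<phi> x) \<partial>M a) = ennreal (J a) \<and> 0 \<le> J a" if a: "a \<in> set A" for a
  proof -
    obtain b \<gamma> \<zeta> where abc: "a = (b, \<gamma>, \<zeta>)" by (cases a)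
    note D = boundary_partitionD[OF A a[unfolded abc]]
    obtain U s where ch: "graph_chart \<Omega> U b s \<gamma>" using D(4) by blast
    have C1: "C1_on UNIV \<gamma>" using ch by (simp add: graph_chart_def)
    note [measurable] = borel_measurable_continuous_onI[OF C1_on_imp_continuous_on[OF C1]]
      borel_measurable_continuous_onI[OF C1_on_continuous_on_grad[OF C1]]
      borel_measurable_continuous_onI[OF C1_on_imp_continuous_on[OF D(1)]] \<phi>(2)
    define w where "w x = \<zeta> x * sqrt (1 + (norm (grad \<gamma> x))\<^sup>2)" for x
    have [measurable]: "w \<in> borel_measurable borel" unfolding w_def[abs_def] by measurable
    have w: "0 \<le> w x" for x using D(2) by (simp add: w_def)
    have J: "J a = (LINT y|hyperplane_measure b. w (graph_point b \<gamma> y) * \<phi> (graph_point b \<gamma> y))"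
      by (simp add: J_def abc w_def)
    have i: "integrable (hyperplane_measure b) (\<lambda>y. w (graph_point b \<gamma> y) * \<phi> (graph_point b \<gamma> y))"
      using int[OF a[unfolded abc]] by (simp add: w_def)
    have "(\<integral>\<^sup>+x. ennreal (\<phi> x) \<partial>M a)
      = (\<integral>\<^sup>+y. ennreal (w (graph_point b \<gamma> y) * \<phi> (graph_point b \<gamma> y)) \<partial>hyperplane_measure b)"
      unfolding M_def abc prod.case weighted_graph_measure_def w_def[symmetric]
      by (simp add: nn_integral_distr nn_integral_density ennreal_mult w \<phi>(1))
    also have "\<dots> = ennreal (J a)"
      unfolding J by (rule nn_integral_eq_integral[OF i]) (simp add: w \<phi>(1))
    finally show ?thesis unfolding J by (simp add: w \<phi>(1))
  qed
  have "(\<integral>\<^sup>+x. ennreal (\<phi> x) \<partial>surface_measure \<Omega>) = (\<Sum>a\<leftarrow>A. \<integral>\<^sup>+x. ennreal (\<phi> x) \<partial>M a)"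
    by (rule nn_integral_sum_list_measure)
      (use sets_M sets_\<sigma> em \<phi>(2) measurable_cong_sets[OF sets_\<sigma> refl] in auto)
  also have "\<dots> = (\<Sum>a\<leftarrow>A. ennreal (J a))" using chart by (simp cong: map_cong)
  also have "\<dots> = ennreal (\<Sum>a\<leftarrow>A. J a) \<and> 0 \<le> (\<Sum>a\<leftarrow>A. J a)"
    using chart by (induction A) auto
  finally have nn: "(\<integral>\<^sup>+x. ennreal (\<phi> x) \<partial>surface_measure \<Omega>) = ennreal (\<Sum>a\<leftarrow>A. J a)"
    "0 \<le> (\<Sum>a\<leftarrow>A. J a)" by auto
  have "(LINT x|surface_measure \<Omega>. \<phi> x) = enn2real (\<integral>\<^sup>+x. ennreal (\<phi> x) \<partial>surface_measure \<Omega>)"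
    by (rule integral_eq_nn_integral) (use \<phi> measurable_cong_sets[OF sets_\<sigma> refl] in auto)
  also have "\<dots> = (\<Sum>a\<leftarrow>A. J a)" using nn by simp
  finally show ?thesis by (simp add: J_def split_def)
qed

section \<open>The weighted Hardy inequality\<close>

text \<open>Positive and negative parts replace the sign function, so that continuity of the
  derivative at 0 can be read off, also for p < 2.\<close>

lemma has_real_derivative_abs_powr:
  fixes p :: real
  assumes "p > 1"
  shows "((\<lambda>t. \<bar>t\<bar> powr p) has_real_derivative p * (max 0 t powr (p - 1) - max 0 (- t) powr (p - 1))) (at t)"
proof -
  consider "t > 0" | "t < 0" | "t = 0" by linarith
  then show ?thesis
  proof cases
    case 1
    then have "((\<lambda>t. t powr p) has_real_derivative p * (max 0 t powr (p - 1) - max 0 (- t) powr (p - 1))) (at t)"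
      using has_real_derivative_powr[of t p] by simp
    then show ?thesis
      by (rule has_field_derivative_transform_within_open[where S = "{0<..}"]) (use 1 in auto)
  next
    case 2
    then have "((\<lambda>t. (- t) powr p) has_real_derivative p * (- t) powr (p - 1) * (- 1)) (at t)"
      by (intro DERIV_chain2[OF has_real_derivative_powr]) (auto intro!: derivative_eq_intros)
    then have "((\<lambda>t. (- t) powr p) has_real_derivative p * (max 0 t powr (p - 1) - max 0 (- t) powr (p - 1))) (at t)"
      using 2 by simp
    then show ?thesis
      by (rule has_field_derivative_transform_within_open[where S = "{..<0}"]) (use 2 in auto)
  next
    case 3
    \<comment> \<open>This is the difference quotient at 0; it tends to zero because p - 1 >
      0.\<close>
    have "((\<lambda>h::real. sgn h * \<bar>h\<bar> powr (p - 1)) \<longlongrightarrow> 0) (at 0)"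
    proof (rule Lim_null_comparison[where g = "\<lambda>h. \<bar>h\<bar> powr (p - 1)"])
      show "\<forall>\<^sub>F h in at (0::real). norm (sgn h * \<bar>h\<bar> powr (p - 1)) \<le> \<bar>h\<bar> powr (p - 1)"
        by (intro always_eventually) (auto simp: abs_mult abs_sgn_eq)
      have "((\<lambda>h::real. \<bar>h\<bar>) \<longlongrightarrow> 0) (at 0)"
        by (rule tendsto_rabs_zero[OF tendsto_ident_at])
      then have "((\<lambda>h::real. \<bar>h\<bar> powr (p - 1)) \<longlongrightarrow> 0 powr (p - 1)) (at 0)"
        by (rule tendsto_powr'[OF _ tendsto_const]) (use assms in auto)
      then show "((\<lambda>h::real. \<bar>h\<bar> powr (p - 1)) \<longlongrightarrow> 0) (at 0)" by simp
    qed
    moreover have "\<forall>\<^sub>F h::real in at 0. sgn h * \<bar>h\<bar> powr (p - 1) = (\<bar>0 + h\<bar> powr p - \<bar>0\<bar> powr p) / h"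
      by (auto simp: eventually_at_filter powr_diff sgn_if)
    ultimately have "((\<lambda>h::real. (\<bar>0 + h\<bar> powr p - \<bar>0\<bar> powr p) / h) \<longlongrightarrow> 0) (at 0)"
      by (rule Lim_transform_eventually)
    then show ?thesis using 3 by (simp add: DERIV_def)
  qed
qed

text \<open>Young's inequality gives integrability of the product, and applied to the normalised
  functions it gives the bound: the right-hand side then integrates to 1/p + 1/q = 1.\<close>

lemma Holder_inequality:
  fixes a b :: "'b \<Rightarrow> real"
  assumes p: "p > 1" and pq: "1 / p + 1 / q = 1"
    and [measurable]: "a \<in> borel_measurable M" "b \<in> borel_measurable M"
    and nn: "\<And>x. x \<in> space M \<Longrightarrow> 0 \<le> a x" "\<And>x. x \<in> space M \<Longrightarrow> 0 \<le> b x"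
    and int: "integrable M (\<lambda>x. a x powr p)" "integrable M (\<lambda>x. b x powr q)"
  shows "integrable M (\<lambda>x. a x * b x)"
    and "(LINT x|M. a x * b x) \<le> (LINT x|M. a x powr p) powr (1 / p) * (LINT x|M. b x powr q) powr (1 / q)"
proof -
  have q: "q > 1"
  proof -
    have "1 / q = 1 - 1 / p" using pq by simp
    then have "1 / q > 0" "1 / q < 1" using p by auto
    then show ?thesis by (simp add: divide_less_eq split: if_splits)
  qed
  have young: "s * t \<le> s powr p / p + t powr q / q" if "0 \<le> s" "0 \<le> t" for s t
    by (rule Youngs_inequality[OF p q pq that])
  show ab: "integrable M (\<lambda>x. a x * b x)"
  proof (rule Bochner_Integration.integrable_bound)
    show "integrable M (\<lambda>x. a x powr p / p + b x powr q / q)" using int by simp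
    show "AE x in M. norm (a x * b x) \<le> norm (a x powr p / p + b x powr q / q)"
    proof (rule AE_I2)
      fix x assume x: "x \<in> space M"
      have "0 \<le> a x * b x" using nn[OF x] by simp
      then show "norm (a x * b x) \<le> norm (a x powr p / p + b x powr q / q)"
        using young[OF nn[OF x]] by simp
    qed
  qed measurable
  define \<alpha> where "\<alpha> = (LINT x|M. a x powr p)"
  define \<beta> where "\<beta> = (LINT x|M. b x powr q)"
  have nn\<alpha>: "0 \<le> \<alpha>" "0 \<le> \<beta>" by (simp_all add: \<alpha>_def \<beta>_def)
  show "(LINT x|M. a x * b x) \<le> \<alpha> powr (1 / p) * \<beta> powr (1 / q)"
  \<comment> \<open>Normalisation is impossible if one of the integrals is zero; then one factor,
    and so the product, vanishes almost everywhere.\<close>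
  proof (cases "\<alpha> = 0 \<or> \<beta> = 0")
    case True
    have "AE x in M. a x powr p = 0 \<or> b x powr q = 0"
    proof (cases "\<alpha> = 0")
      case True
      then have "AE x in M. a x powr p = 0"
        using integral_nonneg_eq_0_iff_AE[OF int(1)] by (simp add: \<alpha>_def)
      then show ?thesis by auto
    next
      case False
      then have "AE x in M. b x powr q = 0"
        using \<open>\<alpha> = 0 \<or> \<beta> = 0\<close> integral_nonneg_eq_0_iff_AE[OF int(2)] by (simp add: \<beta>_def)
      then show ?thesis by auto
    qed
    then have "AE x in M. a x * b x = 0" by eventually_elim auto
    then have "(LINT x|M. a x * b x) = (LINT x|M. 0)" by (intro integral_cong_AE) auto
    then show ?thesis by simp
  next
    case False
    define A where "A = \<alpha> powr (1 / p)"
    define B where "B = \<beta> powr (1 / q)"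
    have pos: "A > 0" "B > 0" using False by (simp_all add: A_def B_def)
    have pw: "A powr p = \<alpha>" "B powr q = \<beta>" using p q nn\<alpha> by (simp_all add: A_def B_def powr_powr)
    have "(LINT x|M. (a x / A) * (b x / B)) \<le> (LINT x|M. a x powr p / (p * \<alpha>) + b x powr q / (q * \<beta>))"
    proof (rule integral_mono)
      show "integrable M (\<lambda>x. (a x / A) * (b x / B))" using ab by simp
      show "integrable M (\<lambda>x. a x powr p / (p * \<alpha>) + b x powr q / (q * \<beta>))" using int by simp
      fix x assume x: "x \<in> space M"
      have "(a x / A) * (b x / B) \<le> (a x / A) powr p / p + (b x / B) powr q / q"
        by (rule young) (use nn[OF x] pos in auto)
      then show "(a x / A) * (b x / B) \<le> a x powr p / (p * \<alpha>) + b x powr q / (q * \<beta>)"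
        using nn[OF x] pos by (simp add: powr_divide pw mult.commute)
    qed
    also have "\<dots> = 1" using int False pq by (simp add: \<alpha>_def[symmetric] \<beta>_def[symmetric])
    finally have "(LINT x|M. a x * b x) / (A * B) \<le> 1" by simp
    then show ?thesis using pos by (simp add: A_def[symmetric] B_def[symmetric] field_simps)
  qed
qed

text \<open>Connects the functionals, defined with the completed measure on \<open>\<Omega>\<close>,
  to the divergence theorem, proved for \<open>lborel\<close>.\<close>

lemma integral_lebesgue_on_eq_set_integral:
  fixes g :: "'a::euclidean_space \<Rightarrow> real"
  assumes "open S" "set_integrable lborel S g"
  shows "integrable (lebesgue_on S) g" and "(LINT x|lebesgue_on S. g x) = (LINT x:S|lborel. g x)"
proof -
  have S: "S \<inter> space lebesgue \<in> sets lebesgue" using assms(1) by simp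
  have meas: "(\<lambda>x. indicator S x *\<^sub>R g x) \<in> borel_measurable lborel"
    using assms(2) by (simp add: set_integrable_def)
  show "integrable (lebesgue_on S) g"
    using assms(2) unfolding integrable_restrict_space[OF S] integrable_completion[OF meas] set_integrable_def .
  show "(LINT x|lebesgue_on S. g x) = (LINT x:S|lborel. g x)"
    unfolding integral_restrict_space[OF S] integral_completion[OF meas] set_lebesgue_integral_def ..
qed

text \<open>The set where \<open>g\<close> is negative is open and null, and a nonempty open set is
  never null.\<close>

lemma AE_nonneg_imp_nonneg_on_open:
  fixes g :: "'a::euclidean_space \<Rightarrow> real"
  assumes "open S" "continuous_on S g" "AE x in lebesgue_on S. 0 \<le> g x" "x \<in> S"
  shows "0 \<le> g x"
proof (rule ccontr)
  assume "\<not> 0 \<le> g x"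
  define T where "T = {x \<in> S. g x < 0}"
  have "T = S \<inter> g -` {..<0}" by (auto simp: T_def)
  then have "open T" using continuous_open_preimage[OF assms(2,1), of "{..<0}"] by simp
  moreover have "T \<noteq> {}" using assms(4) \<open>\<not> 0 \<le> g x\<close> by (auto simp: T_def)
  moreover have "negligible T"
  proof -
    have "AE x in lebesgue. x \<in> S \<longrightarrow> 0 \<le> g x"
      using assms(1,3) by (simp add: AE_restrict_space_iff)
    then have "AE x in lebesgue. x \<notin> T" by eventually_elim (auto simp: T_def)
    then show ?thesis
      using \<open>open T\<close> by (simp add: AE_iff_null_sets negligible_iff_null_sets)
  qed
  ultimately show False using open_not_negligible by blast
qed

section \<open>Test functions and the boundary functional\<close>

lemma Cinf_closure_C1:
  assumes "open \<Omega>" "u \<in> Cinf_closure \<Omega>"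
  shows "C1_on \<Omega> u" and "continuous_on (closure \<Omega>) u"
    and "\<exists>G. continuous_on (closure \<Omega>) G \<and> (\<forall>x\<in>\<Omega>. G x = grad u x)"
proof -
  have D: "set bs \<subseteq> Basis \<Longrightarrow> iterated_partial bs u differentiable_on \<Omega> \<and>
      (\<exists>g. continuous_on (closure \<Omega>) g \<and> (\<forall>x\<in>\<Omega>. g x = iterated_partial bs u x))" for bs
    using assms(2) by (simp add: Cinf_closure_def)
  show "continuous_on (closure \<Omega>) u" using assms(2) by (simp add: Cinf_closure_def)
  show "C1_on \<Omega> u"
    unfolding C1_on_def
  proof (intro conjI ballI)
    show "u differentiable_on \<Omega>" using D[of "[]"] by simp
    fix b :: 'a assume "b \<in> Basis"
    then show "continuous_on \<Omega> (partial_deriv b u)"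
      using D[of "[b]"] by (simp add: differentiable_imp_continuous_on)
  qed
  have "\<forall>b\<in>Basis. \<exists>g. continuous_on (closure \<Omega>) g \<and> (\<forall>x\<in>\<Omega>. g x = partial_deriv b u x)"
  proof
    fix b :: 'a assume "b \<in> Basis"
    then show "\<exists>g. continuous_on (closure \<Omega>) g \<and> (\<forall>x\<in>\<Omega>. g x = partial_deriv b u x)"
      using D[of "[b]"] by simp
  qed
  then obtain g where g: "\<forall>b\<in>Basis. continuous_on (closure \<Omega>) (g b) \<and> (\<forall>x\<in>\<Omega>. g b x = partial_deriv b u x)"
    by metis
  show "\<exists>G. continuous_on (closure \<Omega>) G \<and> (\<forall>x\<in>\<Omega>. G x = grad u x)"
    by (rule exI[of _ "\<lambda>x. \<Sum>b\<in>Basis. g b x *\<^sub>R b"])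
      (use g in \<open>auto simp: grad_def intro!: continuous_on_sum continuous_on_scaleR\<close>)
qed

text \<open>On \<open>Gamma_plus\<close> the flux density of \<open>F\<close> is the integrand of
  \<open>K0_fun\<close>, and on \<open>Gamma_minus\<close> both are zero because \<open>u\<close>
  vanishes there. An inequality is stated so as to cover an integrand that may fail to be
  Borel.\<close>

lemma K0_fun_le_flux:
  fixes \<Omega> :: "'a::euclidean_space set" and f :: "'a \<Rightarrow> 'a" and u :: "'a \<Rightarrow> real" and p :: real
  defines "A \<equiv> SOME A. boundary_partition \<Omega> A" and "F \<equiv> \<lambda>x. \<bar>u x\<bar> powr p *\<^sub>R f x"
  assumes \<Omega>: "open \<Omega>" and A: "boundary_partition \<Omega> A"
    and u: "\<And>x. x \<in> Gamma_minus \<Omega> f \<Longrightarrow> u x = 0"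
    and int: "\<And>b \<gamma> \<zeta>. (b, \<gamma>, \<zeta>) \<in> set A \<Longrightarrow> integrable (hyperplane_measure b) (graph_flux \<Omega> F b \<gamma> \<zeta>)"
  shows "0 \<le> K0_fun \<Omega> f p u"
    and "K0_fun \<Omega> f p u \<le> (\<Sum>(b, \<gamma>, \<zeta>)\<leftarrow>A. LINT y|hyperplane_measure b. graph_flux \<Omega> F b \<gamma> \<zeta> y)"
proof -
  define \<phi> where "\<phi> x = indicator (Gamma_plus \<Omega> f) x * ((f x \<bullet> outward_normal \<Omega> x) * \<bar>u x\<bar> powr p)" for x
  have \<phi>_nonneg: "0 \<le> \<phi> x" for x
    by (auto simp: \<phi>_def Gamma_plus_def indicator_def)
  have K0: "K0_fun \<Omega> f p u = (LINT x|surface_measure \<Omega>. \<phi> x)"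
    by (simp add: K0_fun_def set_lebesgue_integral_def \<phi>_def)
  then show "0 \<le> K0_fun \<Omega> f p u" by (simp add: \<phi>_nonneg)
  have flux: "graph_flux \<Omega> F b \<gamma> \<zeta> = (\<lambda>y. \<zeta> (graph_point b \<gamma> y) *
      sqrt (1 + (norm (grad \<gamma> (graph_point b \<gamma> y)))\<^sup>2) * \<phi> (graph_point b \<gamma> y))"
    if a: "(b, \<gamma>, \<zeta>) \<in> set A" for b \<gamma> \<zeta>
  proof
    fix y
    let ?x = "graph_point b \<gamma> y"
    obtain U s where U: "graph_chart \<Omega> U b s \<gamma>" "closure {x. \<zeta> x \<noteq> 0} \<subseteq> U"
      using boundary_partitionD(4)[OF A a] by blast
    have "\<zeta> ?x = 0 \<or> F ?x \<bullet> outward_normal \<Omega> ?x = \<phi> ?x"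
    proof (cases "\<zeta> ?x = 0")
      case False
      then have "?x \<in> U" using U(2) closure_subset[of "{x. \<zeta> x \<noteq> 0}"] by auto
      then have "?x \<in> frontier \<Omega>" by (rule graph_chart_graph_point_frontier[OF \<Omega> U(1)])
      then have "?x \<in> Gamma_plus \<Omega> f \<or> ?x \<in> Gamma_minus \<Omega> f"
        by (auto simp: Gamma_plus_def Gamma_minus_def)
      then show ?thesis
        using u[of ?x] by (auto simp: F_def \<phi>_def indicator_def)
    qed simp
    then show "graph_flux \<Omega> F b \<gamma> \<zeta> y = \<zeta> ?x * sqrt (1 + (norm (grad \<gamma> ?x))\<^sup>2) * \<phi> ?x"
      by (auto simp: graph_flux_def)
  qed
  have J_nonneg: "0 \<le> (\<Sum>(b, \<gamma>, \<zeta>)\<leftarrow>A. LINT y|hyperplane_measure b. graph_flux \<Omega> F b \<gamma> \<zeta> y)"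
  proof (rule sum_list_nonneg)
    fix j assume "j \<in> set (map (\<lambda>(b, \<gamma>, \<zeta>). LINT y|hyperplane_measure b. graph_flux \<Omega> F b \<gamma> \<zeta> y) A)"
    then obtain b \<gamma> \<zeta> where a: "(b, \<gamma>, \<zeta>) \<in> set A"
      and j: "j = (LINT y|hyperplane_measure b. graph_flux \<Omega> F b \<gamma> \<zeta> y)" by auto
    show "0 \<le> j" unfolding j flux[OF a]
      by (rule Bochner_Integration.integral_nonneg) (simp add: \<phi>_nonneg boundary_partitionD(2)[OF A a])
  qed
  show "K0_fun \<Omega> f p u \<le> (\<Sum>(b, \<gamma>, \<zeta>)\<leftarrow>A. LINT y|hyperplane_measure b. graph_flux \<Omega> F b \<gamma> \<zeta> y)"
  proof (cases "\<phi> \<in> borel_measurable borel")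
    case True
    have "K0_fun \<Omega> f p u = (\<Sum>(b, \<gamma>, \<zeta>)\<leftarrow>A. LINT y|hyperplane_measure b.
      \<zeta> (graph_point b \<gamma> y) * sqrt (1 + (norm (grad \<gamma> (graph_point b \<gamma> y)))\<^sup>2) * \<phi> (graph_point b \<gamma> y))"
      unfolding K0 A_def
      by (rule surface_integral_nonneg_eq[OF A[unfolded A_def] \<phi>_nonneg True])
        (use int flux in \<open>simp flip: A_def\<close>)
    also have "\<dots> = (\<Sum>(b, \<gamma>, \<zeta>)\<leftarrow>A. LINT y|hyperplane_measure b. graph_flux \<Omega> F b \<gamma> \<zeta> y)"
      by (intro arg_cong[of _ _ sum_list] map_cong refl) (auto simp: flux)
    finally show ?thesis by simp
  next
    case False
    \<comment> \<open>In this case the Bochner integral takes its default value 0, which lies below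
      the nonnegative flux.\<close>
    have "\<not> integrable (surface_measure \<Omega>) \<phi>"
    proof
      assume "integrable (surface_measure \<Omega>) \<phi>"
      then have "\<phi> \<in> borel_measurable (surface_measure \<Omega>)" by simp
      with False show False
        by (simp add: measurable_cong_sets[OF sets_surface_measure refl])
    qed
    then have "K0_fun \<Omega> f p u = 0" unfolding K0 by (rule not_integrable_integral_eq)
    then show ?thesis using J_nonneg by simp
  qed
qed

theorem theorem2p1:
  fixes \<Omega> :: "'a::euclidean_space set"
    and f :: "'a \<Rightarrow> 'a"
    and v w u :: "'a \<Rightarrow> real"
    and p p' :: real
  assumes "p > 1" and "1 / p + 1 / p' = 1"
    and "DIM('a) \<ge> 2"
    and "open \<Omega>" and "connected \<Omega>" and "\<Omega> \<noteq> {}" and "bounded \<Omega>"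
    and "C1_boundary \<Omega>"
    and "C1_on \<Omega> f" and "continuous_on (closure \<Omega>) f"
    and "\<And>x. x \<in> \<Omega> \<Longrightarrow> norm (f x) \<noteq> 0"
    and "v \<in> borel_measurable (lebesgue_on \<Omega>)" and "\<And>x. x \<in> \<Omega> \<Longrightarrow> v x > 0"
    and "w \<in> borel_measurable (lebesgue_on \<Omega>)" and "\<And>x. x \<in> \<Omega> \<Longrightarrow> w x \<ge> 0"
    and "integrable (lebesgue_on \<Omega>) (\<lambda>x. v x powr (1 - p))"
    and "AE x in lebesgue_on \<Omega>.
           - divergence f x - (p - 1) * v x * norm (f x) powr p' \<ge> w x"
    and "u \<in> Cinf_Gamma_minus \<Omega> f"
    and "\<exists>x\<in>\<Omega>. u x \<noteq> 0"
  shows "L_fun \<Omega> f v p u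
           \<ge> (1 / p) powr p *
             ((K0_fun \<Omega> f p u + (p - 1) * K_fun \<Omega> f v p p' u + N_fun \<Omega> w p u) powr p
              / K_fun \<Omega> f v p p' u powr (p - 1))"
proof -
  note p = assms(1) and pp' = assms(2) and \<Omega> = assms(4) \<open>bounded \<Omega>\<close>
    and f = \<open>C1_on \<Omega> f\<close> \<open>continuous_on (closure \<Omega>) f\<close>
    and v_pos = assms(13) and w_nonneg = assms(15) and AE = assms(17)
  have [measurable]: "v \<in> borel_measurable (lebesgue_on \<Omega>)" "w \<in> borel_measurable (lebesgue_on \<Omega>)"
    by fact+
  let ?M = "lebesgue_on \<Omega>"
  define K where "K = K_fun \<Omega> f v p p' u"
  define L where "L = L_fun \<Omega> f v p u"
  define N where "N = N_fun \<Omega> w p u"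
  define K0 where "K0 = K0_fun \<Omega> f p u"
  have p'_eq: "1 / p' = (p - 1) / p" "p - 1 = p / p'"
  proof -
    have "1 / p' = 1 - 1 / p" using pp' by simp
    then show "1 / p' = (p - 1) / p" using p by (simp add: field_simps)
    then show "p - 1 = p / p'" using p by (simp add: field_simps)
  qed
  have p'_pos: "p' > 0" using p'_eq(1) p by (metis diff_gt_0_iff_gt divide_pos_pos less_trans zero_less_divide_1_iff zero_less_one)

  have u_Cinf: "u \<in> Cinf_closure \<Omega>" and u_van: "\<And>x. x \<in> Gamma_minus \<Omega> f \<Longrightarrow> u x = 0"
    using assms(18) unfolding Cinf_Gamma_minus_def Gamma_minus_def frontier_def by blast+
  note u = Cinf_closure_C1[OF \<Omega>(1) u_Cinf]
  \<comment> \<open>\<open>grad u\<close> is controlled only inside \<open>\<Omega>\<close>; its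
    continuous extension \<open>G\<close> provides bounds on the compact closure and
    measurability.\<close>
  obtain G where G: "continuous_on (closure \<Omega>) G" "\<And>x. x \<in> \<Omega> \<Longrightarrow> G x = grad u x"
    using u(3) by blast
  define d where "d t = p * (max 0 t powr (p - 1) - max 0 (- t) powr (p - 1))" for t
  have d_deriv: "((\<lambda>t. \<bar>t\<bar> powr p) has_real_derivative d t) (at t)" for t
    unfolding d_def by (rule has_real_derivative_abs_powr[OF p])
  have d_cont: "continuous_on S d" for S
    unfolding d_def[abs_def] using p by (intro continuous_intros continuous_on_powr') auto
  have d_abs: "\<bar>d t\<bar> = p * \<bar>t\<bar> powr (p - 1)" for t
    using p by (cases "t \<ge> 0") (auto simp: d_def max_def abs_mult)
  define h where "h x = \<bar>u x\<bar> powr p" for x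
  have h_cont: "continuous_on (closure \<Omega>) h"
    unfolding h_def[abs_def] using p u(2) by (intro continuous_on_powr' continuous_intros) auto
  have h_C1: "C1_on \<Omega> h" and grad_h: "\<And>x. x \<in> \<Omega> \<Longrightarrow> grad h x = d (u x) *\<^sub>R grad u x"
  proof -
    have c: "continuous_on \<Omega> (\<lambda>x. d (u x))"
      by (rule continuous_on_compose2[OF d_cont C1_on_imp_continuous_on[OF u(1)]]) auto
    show "C1_on \<Omega> h" unfolding h_def[abs_def] by (rule C1_on_compose(1)[OF \<Omega>(1) u(1) d_deriv c])
    show "grad h x = d (u x) *\<^sub>R grad u x" if "x \<in> \<Omega>" for x
      unfolding h_def[abs_def] by (rule C1_on_compose(2)[OF \<Omega>(1) u(1) d_deriv c that])
  qed
  have h_nonneg: "0 \<le> h x" for x by (simp add: h_def)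
  define F where "F x = h x *\<^sub>R f x" for x
  have F: "C1_on \<Omega> F" "continuous_on (closure \<Omega>) F"
    unfolding F_def[abs_def]
    by (rule C1_on_scaleR(1)[OF \<Omega>(1) h_C1 f(1)], intro continuous_on_scaleR h_cont f(2))
  \<comment> \<open>The part of div F that contains grad u, written with \<open>G\<close> so that it
    is continuous, hence bounded, on the closure.\<close>
  define B where "B x = d (u x) * (f x \<bullet> G x)" for x
  have B_cont: "continuous_on (closure \<Omega>) B"
    unfolding B_def[abs_def]
    by (intro continuous_on_mult continuous_on_inner f(2) G(1) continuous_on_compose2[OF d_cont u(2)]) auto
  have div_F: "divergence F x = h x * divergence f x + B x" if "x \<in> \<Omega>" for x
    unfolding F_def[abs_def] C1_on_scaleR(2)[OF \<Omega>(1) h_C1 f(1) that]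
    by (simp add: grad_h[OF that] B_def G(2)[OF that] inner_commute)

  \<comment> \<open>The divergence theorem asks for a bound at every point, whereas the hypothesis
    holds almost everywhere; continuity of div f in \<open>\<Omega>\<close> closes the gap.\<close>
  have div_f: "divergence f x \<le> 0" if "x \<in> \<Omega>" for x
  proof -
    have "AE x in ?M. 0 \<le> - divergence f x"
    proof -
      have "AE x in ?M. x \<in> \<Omega>" by (rule AE_I2) simp
      with AE show ?thesis
      proof eventually_elim
        case (elim x)
        have "0 \<le> (p - 1) * v x * norm (f x) powr p'" using p v_pos[OF elim(2)] by simp
        then show ?case using elim w_nonneg[OF elim(2)] by linarith
      qed
    qed
    then have "0 \<le> - divergence f x"
      by (rule AE_nonneg_imp_nonneg_on_open[OF \<Omega>(1) _ _ that, rotated])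
        (intro continuous_on_minus C1_on_continuous_on_divergence f(1))
    then show ?thesis by simp
  qed
  obtain C where C: "\<And>x. x \<in> closure \<Omega> \<Longrightarrow> \<bar>B x\<bar> \<le> C"
    using compact_imp_bounded[OF compact_continuous_image[OF B_cont]] \<Omega>(2)
    by (force simp: bounded_iff)
  have div_F_le: "divergence F x \<le> C" if "x \<in> \<Omega>" for x
  proof -
    have "h x * divergence f x \<le> 0" using h_nonneg div_f[OF that] by (rule mult_nonneg_nonpos)
    moreover have "\<bar>B x\<bar> \<le> C" using C that closure_subset by blast
    ultimately show ?thesis unfolding div_F[OF that] by linarith
  qed
  \<comment> \<open>The very partition inside the definition of \<open>surface_measure\<close>, so
    that the flux can be compared with \<open>K0_fun\<close>.\<close>
  define A where "A = (SOME A. boundary_partition \<Omega> A)"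
  have A: "boundary_partition \<Omega> A"
    unfolding A_def by (rule someI_ex[OF boundary_partition_exists]) fact+
  have divergence: "\<And>b \<gamma> \<zeta>. (b, \<gamma>, \<zeta>) \<in> set A \<Longrightarrow> integrable (hyperplane_measure b) (graph_flux \<Omega> F b \<gamma> \<zeta>)"
    "set_integrable lborel \<Omega> (divergence F)"
    "(LINT x:\<Omega>|lborel. divergence F x) =
      (\<Sum>(b, \<gamma>, \<zeta>)\<leftarrow>A. LINT y|hyperplane_measure b. graph_flux \<Omega> F b \<gamma> \<zeta> y)"
    by (rule divergence_theorem[OF \<Omega> A F div_F_le]; assumption)+
  have F_eq: "F = (\<lambda>x. \<bar>u x\<bar> powr p *\<^sub>R f x)" by (simp add: F_def h_def fun_eq_iff)
  have K0: "0 \<le> K0" "K0 \<le> (LINT x:\<Omega>|lborel. divergence F x)"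
  proof -
    note K0 = K0_fun_le_flux[OF \<Omega>(1) A[unfolded A_def], of f u p, folded A_def F_eq, OF u_van divergence(1)]
    show "0 \<le> K0" unfolding K0_def by (rule K0(1))
    show "K0 \<le> (LINT x:\<Omega>|lborel. divergence F x)"
      unfolding K0_def by (rule K0(2)[folded divergence(3)])
  qed
  note div_int = integral_lebesgue_on_eq_set_integral[OF \<Omega>(1) divergence(2)]
  note B_int = integral_lebesgue_on_eq_set_integral[OF \<Omega>(1) set_integrable_continuous_on_closure[OF \<Omega> B_cont]]

  \<comment> \<open>\<open>q\<close> dominates the integrands of (p - 1) K and N. It is the
    difference of the integrable functions \<open>B\<close> and div F, which makes both functionals
    finite.\<close>
  define q where "q x = h x * - divergence f x" for x
  have q_eq: "q x = B x - divergence F x" if "x \<in> \<Omega>" for x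
    by (simp add: q_def div_F[OF that])
  have q_int: "integrable ?M q"
    by (rule Bochner_Integration.integrable_cong[THEN iffD2, OF refl _
          Bochner_Integration.integrable_diff[OF B_int(1) div_int(1)]]) (simp add: q_eq)
  have q_integral: "(LINT x|?M. q x) = (LINT x|?M. B x) - (LINT x:\<Omega>|lborel. divergence F x)"
  proof -
    have "(LINT x|?M. q x) = (LINT x|?M. B x - divergence F x)"
      by (rule Bochner_Integration.integral_cong) (simp_all add: q_eq)
    then show ?thesis using Bochner_Integration.integral_diff[OF B_int(1) div_int(1)] div_int(2) by simp
  qed

  have meas: "g \<in> borel_measurable ?M" if "continuous_on (closure \<Omega>) g" for g :: "'a \<Rightarrow> 'b::real_normed_vector"
    by (rule continuous_imp_measurable_on_sets_lebesgue[OF continuous_on_subset[OF that closure_subset]])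
      (use \<Omega>(1) in simp)
  note [measurable] = meas[OF f(2)] meas[OF h_cont] meas[OF u(2)] meas[OF G(1)] meas[OF B_cont]
  define k where "k x = v x * norm (f x) powr p' * h x" for x
  define l where "l x = v x powr (1 - p) * \<bar>(f x \<bullet> G x) / norm (f x)\<bar> powr p" for x
  have [measurable]: "k \<in> borel_measurable ?M" "l \<in> borel_measurable ?M"
    unfolding k_def[abs_def] l_def[abs_def] by measurable
  have k_nonneg: "0 \<le> k x" if "x \<in> \<Omega>" for x using v_pos[OF that] h_nonneg by (simp add: k_def)
  have kw: "AE x in ?M. (p - 1) * k x + w x * h x \<le> q x"
    using AE
  proof eventually_elim
    case (elim x)
    then have "((p - 1) * v x * norm (f x) powr p' + w x) * h x \<le> - divergence f x * h x"
      by (intro mult_right_mono h_nonneg) simp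
    then show ?case by (simp add: k_def q_def algebra_simps)
  qed
  have in\<Omega>: "AE x in ?M. x \<in> \<Omega>" by (rule AE_I2) simp
  have pk_int: "integrable ?M (\<lambda>x. (p - 1) * k x)"
  proof (rule Bochner_Integration.integrable_bound[OF q_int])
    show "AE x in ?M. norm ((p - 1) * k x) \<le> norm (q x)"
      using kw in\<Omega>
    proof eventually_elim
      case (elim x)
      have "0 \<le> (p - 1) * k x" "0 \<le> w x * h x"
        using p k_nonneg[OF elim(2)] w_nonneg[OF elim(2)] h_nonneg by simp_all
      then show ?case using elim(1) by simp
    qed
  qed measurable
  then have k_int: "integrable ?M k" using p by simp
  have w_int: "integrable ?M (\<lambda>x. w x * h x)"
  proof (rule Bochner_Integration.integrable_bound[OF q_int])
    show "AE x in ?M. norm (w x * h x) \<le> norm (q x)"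
      using kw in\<Omega>
    proof eventually_elim
      case (elim x)
      have "0 \<le> (p - 1) * k x" "0 \<le> w x * h x"
        using p k_nonneg[OF elim(2)] w_nonneg[OF elim(2)] h_nonneg by simp_all
      then show ?case using elim(1) by simp
    qed
  qed measurable
  have K_eq: "K = (LINT x|?M. k x)" and N_eq: "N = (LINT x|?M. w x * h x)"
    by (simp_all add: K_def K_fun_def k_def N_def N_fun_def h_def)
  have L_eq: "L = (LINT x|?M. l x)"
    unfolding L_def L_fun_def l_def
    by (rule Bochner_Integration.integral_cong) (simp_all add: G(2))
  have nonneg: "0 \<le> K" "0 \<le> N" "0 \<le> L"
    unfolding K_eq N_eq L_eq using k_nonneg w_nonneg h_nonneg
    by (auto intro!: Bochner_Integration.integral_nonneg simp: l_def)
  have "(p - 1) * K + N = (LINT x|?M. (p - 1) * k x + w x * h x)"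
    using k_int w_int by (simp add: K_eq N_eq)
  also have "\<dots> \<le> (LINT x|?M. q x)"
    by (rule integral_mono_AE) (use k_int w_int q_int kw in auto)
  finally have upper: "K0 + (p - 1) * K + N \<le> (LINT x|?M. B x)"
    using K0(2) q_integral by linarith

  \<comment> \<open>Integrability of \<open>v x powr (1 - p)\<close> enters here: by Cauchy-Schwarz
    the normalised directional derivative is at most |G|, which is bounded.\<close>
  have l_int: "integrable ?M l"
  proof -
    obtain C where C: "\<And>x. x \<in> closure \<Omega> \<Longrightarrow> norm (G x) \<le> C"
      using compact_imp_bounded[OF compact_continuous_image[OF G(1)]] \<Omega>(2)
      by (force simp: bounded_iff)
    show ?thesis
    proof (rule Bochner_Integration.integrable_bound)
      show "integrable ?M (\<lambda>x. v x powr (1 - p) * C powr p)" using assms(16) by simp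
      show "AE x in ?M. norm (l x) \<le> norm (v x powr (1 - p) * C powr p)"
      proof (rule AE_I2)
        fix x assume "x \<in> space ?M"
        then have x: "x \<in> \<Omega>" by simp
        have "\<bar>f x \<bullet> G x\<bar> / norm (f x) \<le> norm (G x)"
          using Cauchy_Schwarz_ineq2[of "f x" "G x"] assms(11)[OF x]
          by (simp add: divide_le_eq mult.commute)
        also have "\<dots> \<le> C" using C x closure_subset by blast
        finally have "\<bar>(f x \<bullet> G x) / norm (f x)\<bar> powr p \<le> C powr p"
          using p by (intro powr_mono2) auto
        then show "norm (l x) \<le> norm (v x powr (1 - p) * C powr p)"
          unfolding l_def by (simp add: mult_left_mono)
      qed
    qed measurable
  qed

  \<comment> \<open>The powers of \<open>v\<close> cancel in the product and so do the factors |f|,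
    leaving |B| / p. The exponents fit because -p/p' = 1 - p and (p - 1) p' = p.\<close>
  define \<alpha> where "\<alpha> x = v x powr (- (1 / p')) * (\<bar>f x \<bullet> G x\<bar> / norm (f x))" for x
  define \<beta> where "\<beta> x = v x powr (1 / p') * norm (f x) * \<bar>u x\<bar> powr (p - 1)" for x
  have [measurable]: "\<alpha> \<in> borel_measurable ?M" "\<beta> \<in> borel_measurable ?M"
    unfolding \<alpha>_def[abs_def] \<beta>_def[abs_def] by measurable
  have \<alpha>_powr: "\<alpha> x powr p = l x" and \<beta>_powr: "\<beta> x powr p' = k x"
    and \<alpha>\<beta>: "\<bar>B x\<bar> = p * (\<alpha> x * \<beta> x)" if x: "x \<in> \<Omega>" for x
  proof -
    have "- (1 / p') * p = 1 - p" using p'_eq(2) by simp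
    moreover have "\<alpha> x powr p = (v x powr (- (1 / p'))) powr p * (\<bar>f x \<bullet> G x\<bar> / norm (f x)) powr p"
      unfolding \<alpha>_def by (rule powr_mult)
    ultimately show "\<alpha> x powr p = l x"
      by (simp add: l_def powr_powr)
    have "(p - 1) * p' = p" using p'_eq(2) p'_pos by simp
    then show "\<beta> x powr p' = k x"
      using p'_pos v_pos[OF x] by (simp add: \<beta>_def k_def h_def powr_mult powr_powr)
    have "v x powr (- (1 / p')) * v x powr (1 / p') = 1"
      using v_pos[OF x] by (simp flip: powr_add)
    moreover have "\<alpha> x * \<beta> x = (v x powr (- (1 / p')) * v x powr (1 / p')) *
        (\<bar>f x \<bullet> G x\<bar> / norm (f x) * norm (f x)) * \<bar>u x\<bar> powr (p - 1)"
      unfolding \<alpha>_def \<beta>_def by (simp only: mult_ac)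
    ultimately show "\<bar>B x\<bar> = p * (\<alpha> x * \<beta> x)"
      using assms(11)[OF x] by (simp add: B_def abs_mult d_abs mult_ac)
  qed
  have "integrable ?M (\<lambda>x. \<alpha> x powr p)" "integrable ?M (\<lambda>x. \<beta> x powr p')"
    by (rule Bochner_Integration.integrable_cong[THEN iffD2, OF refl _ l_int], simp add: \<alpha>_powr)
      (rule Bochner_Integration.integrable_cong[THEN iffD2, OF refl _ k_int], simp add: \<beta>_powr)
  moreover have "0 \<le> \<alpha> x" "0 \<le> \<beta> x" for x by (simp_all add: \<alpha>_def \<beta>_def)
  ultimately have "(LINT x|?M. \<alpha> x * \<beta> x) \<le> (LINT x|?M. \<alpha> x powr p) powr (1 / p) * (LINT x|?M. \<beta> x powr p') powr (1 / p')"
    by (intro Holder_inequality(2)[OF p pp']) auto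
  also have "\<dots> = L powr (1 / p) * K powr (1 / p')"
    unfolding L_eq K_eq
    by (intro arg_cong2[of _ _ _ _ "(*)"] arg_cong2[of _ _ _ _ "(powr)"] Bochner_Integration.integral_cong refl)
      (simp_all add: \<alpha>_powr \<beta>_powr)
  finally have holder: "(LINT x|?M. \<alpha> x * \<beta> x) \<le> L powr (1 / p) * K powr (1 / p')" .
  have "(LINT x|?M. B x) \<le> (LINT x|?M. \<bar>B x\<bar>)"
    by (rule integral_mono) (use B_int(1) in auto)
  also have "\<dots> = p * (LINT x|?M. \<alpha> x * \<beta> x)"
    by (subst Bochner_Integration.integral_mult_right_zero[symmetric], rule Bochner_Integration.integral_cong)
      (simp_all add: \<alpha>\<beta>)
  also have "\<dots> \<le> p * (L powr (1 / p) * K powr (1 / p'))"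
    using holder p by simp
  finally have bound: "K0 + (p - 1) * K + N \<le> p * (L powr (1 / p) * K powr (1 / p'))"
    using upper by simp

  have "(K0 + (p - 1) * K + N) powr p \<le> (p * (L powr (1 / p) * K powr (1 / p'))) powr p"
    by (rule powr_mono2) (use p bound nonneg K0(1) in auto)
  also have "\<dots> = p powr p * (L * K powr (p - 1))"
    using p nonneg p'_eq(2) by (simp add: powr_mult powr_powr)
  finally have main: "(K0 + (p - 1) * K + N) powr p \<le> p powr p * (L * K powr (p - 1))" .
  have "(1 / p) powr p * ((K0 + (p - 1) * K + N) powr p / K powr (p - 1)) \<le> L"
  \<comment> \<open>If K = 0, the denominator is zero and the quotient is 0 by convention, so the
    claim reduces to L \<ge> 0.\<close>
  proof (cases "K = 0")
    case False
    then have "K powr (p - 1) > 0" using nonneg by simp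
    then have "(K0 + (p - 1) * K + N) powr p / K powr (p - 1) \<le> p powr p * L"
      using main by (simp add: divide_le_eq mult.assoc)
    then have "(1 / p) powr p * ((K0 + (p - 1) * K + N) powr p / K powr (p - 1)) \<le> (1 / p) powr p * (p powr p * L)"
      by (intro mult_left_mono) auto
    also have "\<dots> = L" using p by (simp add: powr_divide)
    finally show ?thesis .
  qed (use nonneg in simp)
  then show ?thesis by (simp add: K_def L_def N_def K0_def)
qed

end
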